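(* Let $M\ge 2$ and $N\ge 0$ be integers and let $\Sigma_D$ be the $(M,N)$ Dyck-Motzkin shift. The space $M^{\rm e}(\Sigma_D)$ of shift-invariant ergodic Borel probability measures on $\Sigma_D$ is path connected and locally path connected with respect to the weak* topology.
   Context: Dyck-Motzkin shift: let $M\ge2$, $N\ge0$ be integers, $D_\alpha=\{\alpha_1,\ldots,\alpha_M\}$, $D_\beta=\{\beta_1,\ldots,\beta_M\}$, $D_0=\{1_1,\ldots,1_N\}$ (empty if $N=0$), and let $D=D_\alpha\cup D_0\cup D_\beta$, a finite alphabet of $2M+N$ distinct symbols. Let $D^*$ be the set of finite words in $D$. Consider the monoid with zero $0$ and unit $1$, generated by $D$, with relations: $\alpha_i\cdot\beta_j=\delta_{i,j}$ (Kronecker delta, i.e. $1$ if $i=j$ and $0$ otherwise) for $i,j\in\{1,\ldots,M\}$; $0\cdot0=0$; $1_k\cdot 1_\ell=1$ for $k,\ell\in\{1,\ldots,N\}$; $\omega\cdot1=1\cdot\omega=\omega$ and $\omega\cdot0=0\cdot\omega=0$ for $\omega\in D^*\cup\{1\}$; $\omega\cdot1_\ell=1_\ell\cdot\omega=\omega$ for $\omega\in D^*$, $\ell\in\{1,\ldots,N\}$. For a word $\omega_1\cdots\omega_n\in D^*$, let ${\rm red}(\omega_1\cdots\omega_n)=\prod_{i=1}^n\omega_i$ be its product in this monoid. The $(M,N)$ Dyck-Motzkin shift is $$\Sigma_D=\{x=(x_i)_{i\in\mathbb Z}\in D^{\mathbb Z}\colon {\rm red}(x_j\cdots x_k)\neq0\text{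 for all }j,k\in\mathbb Z\text{ with }j<k\},$$ with the topology induced from the product topology on $D^{\mathbb Z}$ ($D$ discrete), and with the left shift $\sigma$, $(\sigma x)_i=x_{i+1}$. A topological space $X$ is path connected if for any two distinct points $x,y\in X$ there is a continuous map $p\colon[0,1]\to X$ with $p(0)=x$, $p(1)=y$. It is locally path connected if any point of it has a neighborhood base consisting of open sets that are path connected. *)

theory Defs
  imports "HOL-Probability.Probability"
begin

datatype dm_symbol = Sym_alpha nat | Sym_one nat | Sym_beta nat

instantiation dm_symbol :: discrete_topology
begin

definition open_dm_symbol :: "dm_symbol set \<Rightarrow> bool"
  where "open_dm_symbol A \<longleftrightarrow> True"

instance
  by standard (simp_all add: open_dm_symbol_def)

end

definition dm_alphabet :: "nat \<Rightarrow> nat \<Rightarrow> dm_symbol set"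
  where "dm_alphabet M N = Sym_alpha ` {1..M} \<union> Sym_one ` {1..N} \<union> Sym_beta ` {1..M}"

text \<open>
  The free monoid with zero over the alphabet consists of \<open>None\<close>, which is the zero, and of
  \<open>Some w\<close> for words \<open>w\<close>, with unit \<open>Some []\<close>. The Dyck-Motzkin monoid is its quotient by the
  smallest congruence \<open>dm_cong\<close> containing the defining relations. The laws for \<open>0\<close> and \<open>1\<close>
  already hold in the free monoid with zero, by the definition of \<open>zmult\<close>.
\<close>

fun zmult :: "'a list option \<Rightarrow> 'a list option \<Rightarrow> 'a list option" where
  "zmult (Some u) (Some v) = Some (u @ v)"
| "zmult _ _ = None"

definition free_zero_monoid :: "'a set \<Rightarrow> 'a list option set"
  where "free_zero_monoid A = insert None (Some ` lists A)"

inductive dm_cong :: "nat \<Rightarrow> nat \<Rightarrow> dm_symbol list option \<Rightarrow> dm_symbol list option \<Rightarrow> bool"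
  for M N where
  alpha_beta_eq: "i \<in> {1..M} \<Longrightarrow> dm_cong M N (Some [Sym_alpha i, Sym_beta i]) (Some [])"
| alpha_beta_neq: "i \<in> {1..M} \<Longrightarrow> j \<in> {1..M} \<Longrightarrow> i \<noteq> j \<Longrightarrow>
    dm_cong M N (Some [Sym_alpha i, Sym_beta j]) None"
| one_one: "k \<in> {1..N} \<Longrightarrow> l \<in> {1..N} \<Longrightarrow> dm_cong M N (Some [Sym_one k, Sym_one l]) (Some [])"
| one_right: "w \<in> lists (dm_alphabet M N) \<Longrightarrow> l \<in> {1..N} \<Longrightarrow>
    dm_cong M N (Some (w @ [Sym_one l])) (Some w)"
| one_left: "w \<in> lists (dm_alphabet M N) \<Longrightarrow> l \<in> {1..N} \<Longrightarrow>
    dm_cong M N (Some (Sym_one l # w)) (Some w)"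
| refl: "a \<in> free_zero_monoid (dm_alphabet M N) \<Longrightarrow> dm_cong M N a a"
| sym: "dm_cong M N a b \<Longrightarrow> dm_cong M N b a"
| trans: "dm_cong M N a b \<Longrightarrow> dm_cong M N b c \<Longrightarrow> dm_cong M N a c"
| mult: "dm_cong M N a a' \<Longrightarrow> dm_cong M N b b' \<Longrightarrow> dm_cong M N (zmult a b) (zmult a' b')"

text \<open>
  Elements of the monoid are congruence classes. As multiplication in the quotient is induced by
  concatenation, the product of the letters of \<open>w\<close> is the class of \<open>w\<close>.
\<close>

definition dm_class :: "nat \<Rightarrow> nat \<Rightarrow> dm_symbol list option \<Rightarrow> dm_symbol list option set"
  where "dm_class M N a = {b. dm_cong M N a b}"

definition dm_red :: "nat \<Rightarrow> nat \<Rightarrow> dm_symbol list \<Rightarrow> dm_symbol list option set"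
  where "dm_red M N w = dm_class M N (Some w)"

definition dm_zero :: "nat \<Rightarrow> nat \<Rightarrow> dm_symbol list option set"
  where "dm_zero M N = dm_class M N None"

definition dyck_motzkin_shift :: "nat \<Rightarrow> nat \<Rightarrow> (int \<Rightarrow> dm_symbol) set"
  where "dyck_motzkin_shift M N =
    {x. (\<forall>i. x i \<in> dm_alphabet M N) \<and> (\<forall>j k. j < k \<longrightarrow> dm_red M N (map x [j..k]) \<noteq> dm_zero M N)}"

definition left_shift :: "(int \<Rightarrow> 'a) \<Rightarrow> int \<Rightarrow> 'a"
  where "left_shift x = (\<lambda>i. x (i + 1))"

definition borel_prob_measures :: "'a::topological_space set \<Rightarrow> 'a measure set"
  where "borel_prob_measures X = {\<mu>. prob_space \<mu> \<and> sets \<mu> = sets (restrict_space borel X)}"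

definition invariant_measures :: "('a::topological_space \<Rightarrow> 'a) \<Rightarrow> 'a set \<Rightarrow> 'a measure set"
  where "invariant_measures T X = {\<mu> \<in> borel_prob_measures X.
    \<forall>A\<in>sets \<mu>. emeasure \<mu> (T -` A \<inter> space \<mu>) = emeasure \<mu> A}"

definition ergodic_measures :: "('a::topological_space \<Rightarrow> 'a) \<Rightarrow> 'a set \<Rightarrow> 'a measure set"
  where "ergodic_measures T X = {\<mu> \<in> invariant_measures T X.
    \<forall>A\<in>sets \<mu>. T -` A \<inter> space \<mu> = A \<longrightarrow> emeasure \<mu> A = 0 \<or> emeasure \<mu> A = 1}"

text \<open>
  The coarsest topology making \<open>\<mu> \<mapsto> \<integral>f d\<mu>\<close> continuous for every continuous real function \<open>f\<close>
  on \<open>X\<close>. It is meant for compact \<open>X\<close>, where all such \<open>f\<close> are bounded, hence integrable.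
\<close>

definition weak_star_topology :: "'a::topological_space set \<Rightarrow> 'a measure topology"
  where "weak_star_topology X = topology_generated_by
    {{\<mu> \<in> borel_prob_measures X. (LINT x|\<mu>. f x) \<in> U} | (f :: 'a \<Rightarrow> real) U.
      continuous_on X f \<and> open U}"

definition ergodic_measure_space :: "('a::topological_space \<Rightarrow> 'a) \<Rightarrow> 'a set \<Rightarrow> 'a measure topology"
  where "ergodic_measure_space T X = subtopology (weak_star_topology X) (ergodic_measures T X)"

end

theory Submission
  imports Defs
begin

text \<open>
  A word of brackets reduces to \<open>\<beta>\<close>'s followed by \<open>\<alpha>\<close>'s, unless a mismatch makes it \<open>0\<close>. Words
  which reduce to \<open>\<alpha>\<close>'s only (\<open>opening_words\<close>) can be concatenated in any order without ever creating
  a mismatch, and so can words which reduce to \<open>\<beta>\<close>'s only (\<open>closing_words\<close>); words which reduce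
  to \<open>1\<close> belong to both classes. Inside one class the shift behaves like a full shift, and the
  classical argument for full shifts applies: choose between two words \<open>u\<close> and \<open>v\<close> of the same length
  by independent coin tosses with bias \<open>t\<close>, and concatenate. This gives an ergodic measure for every
  \<open>t \<in> [0, 1]\<close>, and as \<open>t\<close> varies a path from the periodic orbit of \<open>u\<close> to that of \<open>v\<close>. Passing to
  powers of \<open>u\<close> and \<open>v\<close> changes neither end, but pushes the path as close as desired to the segment
  of convex combinations of its ends (\<open>mix_freq_nearly_affine\<close>, \<open>nearly_affinely_connected_orbits\<close>).

  The other ingredient is approximation by periodic orbits. Let \<open>\<mu>\<close> be ergodic and \<open>d\<close> its drift, the
  integral of the height that counts \<open>\<alpha>\<close> as \<open>1\<close> and \<open>\<beta>\<close> as \<open>-1\<close>. By Birkhoff's theorem \<open>\<mu>\<close> has a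
  generic point, and the orbit of a long block of it is close to \<open>\<mu>\<close>. If \<open>d \<ge> 0\<close>, the number of
  unmatched \<open>\<beta>\<close>'s in a block of length \<open>n\<close> is \<open>o(n)\<close>, as it is the depth of the deepest dip of the
  height; putting the matching \<open>\<alpha>\<close>'s in front makes the block an opening word and is invisible in the
  limit. If \<open>d \<le> 0\<close>, closing words are obtained in the same way, and if \<open>d = 0\<close> words of both classes
  (\<open>drift_approximation\<close>).

  Infinitely many nearly affine paths between better and better approximations join \<open>\<mu>\<close> to a
  periodic orbit of its class, without leaving the double of a given basic neighbourhood that contains
  both (\<open>path_to_box_closure\<close>). A measure with non-zero drift has a neighbourhood in which a single class
  suffices. Near a measure with drift \<open>0\<close> both classes occur, but there an orbit common to both
  classes is available, through which everything is joined. Globally such an orbit always exists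
  (\<open>connected_by_two_classes\<close>).

  All this takes place in coordinates: the probabilities of finite words identify the ergodic measures
  homeomorphically with a set of functions on words (\<open>ergodic_space_homeomorphic\<close>).
\<close>

section \<open>Words acting on stacks\<close>

fun sym_act :: "dm_symbol \<Rightarrow> nat list \<Rightarrow> nat list option" where
  "sym_act (Sym_alpha i) s = Some (i # s)"
| "sym_act (Sym_one k) s = Some s"
| "sym_act (Sym_beta j) [] = None"
| "sym_act (Sym_beta j) (i # s) = (if i = j then Some s else None)"

text \<open>
  Words act on stacks of indices by partial maps: an opening bracket pushes its index, a closing
  bracket pops its own index and is undefined otherwise. This is a representation of the
  Dyck-Motzkin monoid in which only \<open>0\<close> acts as the nowhere defined map, so that it decides
  which words vanish.
\<close>
fun word_act :: "dm_symbol list \<Rightarrow> nat list \<Rightarrow> nat list option" where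
  "word_act [] s = Some s"
| "word_act (c # w) s = Option.bind (sym_act c s) (word_act w)"

lemma word_act_append: "word_act (u @ v) s = Option.bind (word_act u s) (word_act v)"
proof (induction u arbitrary: s)
  case (Cons c u)
  then show ?case by (cases "sym_act c s") simp_all
qed simp

fun zword_act :: "dm_symbol list option \<Rightarrow> nat list \<Rightarrow> nat list option" where
  "zword_act None s = None"
| "zword_act (Some w) s = word_act w s"

lemma zword_act_zmult: "zword_act (zmult a b) = (\<lambda>s. Option.bind (zword_act a s) (zword_act b))"
  by (cases a; cases b) (auto simp: word_act_append fun_eq_iff split: bind_splits)

text \<open>
  The defining relations hold for the action, and composition of partial maps respects products.
\<close>
lemma dm_cong_act: "dm_cong M N a b \<Longrightarrow> zword_act a = zword_act b"
proof (induction rule: dm_cong.induct)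
  case (alpha_beta_neq i j)
  then show ?case by (auto simp: fun_eq_iff)
next
  case (one_right w l)
  then show ?case by (auto simp: fun_eq_iff word_act_append bind_eq_Some_conv split: bind_splits)
next
  case (mult a a' b b')
  then show ?case by (simp add: zword_act_zmult)
qed (auto simp: fun_eq_iff)

lemma word_act_alphas: "word_act (map Sym_alpha a) s = Some (rev a @ s)"
  by (induction a arbitrary: s) auto

lemma word_act_betas: "word_act (map Sym_beta b) (b @ s) = Some s"
  by (induction b arbitrary: s) auto

lemma Some_in_free_zero_monoid: "set w \<subseteq> A \<Longrightarrow> Some w \<in> free_zero_monoid A"
  unfolding free_zero_monoid_def by (rule insertI2, rule imageI) (simp only: lists_eq_set mem_Collect_eq)

text \<open>
  Appending a letter to a normal form \<open>\<beta>\<close>...\<open>\<beta>\<alpha>\<close>...\<open>\<alpha>\<close> either keeps it normal, or meets the last \<open>\<alpha>\<close>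
  and cancels it or gives \<open>0\<close>.
\<close>
lemma dm_cong_normal_form:
  assumes "set w \<subseteq> dm_alphabet M N"
  shows "dm_cong M N (Some w) None \<or>
    (\<exists>b a. set b \<subseteq> {1..M} \<and> set a \<subseteq> {1..M} \<and>
      dm_cong M N (Some w) (Some (map Sym_beta b @ map Sym_alpha a)))"
  using assms
proof (induction w rule: rev_induct)
  case Nil
  have "dm_cong M N (Some []) (Some [])"
    by (rule dm_cong.refl) (auto simp: free_zero_monoid_def)
  then have "dm_cong M N (Some []) (Some (map Sym_beta [] @ map Sym_alpha []))" by simp
  then show ?case by (metis empty_set empty_subsetI)
next
  case (snoc c w)
  have c: "c \<in> dm_alphabet M N" using snoc.prems by simp
  have rc: "dm_cong M N (Some [c]) (Some [c])"
    using c by (intro dm_cong.refl) (auto simp: free_zero_monoid_def)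
  from snoc consider "dm_cong M N (Some w) None" |
    b a where "set b \<subseteq> {1..M}" "set a \<subseteq> {1..M}"
      "dm_cong M N (Some w) (Some (map Sym_beta b @ map Sym_alpha a))"
    by auto
  then show ?case
  proof cases
    case 1
    from dm_cong.mult[OF this rc] show ?thesis by simp
  next
    case (2 b a)
    let ?n = "map Sym_beta b @ map Sym_alpha a"
    have nfw: "set ?n \<subseteq> dm_alphabet M N" using 2 by (auto simp: dm_alphabet_def)
    have m: "dm_cong M N (Some (w @ [c])) (Some (?n @ [c]))"
      using dm_cong.mult[OF 2(3) rc] by simp
    consider i where "c = Sym_alpha i" "i \<in> {1..M}" | k where "c = Sym_one k" "k \<in> {1..N}"
      | j where "c = Sym_beta j" "j \<in> {1..M}"
      using c by (auto simp: dm_alphabet_def)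
    then show ?thesis
    proof cases
      case (1 i)
      have "?n @ [c] = map Sym_beta b @ map Sym_alpha (a @ [i])" using 1 by simp
      then show ?thesis using m 1 2
        by (metis (no_types, lifting) Un_insert_right append.right_neutral empty_set insert_subset
            list.simps(15) set_append)
    next
      case (2 k)
      have "dm_cong M N (Some (?n @ [c])) (Some ?n)"
        unfolding 2(1) by (rule dm_cong.one_right) (use nfw 2 in \<open>simp_all only: lists_eq_set mem_Collect_eq\<close>)
      then show ?thesis using m \<open>set b \<subseteq> {1..M}\<close> \<open>set a \<subseteq> {1..M}\<close> dm_cong.trans by blast
    next
      case (3 j)
      show ?thesis
      proof (cases a rule: rev_cases)
        case Nil
        then have "?n @ [c] = map Sym_beta (b @ [j]) @ map Sym_alpha []" using 3 by simp
        then show ?thesis using m 3 \<open>set b \<subseteq> {1..M}\<close> 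
          by (intro disjI2 exI[of _ "b @ [j]"] exI[of _ "[]"]) auto
      next
        case (snoc a' i)
        have i: "i \<in> {1..M}" using snoc \<open>set a \<subseteq> {1..M}\<close> by auto
        let ?p = "map Sym_beta b @ map Sym_alpha a'"
        have rp: "dm_cong M N (Some ?p) (Some ?p)"
          using nfw snoc by (intro dm_cong.refl Some_in_free_zero_monoid) simp
        have eq: "Some (?n @ [c]) = zmult (Some ?p) (Some [Sym_alpha i, Sym_beta j])"
          using snoc 3 by simp
        show ?thesis
        proof (cases "i = j")
          case True
          have "dm_cong M N (Some (?n @ [c])) (Some ?p)"
            unfolding eq using dm_cong.mult[OF rp dm_cong.alpha_beta_eq[OF i, of N]] True by simp
          with m have "dm_cong M N (Some (w @ [c])) (Some ?p)" by (rule dm_cong.trans)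
          moreover have "set a' \<subseteq> {1..M}" using snoc \<open>set a \<subseteq> {1..M}\<close> by auto
          ultimately show ?thesis using \<open>set b \<subseteq> {1..M}\<close> by blast
        next
          case False
          have "dm_cong M N (Some (?n @ [c])) None"
            unfolding eq using dm_cong.mult[OF rp dm_cong.alpha_beta_neq[OF i 3(2) False, of N]] by simp
          with m show ?thesis using dm_cong.trans by blast
        qed
      qed
    qed
  qed
qed

text \<open>
  A normal form is defined on the stack that lists the indices of its \<open>\<beta>\<close>'s. Hence a word which acts
  nowhere has no normal form and must be congruent to \<open>0\<close>.
\<close>
lemma dm_red_neq_zero_iff:
  assumes "set w \<subseteq> dm_alphabet M N"
  shows "dm_red M N w \<noteq> dm_zero M N \<longleftrightarrow> (\<exists>s. word_act w s \<noteq> None)"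
proof -
  have "dm_red M N w = dm_zero M N \<longleftrightarrow> dm_cong M N (Some w) None"
  proof
    assume "dm_red M N w = dm_zero M N"
    moreover have "None \<in> dm_zero M N"
      by (auto simp: dm_zero_def dm_class_def free_zero_monoid_def intro: dm_cong.refl)
    ultimately show "dm_cong M N (Some w) None" by (auto simp: dm_red_def dm_class_def)
  next
    assume "dm_cong M N (Some w) None"
    then show "dm_red M N w = dm_zero M N"
      unfolding dm_red_def dm_zero_def dm_class_def by (blast intro: dm_cong.sym dm_cong.trans)
  qed
  moreover have "dm_cong M N (Some w) None \<longleftrightarrow> (\<forall>s. word_act w s = None)"
  proof
    assume "dm_cong M N (Some w) None"
    from dm_cong_act[OF this] show "\<forall>s. word_act w s = None"
      by (metis zword_act.simps)
  next
    assume undef: "\<forall>s. word_act w s = None"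
    show "dm_cong M N (Some w) None"
    proof (rule ccontr)
      assume "\<not> ?thesis"
      then obtain b a where
        "dm_cong M N (Some w) (Some (map Sym_beta b @ map Sym_alpha a))"
        using dm_cong_normal_form[OF assms] by blast
      from dm_cong_act[OF this] have "word_act w b = word_act (map Sym_beta b @ map Sym_alpha a) b"
        by (metis zword_act.simps(2))
      then show False
        using word_act_betas[of b "[]"] undef by (simp add: word_act_append word_act_alphas)
    qed
  qed
  ultimately show ?thesis by simp
qed

text \<open>
  What lies below the part of the stack that a word uses does not matter.
\<close>
lemma sym_act_frame: "sym_act c s = Some t \<Longrightarrow> sym_act c (s @ r) = Some (t @ r)"
  by (cases "(c, s)" rule: sym_act.cases) (auto split: if_splits)

lemma word_act_frame: "word_act w s = Some t \<Longrightarrow> word_act w (s @ r) = Some (t @ r)"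
  by (induction w arbitrary: s) (auto simp: bind_eq_Some_conv sym_act_frame)

fun sym_height :: "dm_symbol \<Rightarrow> int" where
  "sym_height (Sym_alpha i) = 1"
| "sym_height (Sym_one k) = 0"
| "sym_height (Sym_beta j) = -1"

definition height :: "dm_symbol list \<Rightarrow> int" where
  "height w = (\<Sum>c\<leftarrow>w. sym_height c)"

lemma height_simps [simp]: "height [] = 0" "height (c # w) = sym_height c + height w"
  by (simp_all add: height_def)

lemma sym_act_length: "sym_act c s = Some t \<Longrightarrow> int (length t) = int (length s) + sym_height c"
  by (cases "(c, s)" rule: sym_act.cases) (auto split: if_splits)

lemma word_act_length: "word_act w s = Some t \<Longrightarrow> int (length t) = int (length s) + height w"
  by (induction w arbitrary: s) (auto simp: bind_eq_Some_conv dest!: sym_act_length)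

lemma sym_act_unframe:
  assumes "sym_act c (s @ r) = Some t" "0 \<le> int (length s) + sym_height c"
  shows "\<exists>t'. t = t' @ r \<and> sym_act c s = Some t'"
  using assms by (cases "(c, s)" rule: sym_act.cases) (auto split: if_splits)

lemma word_act_unframe:
  assumes "word_act w (s @ r) = Some t" 
    and "\<And>k. k \<le> length w \<Longrightarrow> - height (take k w) \<le> int (length s)"
  shows "\<exists>t'. word_act w s = Some t'"
  using assms
proof (induction w arbitrary: s)
  case (Cons c w)
  obtain t1 where t1: "sym_act c (s @ r) = Some t1" "word_act w t1 = Some t"
    using Cons.prems(1) by (auto simp: bind_eq_Some_conv)
  have "0 \<le> int (length s) + sym_height c" using Cons.prems(2)[of 1] by simp
  with t1(1) obtain s1 where s1: "t1 = s1 @ r" "sym_act c s = Some s1"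
    using sym_act_unframe by blast
  have "\<exists>t'. word_act w s1 = Some t'"
  proof (rule Cons.IH)
    show "word_act w (s1 @ r) = Some t" using t1 s1 by simp
    fix k assume "k \<le> length w"
    then show "- height (take k w) \<le> int (length s1)"
      using Cons.prems(2)[of "Suc k"] sym_act_length[OF s1(2)] by simp
  qed
  then show ?case using s1 by simp
qed auto

text \<open>
  The depth to which a word reaches into the stack is the depth of the deepest dip of its height, so
  the part of the stack below can be cut off. This bounds the number of unmatched \<open>\<beta>\<close>'s by a
  quantity that is controlled by the ergodic theorem.
\<close>
lemma word_act_min_stack:
  assumes act: "word_act w s = Some t"
    and dip: "\<And>k. k \<le> length w \<Longrightarrow> - height (take k w) \<le> int p"
  obtains s' t' where "length s' \<le> p" "set s' \<subseteq> set s" "word_act w s' = Some t'"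
    "int (length t') = int (length s') + height w"
proof -
  have "\<exists>t'. word_act w (take p s) = Some t'"
  proof (cases "length s \<le> p")
    case False
    show ?thesis
      by (rule word_act_unframe[where r = "drop p s"]) (use act dip False in auto)
  qed (use act in simp)
  then obtain t' where t': "word_act w (take p s) = Some t'" by blast
  show ?thesis
    by (rule that[OF _ _ t' word_act_length[OF t']]) (simp_all add: set_take_subset)
qed

section \<open>Birkhoff's theorem for an ergodic transformation\<close>

lemma integral_measure_preserving:
  fixes g :: "'a \<Rightarrow> real"
  assumes T: "T \<in> measurable M M" and inv: "distr M M T = M" and g: "g \<in> borel_measurable M"
  shows "(\<integral>x. g (T x) \<partial>M) = (\<integral>x. g x \<partial>M)"
  using integral_distr[OF T g] inv by simp

text \<open>
  The maximal ergodic argument. Let \<open>F n\<close> be the maximum of \<open>0\<close> and the first \<open>n\<close> Birkhoff sums, and let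
  \<open>A\<close> be the set where \<open>F n\<close> is unbounded, an invariant set. On \<open>A\<close> the difference of \<open>F (n + 1)\<close> and
  \<open>F n \<circ> T\<close> is eventually \<open>f\<close>, while its integral over \<open>A\<close> is the non-negative integral of
  \<open>F (n + 1) - F n\<close>. Thus \<open>f\<close> has a non-negative integral over \<open>A\<close>. As the full integral is negative,
  ergodicity leaves only measure \<open>0\<close> for \<open>A\<close>.
\<close>
lemma (in prob_space) ergodic_sums_bounded_above:
  fixes f :: "'a \<Rightarrow> real"
  assumes T: "T \<in> measurable M M" and inv: "distr M M T = M"
    and erg: "\<And>A. A \<in> sets M \<Longrightarrow> T -` A \<inter> space M = A \<Longrightarrow> emeasure M A = 0 \<or> emeasure M A = 1"
    and f [measurable]: "f \<in> borel_measurable M" and bnd: "\<And>x. x \<in> space M \<Longrightarrow> \<bar>f x\<bar> \<le> C"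
    and neg: "(\<integral>x. f x \<partial>M) < 0"
  shows "AE x in M. \<exists>K. \<forall>n. (\<Sum>i<n. f ((T ^^ i) x)) \<le> K"
proof -
  note [measurable] = T
  have Tsp: "T x \<in> space M" if "x \<in> space M" for x using measurable_space[OF T that] .
  define F where "F = rec_nat (\<lambda>x. 0) (\<lambda>n G x. max 0 (f x + G (T x)))"
  have F0: "F 0 x = 0" and FS: "F (Suc n) x = max 0 (f x + F n (T x))" for n x
    by (simp_all add: F_def)
  have Fm [measurable]: "F n \<in> borel_measurable M" for n
  proof (induction n)
    case 0 then show ?case by (simp add: F_def)
  next
    case (Suc n)
    note [measurable] = Suc
    have "F (Suc n) = (\<lambda>x. max 0 (f x + F n (T x)))" by (rule ext) (rule FS)
    then show ?case by simp
  qed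
  have Fnn: "0 \<le> F n x" for n x by (cases n) (simp_all add: F0 FS)
  have F_mono: "F n x \<le> F (Suc n) x" for n x
  proof (induction n arbitrary: x)
    case 0 then show ?case by (simp add: F0 FS)
  next
    case (Suc n) then show ?case using Suc[of "T x"] by (subst (1 2) FS) linarith
  qed
  have F_bnd: "F n x \<le> real n * C" if "x \<in> space M" for n x
    using that
  proof (induction n arbitrary: x)
    case (Suc n)
    have "F n (T x) \<le> real n * C" by (rule Suc.IH[OF Tsp[OF Suc.prems]])
    moreover have "0 \<le> C" using bnd[OF Suc.prems] by linarith
    ultimately show ?case using bnd[OF Suc.prems] by (auto simp: FS field_simps abs_le_iff)
  qed (simp add: F0)
  have S_le_F: "(\<Sum>i<n. f ((T ^^ i) x)) \<le> F n x" for n x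
  proof (induction n arbitrary: x)
    case (Suc n)
    have "(\<Sum>i<Suc n. f ((T ^^ i) x)) = f x + (\<Sum>i<n. f ((T ^^ i) (T x)))"
      by (subst sum.lessThan_Suc_shift) (simp add: funpow_swap1)
    also have "\<dots> \<le> F (Suc n) x" using Suc[of "T x"] by (simp add: FS)
    finally show ?case .
  qed (simp add: F0)
  \<comment> \<open>Thresholds are natural numbers, which keeps this a countable intersection.\<close>
  define A where "A = {x \<in> space M. \<forall>K::nat. \<exists>n. real K < F n x}"
  have A [measurable]: "A \<in> sets M" unfolding A_def by measurable
  have Ainv: "T x \<in> A \<longleftrightarrow> x \<in> A" if x: "x \<in> space M" for x
  proof
    assume "T x \<in> A"
    have "\<exists>n. real K < F n x" for K
    proof -
      obtain K' :: nat where "real K + C \<le> real K'" using real_arch_simple by blast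
      moreover obtain n where "real K' < F n (T x)" using \<open>T x \<in> A\<close> by (auto simp: A_def)
      ultimately have "real K < F (Suc n) x" using bnd[OF x] by (auto simp: FS)
      then show ?thesis by blast
    qed
    then show "x \<in> A" using x by (auto simp: A_def)
  next
    assume "x \<in> A"
    have "\<exists>n. real K < F n (T x)" for K
    proof -
      obtain K' :: nat where "real K + C \<le> real K'" using real_arch_simple by blast
      moreover obtain n where "real K' < F n x" using \<open>x \<in> A\<close> by (auto simp: A_def)
      moreover have "0 \<le> real K'" by simp
      ultimately have "real K < F (n - 1) (T x)" using bnd[OF x]
        by (cases n) (auto simp: FS F0)
      then show ?thesis by blast
    qed
    then show "T x \<in> A" using Tsp[OF x] by (auto simp: A_def)
  qed
  have "T -` A \<inter> space M = A" using Ainv by (auto simp: A_def)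
  then have A01: "emeasure M A = 0 \<or> emeasure M A = 1" by (rule erg[OF A])
  let ?D = "\<lambda>n x. indicator A x * max (- F n (T x)) (f x) :: real"
  have lim: "(\<lambda>n. \<integral>x. ?D n x \<partial>M) \<longlonglongrightarrow> (\<integral>x. indicator A x * f x \<partial>M)"
  proof (rule integral_dominated_convergence[where w = "\<lambda>x. C"])
    show "AE x in M. (\<lambda>n. ?D n x) \<longlonglongrightarrow> indicator A x * f x"
    proof (intro AE_I2)
      fix x assume x: "x \<in> space M"
      show "(\<lambda>n. ?D n x) \<longlonglongrightarrow> indicator A x * f x"
      proof (cases "x \<in> A")
        case True
        then have TA: "T x \<in> A" using Ainv x by blast
        obtain K :: nat where K: "- f x \<le> real K" using real_arch_simple by blast
        obtain m where m: "real K < F m (T x)" using TA by (auto simp: A_def)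
        have "max (- F n (T x)) (f x) = f x" if "m \<le> n" for n
          using lift_Suc_mono_le[of "\<lambda>n. F n (T x)", OF F_mono that] m K by linarith
        then have "eventually (\<lambda>n. ?D n x = indicator A x * f x) sequentially"
          unfolding eventually_sequentially by auto
        then show ?thesis by (rule tendsto_eventually)
      qed simp
    qed
    show "AE x in M. norm (?D n x) \<le> C" for n
    proof (intro AE_I2)
      fix x assume x: "x \<in> space M"
      show "norm (?D n x) \<le> C"
        using bnd[OF x] Fnn[of n "T x"] by (auto simp: indicator_def abs_le_iff)
    qed
  qed simp_all
  have nonneg: "0 \<le> (\<integral>x. ?D n x \<partial>M)" for n
  proof -
    have int: "integrable M (\<lambda>x. indicator A x * F m x)" for m
    proof (rule integrable_const_bound[where B = "real m * C"])
      show "AE x in M. norm (indicator A x * F m x) \<le> real m * C"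
      proof (intro AE_I2)
        fix x assume "x \<in> space M"
        from F_bnd[OF this, of m] show "norm (indicator A x * F m x) \<le> real m * C"
          using Fnn[of m x] by (cases "x \<in> A") simp_all
      qed
    qed simp
    have intT: "integrable M (\<lambda>x. indicator A (T x) * F m (T x))" for m
      using integrable_distr_eq[of T M M "\<lambda>x. indicator A x * F m x"] int[of m] by (simp add: inv)
    have "(\<integral>x. indicator A x * F n x \<partial>M) \<le> (\<integral>x. indicator A x * F (Suc n) x \<partial>M)"
      by (rule integral_mono[OF int int]) (simp add: F_mono mult_left_mono)
    then have "0 \<le> (\<integral>x. indicator A x * F (Suc n) x \<partial>M) - (\<integral>x. indicator A (T x) * F n (T x) \<partial>M)"
      using integral_measure_preserving[OF T inv, of "\<lambda>x. indicator A x * F n x"] by simp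
    also have "\<dots> = (\<integral>x. indicator A x * F (Suc n) x - indicator A (T x) * F n (T x) \<partial>M)"
      by (rule Bochner_Integration.integral_diff[OF int intT, symmetric])
    also have "\<dots> = (\<integral>x. ?D n x \<partial>M)"
      using Ainv by (intro Bochner_Integration.integral_cong) (auto simp: indicator_def FS)
    finally show ?thesis .
  qed
  have "0 \<le> (\<integral>x. indicator A x * f x \<partial>M)"
    by (rule LIMSEQ_le_const[OF lim]) (use nonneg in auto)
  moreover have "(\<integral>x. indicator A x * f x \<partial>M) = (\<integral>x. f x \<partial>M)" if "emeasure M A = 1"
  proof -
    have "AE x in M. x \<in> A" using that A prob_eq_1[of A] by (simp add: emeasure_eq_measure)
    then show ?thesis by (intro integral_cong_AE) auto
  qed
  ultimately have "emeasure M A = 0" using A01 neg by auto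
  then have "AE x in M. x \<notin> A" using AE_iff_measurable[of A M "\<lambda>x. x \<notin> A"] A 
    by (auto simp: A_def)
  then show ?thesis
  proof (rule AE_mp, intro AE_I2 impI)
    fix x assume "x \<in> space M" "x \<notin> A"
    then obtain K :: nat where "\<And>n. F n x \<le> real K" by (force simp: A_def not_less)
    then show "\<exists>K. \<forall>n. (\<Sum>i<n. f ((T ^^ i) x)) \<le> K" using S_le_F order_trans by blast
  qed
qed

text \<open>
  The function \<open>f - \<integral>f - \<epsilon>\<close> has a negative integral, so its Birkhoff sums are bounded above.
\<close>
lemma (in prob_space) ergodic_averages_eventually_le:
  fixes f :: "'a \<Rightarrow> real"
  assumes T: "T \<in> measurable M M" and inv: "distr M M T = M"
    and erg: "\<And>A. A \<in> sets M \<Longrightarrow> T -` A \<inter> space M = A \<Longrightarrow> emeasure M A = 0 \<or> emeasure M A = 1"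
    and f [measurable]: "f \<in> borel_measurable M" and bnd: "\<And>x. x \<in> space M \<Longrightarrow> \<bar>f x\<bar> \<le> C"
  shows "AE x in M. \<forall>e>0. \<forall>\<^sub>F n in sequentially. (\<Sum>i<n. f ((T ^^ i) x)) / real n \<le> (\<integral>x. f x \<partial>M) + e"
proof -
  let ?I = "\<integral>x. f x \<partial>M"
  have int: "integrable M f" by (rule integrable_const_bound[where B = C]) (use bnd in auto)
  have "AE x in M. \<forall>k::nat. \<exists>K. \<forall>n. (\<Sum>i<n. f ((T ^^ i) x) - ?I - 1 / real (Suc k)) \<le> K"
  proof (subst AE_all_countable, intro allI)
    fix k :: nat
    let ?g = "\<lambda>x. f x - ?I - 1 / real (Suc k)"
    have "(\<integral>x. ?g x \<partial>M) = - (1 / real (Suc k))"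
      using int by (simp add: prob_space)
    then have "(\<integral>x. ?g x \<partial>M) < 0" by simp
    moreover have "\<bar>?g x\<bar> \<le> C + \<bar>?I\<bar> + 1 / real (Suc k)" if "x \<in> space M" for x
    proof -
      define d where "d = 1 / real (Suc k)"
      have "0 \<le> d" by (simp add: d_def)
      then have "\<bar>f x - ?I - d\<bar> \<le> \<bar>f x\<bar> + \<bar>?I\<bar> + d" by linarith
      then show ?thesis using bnd[OF that] unfolding d_def by linarith
    qed
    ultimately show "AE x in M. \<exists>K. \<forall>n. (\<Sum>i<n. ?g ((T ^^ i) x)) \<le> K"
      by (intro ergodic_sums_bounded_above[OF T inv erg]) auto
  qed
  then show ?thesis
  proof (rule AE_mp, intro AE_I2 impI allI)
    fix x and e :: real
    assume b: "\<forall>k::nat. \<exists>K. \<forall>n. (\<Sum>i<n. f ((T ^^ i) x) - ?I - 1 / real (Suc k)) \<le> K" and e: "0 < e"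
    obtain k :: nat where k: "1 / real (Suc k) < e / 2"
      using nat_approx_posE[of "e / 2"] e by auto
    obtain K where K: "\<And>n. (\<Sum>i<n. f ((T ^^ i) x) - ?I - 1 / real (Suc k)) \<le> K" using b by blast
    obtain m :: nat where m: "2 * \<bar>K\<bar> / e < real m" using reals_Archimedean2 by blast
    show "\<forall>\<^sub>F n in sequentially. (\<Sum>i<n. f ((T ^^ i) x)) / real n \<le> ?I + e"
      unfolding eventually_sequentially
    proof (intro exI[of _ "Suc m"] allI impI)
      fix n assume n: "Suc m \<le> n"
      have "2 * \<bar>K\<bar> / e \<le> real n" using m n by linarith
      then have "2 * \<bar>K\<bar> / e * (e / 2) \<le> real n * (e / 2)" using e by (intro mult_right_mono) auto
      then have "K \<le> real n * (e / 2)" using e by simp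
      moreover have "real n * (1 / real (Suc k)) \<le> real n * (e / 2)"
        using k by (intro mult_left_mono) auto
      moreover have "(\<Sum>i<n. f ((T ^^ i) x)) - real n * ?I - real n * (1 / real (Suc k)) \<le> K"
        using K[of n] by (simp add: sum_subtractf)
      moreover have "real n * (?I + e) = real n * ?I + real n * (e / 2) + real n * (e / 2)"
        by (simp add: algebra_simps)
      ultimately have "(\<Sum>i<n. f ((T ^^ i) x)) \<le> real n * (?I + e)" by linarith
      then show "(\<Sum>i<n. f ((T ^^ i) x)) / real n \<le> ?I + e" using n by (simp add: field_simps)
    qed
  qed
qed

lemma tendsto_of_eventually_le:
  fixes a :: "nat \<Rightarrow> real"
  assumes "\<And>e. 0 < e \<Longrightarrow> \<forall>\<^sub>F n in sequentially. a n \<le> l + e"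
    and "\<And>e. 0 < e \<Longrightarrow> \<forall>\<^sub>F n in sequentially. - a n \<le> - l + e"
  shows "a \<longlonglongrightarrow> l"
proof (rule tendstoI)
  fix e :: real assume "0 < e"
  then have "0 < e / 2" by simp
  show "\<forall>\<^sub>F n in sequentially. dist (a n) l < e"
    using assms(1)[OF \<open>0 < e / 2\<close>] assms(2)[OF \<open>0 < e / 2\<close>]
  proof (rule eventually_elim2)
    fix n assume "a n \<le> l + e / 2" "- a n \<le> - l + e / 2"
    then show "dist (a n) l < e" using \<open>0 < e\<close> unfolding dist_real_def by linarith
  qed
qed

lemma (in prob_space) birkhoff_ergodic:
  fixes f :: "'a \<Rightarrow> real"
  assumes T: "T \<in> measurable M M" and inv: "distr M M T = M"
    and erg: "\<And>A. A \<in> sets M \<Longrightarrow> T -` A \<inter> space M = A \<Longrightarrow> emeasure M A = 0 \<or> emeasure M A = 1"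
    and f [measurable]: "f \<in> borel_measurable M" and bnd: "\<And>x. x \<in> space M \<Longrightarrow> \<bar>f x\<bar> \<le> C"
  shows "AE x in M. (\<lambda>n. (\<Sum>i<n. f ((T ^^ i) x)) / real n) \<longlonglongrightarrow> (\<integral>x. f x \<partial>M)"
proof -
  have "AE x in M. \<forall>e>0. \<forall>\<^sub>F n in sequentially. (\<Sum>i<n. - f ((T ^^ i) x)) / real n \<le> (\<integral>x. - f x \<partial>M) + e"
  proof (rule ergodic_averages_eventually_le[OF T inv])
    show "\<bar>- f x\<bar> \<le> C" if "x \<in> space M" for x using bnd[OF that] by simp
  qed (fact erg, simp)
  moreover have "AE x in M. \<forall>e>0. \<forall>\<^sub>F n in sequentially. (\<Sum>i<n. f ((T ^^ i) x)) / real n \<le> (\<integral>x. f x \<partial>M) + e"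
    by (rule ergodic_averages_eventually_le[OF T inv], fact erg, fact f, fact bnd)
  ultimately have "AE x in M.
      (\<forall>e>0. \<forall>\<^sub>F n in sequentially. (\<Sum>i<n. - f ((T ^^ i) x)) / real n \<le> (\<integral>x. - f x \<partial>M) + e) \<and>
      (\<forall>e>0. \<forall>\<^sub>F n in sequentially. (\<Sum>i<n. f ((T ^^ i) x)) / real n \<le> (\<integral>x. f x \<partial>M) + e)"
    by (rule AE_conjI)
  then show ?thesis
    by (rule AE_mp) (intro AE_I2 impI tendsto_of_eventually_le, simp_all add: sum_negf)
qed

section \<open>Ergodicity of an i.i.d. sequence under the shift\<close>

lemma distr_PiM_shift:
  fixes N :: "'a measure"
  assumes "prob_space N" "space N = UNIV"
  shows "distr (\<Pi>\<^sub>M i\<in>(UNIV::int set). N) (\<Pi>\<^sub>M i\<in>(UNIV::int set). N) (\<lambda>\<omega> i. \<omega> (i + k)) = (\<Pi>\<^sub>M i\<in>(UNIV::int set). N)"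
proof -
  have eq: "(\<lambda>\<omega>. \<lambda>n\<in>(UNIV::int set). \<omega> (n + k)) = (\<lambda>\<omega> i. \<omega> (i + k))"
    by (simp add: restrict_def)
  have "distr (\<Pi>\<^sub>M i\<in>(UNIV::int set). N) (\<Pi>\<^sub>M i\<in>(UNIV::int set). N) (\<lambda>\<omega>. \<lambda>n\<in>(UNIV::int set). \<omega> (n + k))
      = (\<Pi>\<^sub>M i\<in>(UNIV::int set). N)"
    by (rule distr_PiM_reindex) (auto simp: assms inj_def)
  then show ?thesis unfolding eq .
qed

lemma measurable_PiM_shift:
  assumes "space N = UNIV"
  shows "(\<lambda>\<omega> i. \<omega> (i + k)) \<in> measurable (\<Pi>\<^sub>M i\<in>(UNIV::int set). N) (\<Pi>\<^sub>M i\<in>(UNIV::int set). N)"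
  by (rule measurable_PiM_single') (auto simp: assms space_PiM)

text \<open>
  For cylinders \<open>C\<close> the two events become independent once the shift has separated their coordinates. The
  sets \<open>C\<close> with the asserted limit form a Dynkin system; for disjoint unions the limit is exchanged
  with the sum by dominated convergence.
\<close>
lemma PiM_shift_mixing_cylinder:
  fixes N :: "'a measure" and J :: "int set"
  assumes N: "prob_space N" "space N = UNIV"
    and J: "finite J" "\<And>i. i \<in> J \<Longrightarrow> F i \<in> sets N"
    and C: "C \<in> sets (\<Pi>\<^sub>M i\<in>(UNIV::int set). N)"
  defines "P \<equiv> (\<Pi>\<^sub>M i\<in>(UNIV::int set). N)"
  shows "(\<lambda>n. measure P ((\<lambda>\<omega> i. \<omega> (i + int n)) -` C \<inter> {\<omega>. \<forall>i\<in>J. \<omega> i \<in> F i}))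
    \<longlonglongrightarrow> measure P C * measure P {\<omega>. \<forall>i\<in>J. \<omega> i \<in> F i}"
proof -
  interpret N: prob_space N by fact
  interpret product_prob_space "\<lambda>_. N" "UNIV :: int set" ..
  have spP: "space P = UNIV" by (simp add: P_def space_PiM N)
  interpret PP: prob_space P unfolding P_def by (rule prob_space_PiM) (rule N)
  define S where "S = (\<lambda>n (\<omega> :: int \<Rightarrow> 'a) i. \<omega> (i + int n))"
  have S [measurable]: "S n \<in> measurable P P" for n
    unfolding S_def P_def by (rule measurable_PiM_shift) fact
  have inv: "measure P (S n -` A) = measure P A" if "A \<in> sets P" for n A
    using measure_distr[OF S that, of n] distr_PiM_shift[OF N, of "int n"] that
    by (simp add: spP[unfolded P_def] S_def P_def)
  let ?B = "{\<omega>. \<forall>i\<in>J. \<omega> i \<in> F i}"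
  have cyl: "{\<omega>. \<forall>i\<in>K. \<omega> i \<in> X i} \<in> sets P \<and>
      measure P {\<omega>. \<forall>i\<in>K. \<omega> i \<in> X i} = (\<Prod>i\<in>K. measure N (X i))"
    if "finite K" "\<And>i. i \<in> K \<Longrightarrow> X i \<in> sets N" for K :: "int set" and X
  proof -
    have "prod_emb UNIV (\<lambda>_. N) K (Pi\<^sub>E K X) = {\<omega>. \<forall>i\<in>K. \<omega> i \<in> X i}"
      unfolding prod_emb_def by (auto simp: N PiE_def Pi_def extensional_def)
    then show ?thesis
      using measure_PiM_emb[of K X] sets_PiM_I[of K UNIV X "\<lambda>_. N"] that by (simp add: P_def)
  qed
  have B [measurable]: "?B \<in> sets P" using cyl J by blast
  have pre [measurable]: "S n -` A \<in> sets P" if "A \<in> sets P" for n A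
    using measurable_sets[OF S that] by (simp add: spP)
  have "C \<in> sigma_sets (\<Pi>\<^sub>E i\<in>UNIV. space N) (prod_algebra UNIV (\<lambda>_. N))"
    using C unfolding sets_PiM .
  with Int_stable_prod_algebra prod_algebra_sets_into_space
  have "(\<lambda>n. measure P (S n -` C \<inter> ?B)) \<longlonglongrightarrow> measure P C * measure P ?B"
  proof (induction rule: sigma_sets_induct_disjoint)
    case (basic A)
    then obtain K E where A: "A = prod_emb UNIV (\<lambda>_. N) K (Pi\<^sub>E K E)" and K: "finite K"
      and E: "\<And>i. i \<in> K \<Longrightarrow> E i \<in> sets N" by (rule prod_algebraE) blast
    have A_eq: "A = {\<omega>. \<forall>i\<in>K. \<omega> i \<in> E i}"
      unfolding A prod_emb_def by (auto simp: N PiE_def Pi_def extensional_def)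
    obtain m where m: "\<And>i. i \<in> K \<union> J \<Longrightarrow> \<bar>i\<bar> \<le> int m"
    proof -
      have "finite ((\<lambda>i. nat \<bar>i\<bar>) ` (K \<union> J))" using K J by simp
      then obtain m where "\<forall>j\<in>(\<lambda>i. nat \<bar>i\<bar>) ` (K \<union> J). j \<le> m"
        unfolding finite_nat_set_iff_bounded_le by blast
      then show ?thesis by (intro that[of m]) (auto simp: nat_le_iff)
    qed
    have "measure P (S n -` A \<inter> ?B) = measure P A * measure P ?B" if n: "2 * m < n" for n
    proof -
      let ?K = "(\<lambda>i. i + int n) ` K"
      have disj: "?K \<inter> J = {}"
      proof (rule ccontr)
        assume "?K \<inter> J \<noteq> {}"
        then obtain i where "i \<in> K" "i + int n \<in> J" by auto
        then show False using m[of i] m[of "i + int n"] n by auto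
      qed
      define X where "X i = (if i \<in> J then F i else E (i - int n))" for i
      have XK: "X (i + int n) = E i" if "i \<in> K" for i using disj that by (auto simp: X_def)
      have XJ: "X i = F i" if "i \<in> J" for i using that by (simp add: X_def)
      have "S n -` A \<inter> ?B = {\<omega>. \<forall>i\<in>?K \<union> J. \<omega> i \<in> X i}"
        using XK XJ by (auto simp: A_eq S_def ball_Un)
      moreover have "X i \<in> sets N" if "i \<in> ?K \<union> J" for i
        using that XK XJ J E by auto
      ultimately have "measure P (S n -` A \<inter> ?B) = (\<Prod>i\<in>?K \<union> J. measure N (X i))"
        using cyl[of "?K \<union> J" X] K J by simp
      also have "\<dots> = (\<Prod>i\<in>?K. measure N (X i)) * (\<Prod>i\<in>J. measure N (X i))"
        using K J disj by (intro prod.union_disjoint) auto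
      also have "(\<Prod>i\<in>?K. measure N (X i)) = (\<Prod>i\<in>K. measure N (E i))"
        by (subst prod.reindex) (auto simp: inj_on_def XK cong: prod.cong)
      also have "(\<Prod>i\<in>J. measure N (X i)) = (\<Prod>i\<in>J. measure N (F i))"
        using XJ by simp
      finally show ?thesis using cyl[of K E] cyl[of J F] K J E by (simp add: A_eq)
    qed
    then show ?case
      by (intro tendsto_eventually) (auto simp: eventually_at_top_dense)
  next
    case empty
    then show ?case by simp
  next
    case (compl A)
    have A [measurable]: "A \<in> sets P" using compl by (simp add: P_def sets_PiM)
    have sp: "(\<Pi>\<^sub>E i\<in>(UNIV::int set). space N) = UNIV" by (simp add: N)
    have "measure P (S n -` (UNIV - A) \<inter> ?B) = measure P ?B - measure P (S n -` A \<inter> ?B)" for n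
    proof -
      have "S n -` (UNIV - A) \<inter> ?B = ?B - (S n -` A \<inter> ?B)" by auto
      then show ?thesis by (simp add: PP.finite_measure_Diff)
    qed
    moreover have "measure P (UNIV - A) * measure P ?B = measure P ?B - measure P A * measure P ?B"
      using PP.prob_compl[OF A] by (simp add: spP left_diff_distrib)
    ultimately show ?case
      using tendsto_diff[OF tendsto_const[of "measure P ?B"] compl.IH] by (simp only: sp)
  next
    case (union A)
    have A [measurable]: "A i \<in> sets P" for i
      using union.hyps(2) unfolding P_def sets_PiM by blast
    have disj: "disjoint_family (\<lambda>i. S n -` A i \<inter> ?B)" for n
      using union.hyps(1) unfolding disjoint_family_on_def by auto
    have s1: "(\<lambda>i. measure P (S n -` A i \<inter> ?B)) sums measure P (S n -` (\<Union>i. A i) \<inter> ?B)" for n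
    proof -
      have "S n -` (\<Union>i. A i) \<inter> ?B = (\<Union>i. S n -` A i \<inter> ?B)" by auto
      then show ?thesis using PP.finite_measure_UNION[OF _ disj[of n]] by (auto simp: image_subset_iff)
    qed
    have s2: "(\<lambda>i. measure P (A i)) sums measure P (\<Union>i. A i)"
      using union.hyps(1) by (intro PP.finite_measure_UNION) auto
    have le: "measure P (S n -` A k \<inter> ?B) \<le> measure P (A k)" for n k
      using PP.finite_measure_mono[of "S n -` A k \<inter> ?B" "S n -` A k"] inv[OF A] by auto
    have "(\<lambda>n. \<Sum>i. measure P (S n -` A i \<inter> ?B)) \<longlonglongrightarrow> (\<Sum>i. measure P (A i) * measure P ?B)"
    proof (rule tannerys_theorem[THEN conjunct2, THEN conjunct2])
      show "\<forall>\<^sub>F (k, n) in sequentially \<times>\<^sub>F sequentially. norm (measure P (S n -` A k \<inter> ?B)) \<le> measure P (A k)"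
        by (intro always_eventually) (auto intro: le)
    qed (use union.IH s2 in \<open>auto simp: sums_iff\<close>)
    moreover have "(\<Sum>i. measure P (A i) * measure P ?B) = measure P (\<Union>i. A i) * measure P ?B"
      using sums_mult2[OF s2] by (simp add: sums_iff)
    ultimately show ?case using s1 by (simp add: sums_iff)
  qed
  then show ?thesis by (simp add: S_def)
qed

text \<open>
  An invariant set \<open>A\<close> is independent of every cylinder by mixing, hence of every event, hence of
  itself.
\<close>
lemma PiM_shift_ergodic:
  fixes N :: "'a measure"
  assumes N: "prob_space N" "space N = UNIV"
  defines "P \<equiv> (\<Pi>\<^sub>M i\<in>(UNIV::int set). N)"
  assumes A: "A \<in> sets P" and invA: "(\<lambda>\<omega> i. \<omega> (i + 1)) -` A = A"
  shows "emeasure P A = 0 \<or> emeasure P A = 1"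
proof -
  have spP: "space P = UNIV" by (simp add: P_def space_PiM N)
  interpret PP: prob_space P unfolding P_def by (rule prob_space_PiM) (rule N)
  have invn: "(\<lambda>\<omega> i. \<omega> (i + int n)) -` A = A" for n
  proof (induction n)
    case (Suc n)
    have "(\<lambda>\<omega> i. \<omega> (i + int (Suc n))) -` A = (\<lambda>\<omega> i. \<omega> (i + int n)) -` ((\<lambda>\<omega> i. \<omega> (i + 1)) -` A)"
      by (auto simp: ac_simps)
    then show ?case using Suc invA by simp
  qed simp
  have "B \<in> sigma_sets (\<Pi>\<^sub>E i\<in>UNIV. space N) (prod_algebra UNIV (\<lambda>_. N)) \<Longrightarrow>
    measure P (A \<inter> B) = measure P A * measure P B" for B
  proof (induction rule: sigma_sets_induct_disjoint[OF Int_stable_prod_algebra prod_algebra_sets_into_space, consumes 1, case_names basic empty compl union])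
    case (basic B)
    then obtain K E where B: "B = prod_emb UNIV (\<lambda>_. N) K (Pi\<^sub>E K E)" and K: "finite K"
      and E: "\<And>i. i \<in> K \<Longrightarrow> E i \<in> sets N" by (rule prod_algebraE) blast
    have B_eq: "B = {\<omega>. \<forall>i\<in>K. \<omega> i \<in> E i}"
      unfolding B prod_emb_def by (auto simp: N PiE_def Pi_def extensional_def)
    from PiM_shift_mixing_cylinder[OF N K, where F = E and C = A] A E
    have "(\<lambda>n. measure P (A \<inter> B)) \<longlonglongrightarrow> measure P A * measure P B" 
      by (simp add: P_def B_eq invn)
    then show ?case by (simp add: LIMSEQ_const_iff)
  next
    case (compl B)
    have B [measurable]: "B \<in> sets P" using compl by (simp add: P_def sets_PiM)
    have "measure P (A - A \<inter> B) = measure P A - measure P (A \<inter> B)"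
      using A by (intro PP.finite_measure_Diff) auto
    moreover have "measure P (UNIV - B) = 1 - measure P B"
      using PP.prob_compl[OF B] spP by simp
    moreover have "A - A \<inter> B = A \<inter> (UNIV - B)" by auto
    ultimately have "measure P (A \<inter> (UNIV - B)) = measure P A * measure P (UNIV - B)"
      using compl.IH by (metis mult.right_neutral right_diff_distrib)
    then show ?case by (simp add: N)
  next
    case (union B)
    have B [measurable]: "B i \<in> sets P" for i
      using union.hyps(2) unfolding P_def sets_PiM by blast
    have s1: "(\<lambda>i. measure P (A \<inter> B i)) sums measure P (\<Union>i. A \<inter> B i)"
      using union.hyps(1) A by (intro PP.finite_measure_UNION) (auto simp: disjoint_family_on_def)
    have "(\<lambda>i. measure P (B i)) sums measure P (\<Union>i. B i)"
      using union.hyps(1) by (intro PP.finite_measure_UNION) auto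
    from sums_mult[OF this, of "measure P A"]
    have "(\<lambda>i. measure P (A \<inter> B i)) sums (measure P A * measure P (\<Union>i. B i))"
      using union.IH by simp
    with s1 have "measure P (\<Union>i. A \<inter> B i) = measure P A * measure P (\<Union>i. B i)"
      by (rule sums_unique2)
    moreover have "(\<Union>i. A \<inter> B i) = A \<inter> (\<Union>i. B i)" by blast
    ultimately show ?case by simp
  qed simp
  from this[of A] have "measure P A = measure P A * measure P A"
    using A by (simp add: P_def sets_PiM)
  then have "measure P A * (measure P A - 1) = 0" by (simp only: right_diff_distrib mult_1_right diff_self)
  then have "measure P A = 0 \<or> measure P A = 1" unfolding mult_eq_0_iff by linarith
  then show ?thesis unfolding PP.emeasure_eq_measure by (elim disjE) simp_all
qed

section \<open>Connecting by nearly affine paths\<close>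

text \<open>
  The \<open>n\<close>-th path is run through on the interval from \<open>n\<close> to \<open>n + 1\<close>, and the half-line is then mapped
  onto \<open>[0, 1)\<close> by \<open>s = t / (1 - t)\<close>.
\<close>
lemma path_infinite_concatenation:
  fixes g :: "nat \<Rightarrow> real \<Rightarrow> 'a::topological_space"
  assumes cont: "\<And>n. continuous_on {0..1} (g n)"
    and match: "\<And>n. g n 1 = g (Suc n) 0"
    and lim: "\<And>U. open U \<Longrightarrow> z \<in> U \<Longrightarrow> \<exists>m. \<forall>n\<ge>m. \<forall>t\<in>{0..1}. g n t \<in> U"
  obtains p where "path p" "p 0 = g 0 0" "p 1 = z" "path_image p \<subseteq> insert z (\<Union>n. g n ` {0..1})"
proof -
  \<comment> \<open>Constant on the left of \<open>0\<close>, so that the sets \<open>{..<n}\<close> form an open cover of the domain.\<close>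
  define h where "h s = (if s \<le> 0 then g 0 0 else g (nat \<lfloor>s\<rfloor>) (s - real (nat \<lfloor>s\<rfloor>)))" for s :: real
  have h_eq: "h s = g n (s - real n)" if "s \<in> {real n..real (Suc n)}" for s n
  proof (cases "s = real (Suc n)")
    case True
    then have "nat \<lfloor>s\<rfloor> = Suc n" by (simp add: nat_add_distrib)
    then show ?thesis using True match[of n] by (simp add: h_def)
  next
    case False
    then have "\<lfloor>s\<rfloor> = int n" using that by (intro floor_unique) auto
    then show ?thesis using that by (cases "s = 0") (auto simp: h_def)
  qed
  have h_range: "\<exists>n. real n \<le> max 0 s \<and> max 0 s \<le> real (Suc n) \<and> h s \<in> g n ` {0..1}" for s
  proof (cases "s \<le> 0")
    case True
    then show ?thesis by (intro exI[of _ 0]) (auto simp: h_def)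
  next
    case False
    let ?n = "nat \<lfloor>s\<rfloor>"
    have s: "real ?n \<le> s" "s \<le> real (Suc ?n)" using False by linarith+
    then have "h s \<in> g ?n ` {0..1}" using h_eq[of s ?n] by (intro image_eqI[of _ _ "s - real ?n"]) auto
    then show ?thesis using s False by (intro exI[of _ ?n]) auto
  qed
  have hn: "continuous_on {..real n} h" for n
  proof (induction n)
    case 0
    have "continuous_on {..real 0} (\<lambda>s. g 0 0)" by simp
    then show ?case by (rule continuous_on_eq) (auto simp: h_def)
  next
    case (Suc n)
    have "continuous_on {real n..real (Suc n)} (\<lambda>s. g n (s - real n))"
      by (rule continuous_on_compose2[OF cont[of n]]) (auto intro!: continuous_intros)
    then have "continuous_on {real n..real (Suc n)} h"
      by (rule continuous_on_eq) (simp add: h_eq)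
    then have "continuous_on ({..real n} \<union> {real n..real (Suc n)}) h"
      by (intro continuous_on_closed_Un Suc) auto
    moreover have "{..real n} \<union> {real n..real (Suc n)} = {..real (Suc n)}" by auto
    ultimately show ?case by simp
  qed
  have "continuous_on (\<Union>n. {..<real n}) h"
  proof (rule continuous_on_open_UN)
    show "continuous_on {..<real n} h" for n by (rule continuous_on_subset[OF hn[of n]]) auto
  qed simp
  moreover have "(\<Union>n. {..<real n}) = UNIV" using reals_Archimedean2 by auto
  ultimately have h: "continuous_on UNIV h" by simp
  define p where "p t = (if t < 1 then h (t / (1 - t)) else z)" for t
  have "continuous_on {..<1} (\<lambda>t. h (t / (1 - t)))"
    by (rule continuous_on_compose2[OF h]) (auto intro!: continuous_intros)
  then have p1: "continuous_on {..<1} p" by (rule continuous_on_eq) (simp add: p_def)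
  have "path p"
    unfolding path_def continuous_on_def
  proof
    fix t :: real assume t: "t \<in> {0..1}"
    show "(p \<longlongrightarrow> p t) (at t within {0..1})"
    proof (cases "t < 1")
      case True
      then have "isCont p t" using p1 by (simp add: continuous_on_eq_continuous_at)
      then show ?thesis unfolding isCont_def by (rule tendsto_within_subset) simp
    next
      case False
      then have t1: "t = 1" using t by simp
      show ?thesis
      proof (rule topological_tendstoI)
        fix U assume U: "open U" "p t \<in> U"
        then have "z \<in> U" by (simp add: p_def t1)
        from lim[OF U(1) this] obtain m where m: "\<And>n t. m \<le> n \<Longrightarrow> t \<in> {0..1} \<Longrightarrow> g n t \<in> U" by blast
        have "p s \<in> U" if s: "real (Suc m) / (real (Suc m) + 1) < s" for s
        proof (cases "s < 1")
          case True
          let ?r = "s / (1 - s)"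
          have "real (Suc m) < ?r" using s True by (simp add: field_simps)
          moreover obtain n where "max 0 ?r \<le> real (Suc n)" "h ?r \<in> g n ` {0..1}"
            using h_range by blast
          ultimately have "m \<le> n" "h ?r \<in> g n ` {0..1}" by auto
          then show ?thesis using m True by (auto simp: p_def)
        qed (use \<open>z \<in> U\<close> in \<open>simp add: p_def\<close>)
        moreover have "real (Suc m) / (real (Suc m) + 1) < 1" by simp
        then have "\<forall>\<^sub>F s in at t within {0..1}. real (Suc m) / (real (Suc m) + 1) < s"
          unfolding t1 by (intro order_tendstoD(1)[OF tendsto_ident_at])
        ultimately show "\<forall>\<^sub>F s in at t within {0..1}. p s \<in> U"
          by (elim eventually_mono) blast
      qed
    qed
  qed
  moreover have "p 0 = g 0 0" "p 1 = z" by (simp_all add: p_def h_def)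
  moreover have "path_image p \<subseteq> insert z (\<Union>n. g n ` {0..1})"
    using h_range by (fastforce simp: path_image_def p_def)
  ultimately show ?thesis by (rule that)
qed

text \<open>
  With finite \<open>K\<close> and positive \<open>e\<close> these are the basic neighbourhoods of \<open>x\<close> in the product topology. They
  are convex, which is what keeps nearly affine paths inside them.
\<close>
definition coord_box :: "('w \<Rightarrow> real) \<Rightarrow> 'w set \<Rightarrow> real \<Rightarrow> ('w \<Rightarrow> real) set"
  where "coord_box x K e = {y. \<forall>w\<in>K. \<bar>y w - x w\<bar> < e}"

lemma open_coord_box: "finite K \<Longrightarrow> open (coord_box x K e)"
proof -
  assume "finite K"
  then have "open (\<Inter>w\<in>K. {y. \<bar>y w - x w\<bar> < e})"
    by (intro open_INT ballI open_Collect_less continuous_intros continuous_on_product_coordinates) auto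
  moreover have "coord_box x K e = (\<Inter>w\<in>K. {y. \<bar>y w - x w\<bar> < e})" by (auto simp: coord_box_def)
  ultimately show ?thesis by simp
qed

lemma coord_box_base:
  fixes x :: "'w \<Rightarrow> real"
  assumes "open U" "x \<in> U"
  obtains K e where "finite K" "0 < e" "coord_box x K e \<subseteq> U"
proof -
  have "openin (product_topology (\<lambda>i. euclidean) UNIV) U"
    unfolding euclidean_product_topology using assms(1) by (simp only: open_openin)
  from product_topology_open_contains_basis[OF this \<open>x \<in> U\<close>]
  obtain X where X: "x \<in> Pi\<^sub>E UNIV X" "\<And>i. open (X i)" "finite {i. X i \<noteq> UNIV}" "Pi\<^sub>E UNIV X \<subseteq> U"
    by auto
  let ?K = "{i. X i \<noteq> UNIV}"
  have "\<exists>e>0. \<forall>y. \<bar>y - x i\<bar> < e \<longrightarrow> y \<in> X i" for i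
    using X(1,2) open_dist[of "X i"] by (auto simp: dist_real_def PiE_def)
  then obtain d where d: "\<And>i. 0 < d i" "\<And>i y. \<bar>y - x i\<bar> < d i \<Longrightarrow> y \<in> X i" by metis
  define e where "e = Min (insert 1 (d ` ?K))"
  have "0 < e" using X(3) d(1) by (auto simp: e_def)
  have e: "e \<le> d i" if "i \<in> ?K" for i using that X(3) by (auto simp: e_def)
  have "coord_box x ?K e \<subseteq> Pi\<^sub>E UNIV X"
  proof
    fix y assume y: "y \<in> coord_box x ?K e"
    have "y i \<in> X i" for i
    proof (cases "i \<in> ?K")
      case True
      then have "\<bar>y i - x i\<bar> < e" using y by (auto simp: coord_box_def)
      then show ?thesis using e[OF True] by (intro d(2)) linarith
    qed auto
    then show "y \<in> Pi\<^sub>E UNIV X" by auto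
  qed
  then show ?thesis using that[OF X(3) \<open>0 < e\<close>] X(4) by blast
qed

definition nearly_affinely_connected :: "('w \<Rightarrow> real) set \<Rightarrow> ('w \<Rightarrow> real) set \<Rightarrow> bool" where
  "nearly_affinely_connected E Q \<longleftrightarrow> (\<forall>q\<in>Q. \<forall>q'\<in>Q. \<forall>K e. finite K \<longrightarrow> 0 < e \<longrightarrow>
    (\<exists>g. continuous_on {0..1} g \<and> g 0 = q \<and> g 1 = q' \<and> (\<forall>t\<in>{0..1}. g t \<in> E \<and>
      (\<forall>w\<in>K. \<bar>g t w - ((1 - t) * q w + t * q' w)\<bar> < e))))"

text \<open>
  This is the closure in the product topology.
\<close>
definition box_closure :: "('w \<Rightarrow> real) set \<Rightarrow> ('w \<Rightarrow> real) set" where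
  "box_closure Q = {x. \<forall>K e. finite K \<longrightarrow> 0 < e \<longrightarrow> Q \<inter> coord_box x K e \<noteq> {}}"

lemma convex_combination_close:
  fixes a b z e t :: real
  assumes "\<bar>a - z\<bar> < e" "\<bar>b - z\<bar> < e" "t \<in> {0..1}"
  shows "\<bar>((1 - t) * a + t * b) - z\<bar> < e"
proof -
  have "a \<in> ball z e" "b \<in> ball z e" using assms by (auto simp: dist_real_def abs_minus_commute)
  then have "(1 - t) *\<^sub>R a + t *\<^sub>R b \<in> ball z e"
    using convex_ball[of z e] assms(3) unfolding convex_alt by auto
  then show ?thesis by (simp add: dist_real_def abs_minus_commute)
qed

text \<open>
  Choose points of \<open>Q\<close> converging to \<open>z\<close>, starting with \<open>q\<close>, and join consecutive ones by paths whose
  deviation from the straight segment tends to \<open>0\<close>. The list of coordinates on which convergence is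
  enforced grows along an enumeration of the countable index type. Doubling the size of the box
  leaves room for the deviations.
\<close>
lemma path_to_box_closure:
  fixes E Q :: "('w::countable \<Rightarrow> real) set"
  assumes conn: "nearly_affinely_connected E Q"
    and z: "z \<in> E" "z \<in> box_closure Q" and q: "q \<in> Q"
    and K: "finite K" "0 < e" "q \<in> coord_box x K e" "z \<in> coord_box x K e"
  obtains p where "path p" "p 0 = q" "p 1 = z" "path_image p \<subseteq> E \<inter> coord_box x K (2 * e)"
proof -
  \<comment> \<open>The coordinates controlled by the \<open>n\<close>-th approximation.\<close>
  define L where "L n = K \<union> {w::'w. to_nat w < n}" for n
  have L: "finite (L n)" for n
    using K(1) finite_vimageI[of "{..<n}" "to_nat :: 'w \<Rightarrow> nat"] by (auto simp: L_def vimage_def)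
  have L_mono: "m \<le> n \<Longrightarrow> L m \<subseteq> L n" for m n by (auto simp: L_def)
  define d where "d n = min (e / 2) (1 / real (Suc n))" for n
  have d: "0 < d n" for n using K(2) by (simp add: d_def)
  have "\<exists>y. y \<in> Q \<and> y \<in> coord_box z (L n) (d n)" for n
    using z(2) L[of n] d[of n] unfolding box_closure_def by blast
  then obtain y where y: "\<And>n. y n \<in> Q" "\<And>n. y n \<in> coord_box z (L n) (d n)" by metis
  define r where "r = case_nat q y"
  have rQ: "r n \<in> Q" for n using y q by (auto simp: r_def split: nat.split)
  have "\<exists>g. continuous_on {0..1} g \<and> g 0 = r n \<and> g 1 = r (Suc n) \<and> (\<forall>t\<in>{0..1}. g t \<in> E \<and>
      (\<forall>w\<in>L n. \<bar>g t w - ((1 - t) * r n w + t * r (Suc n) w)\<bar> < d n))" for n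
    using conn rQ[of n] rQ[of "Suc n"] L[of n] d[of n] unfolding nearly_affinely_connected_def by blast
  then obtain g where g: "\<And>n. continuous_on {0..1} (g n)" "\<And>n. g n 0 = r n"
      "\<And>n. g n 1 = r (Suc n)" "\<And>n t. t \<in> {0..1} \<Longrightarrow> g n t \<in> E"
      "\<And>n t w. t \<in> {0..1} \<Longrightarrow> w \<in> L n \<Longrightarrow> \<bar>g n t w - ((1 - t) * r n w + t * r (Suc n) w)\<bar> < d n"
    by metis
  have r_box: "\<bar>r n w - x w\<bar> < 3 / 2 * e" if "w \<in> K" for n w
  proof (cases n)
    case 0
    then show ?thesis using K that by (auto simp: r_def coord_box_def)
  next
    case (Suc m)
    have "\<bar>y m w - z w\<bar> < d m" using y(2)[of m] that by (auto simp: coord_box_def L_def)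
    moreover have "\<bar>z w - x w\<bar> < e" using K(4) that by (auto simp: coord_box_def)
    moreover have "d m \<le> e / 2" by (simp add: d_def)
    ultimately have "\<bar>y m w - x w\<bar> < 3 / 2 * e" by linarith
    then show ?thesis by (simp add: r_def Suc)
  qed
  have g_box: "g n t \<in> coord_box x K (2 * e)" if t: "t \<in> {0..1}" for n t
    unfolding coord_box_def
  proof (intro CollectI ballI)
    fix w assume w: "w \<in> K"
    have "\<bar>((1 - t) * r n w + t * r (Suc n) w) - x w\<bar> < 3 / 2 * e"
      by (rule convex_combination_close[OF r_box[OF w] r_box[OF w] t])
    moreover have "\<bar>g n t w - ((1 - t) * r n w + t * r (Suc n) w)\<bar> < d n"
      using w by (intro g t) (auto simp: L_def)
    moreover have "d n \<le> e / 2" by (simp add: d_def)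
    ultimately show "\<bar>g n t w - x w\<bar> < 2 * e" by linarith
  qed
  have lim: "\<exists>m. \<forall>n\<ge>m. \<forall>t\<in>{0..1}. g n t \<in> U" if U: "open U" "z \<in> U" for U
  proof -
    obtain K' e' where K': "finite K'" "0 < e'" "coord_box z K' e' \<subseteq> U"
      using coord_box_base[OF U] by blast
    obtain m1 where m1: "\<And>w. w \<in> K' \<Longrightarrow> to_nat w < m1"
      using finite_nat_bounded[of "to_nat ` K'"] K'(1) by auto
    obtain m2 where m2: "1 / real (Suc m2) < e' / 2" using nat_approx_posE[of "e' / 2"] K'(2) by auto
    show ?thesis
    proof (intro exI allI impI ballI)
      fix n and t :: real assume n: "Suc (max m1 m2) \<le> n" and t: "t \<in> {0..1}"
      then obtain k where k: "n = Suc k" "m1 \<le> k" "m2 \<le> k" by (cases n) auto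
      have dd: "d j < e' / 2" if "k \<le> j" for j
      proof -
        have "1 / real (Suc j) \<le> 1 / real (Suc m2)" using k that by (intro divide_left_mono) auto
        then show ?thesis using m2 by (auto simp: d_def)
      qed
      have "g n t \<in> coord_box z K' e'"
        unfolding coord_box_def
      proof (intro CollectI ballI)
        fix w assume w: "w \<in> K'"
        have wL: "w \<in> L j" if "k \<le> j" for j using m1[OF w] k that by (auto simp: L_def)
        have yj: "\<bar>y j w - z w\<bar> < e' / 2" if "k \<le> j" for j
          using y(2)[of j] wL[OF that] dd[OF that] by (auto simp: coord_box_def dest!: bspec)
        have "\<bar>((1 - t) * r n w + t * r (Suc n) w) - z w\<bar> < e' / 2"
          using yj[of k] yj[of n] k(1) by (intro convex_combination_close t) (auto simp: r_def)
        moreover have "\<bar>g n t w - ((1 - t) * r n w + t * r (Suc n) w)\<bar> < d n"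
          using wL[of n] k by (intro g t) auto
        ultimately show "\<bar>g n t w - z w\<bar> < e'" using dd[of n] k by linarith
      qed
      then show "g n t \<in> U" using K' by blast
    qed
  qed
  have match: "g n 1 = g (Suc n) 0" for n using g by simp
  obtain p where p: "path p" "p 0 = g 0 0" "p 1 = z"
      "path_image p \<subseteq> insert z (\<Union>n. g n ` {0..1})"
    using path_infinite_concatenation[of g z, OF g(1) match lim] .
  have zb: "z \<in> coord_box x K (2 * e)" using K(2,4) by (force simp: coord_box_def)
  have "path_image p \<subseteq> E \<inter> coord_box x K (2 * e)"
  proof
    fix u assume "u \<in> path_image p"
    then consider "u = z" | n t where "t \<in> {0..1}" "u = g n t" using p(4) by fastforce
    then show "u \<in> E \<inter> coord_box x K (2 * e)" using z(1) zb g(4) g_box by cases simp_all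
  qed
  then show ?thesis using that p g(2) by (simp add: r_def)
qed

text \<open>
  The sign of \<open>d\<close> tells by which class a point is approximated. Around a point with \<open>d \<noteq> 0\<close> the sign is
  constant on a neighbourhood, and a point of the one class serves as a hub. Around a point with
  \<open>d = 0\<close> the hub is taken in the intersection of the classes, so it can be reached from either side.
\<close>
lemma connected_by_two_classes:
  fixes E Qp Qn :: "('w::countable \<Rightarrow> real) set"
  assumes conn: "nearly_affinely_connected E Qp" "nearly_affinely_connected E Qn"
    and sub: "Qp \<subseteq> E" "Qn \<subseteq> E" and d: "continuous_on UNIV d"
    and pos: "\<And>x. x \<in> E \<Longrightarrow> 0 \<le> d x \<Longrightarrow> x \<in> box_closure Qp"
    and neg: "\<And>x. x \<in> E \<Longrightarrow> d x \<le> (0::real) \<Longrightarrow> x \<in> box_closure Qn"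
    and neut: "\<And>x. x \<in> E \<Longrightarrow> d x = 0 \<Longrightarrow> x \<in> box_closure (Qp \<inter> Qn)"
    and ne: "Qp \<inter> Qn \<noteq> {}"
  shows "path_connected_space (top_of_set E) \<and> locally_path_connected_space (top_of_set E)"
proof
  have join: "\<exists>C. path_connected C \<and> C \<subseteq> E \<inter> coord_box x K (2 * e) \<and> y \<in> C \<and> q \<in> C"
    if "finite K" "0 < e" "y \<in> E" "Q = Qp \<or> Q = Qn" "q \<in> Q" "y \<in> box_closure Q"
      "y \<in> coord_box x K e" "q \<in> coord_box x K e" for x K e y q Q
  proof -
    have "nearly_affinely_connected E Q" using that conn by auto
    from path_to_box_closure[OF this \<open>y \<in> E\<close> that(6,5,1,2,8,7)]
    obtain p where p: "path p" "p 0 = q" "p 1 = y" "path_image p \<subseteq> E \<inter> coord_box x K (2 * e)" .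
    then show ?thesis
      using path_connected_path_image[OF p(1)] pathstart_in_path_image[of p] pathfinish_in_path_image[of p]
      by (intro exI[of _ "path_image p"]) (auto simp: pathstart_def pathfinish_def)
  qed
  have sign: "x \<in> box_closure Qp \<or> x \<in> box_closure Qn" if "x \<in> E" for x
    using pos neg that linear by blast
  obtain q where q: "q \<in> Qp" "q \<in> Qn" using ne by blast
  have toq: "\<exists>C. path_connected C \<and> C \<subseteq> E \<and> y \<in> C \<and> q \<in> C" if y: "y \<in> E" for y
    using sign[OF y] join[of "{}" 1 y Qp q] join[of "{}" 1 y Qn q] y q by (fastforce simp: coord_box_def)
  have "path_connected E"
    unfolding path_connected_component
  proof (intro ballI)
    fix x y assume "x \<in> E" "y \<in> E"
    from toq[OF this(1)] toq[OF this(2)] obtain C D where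
      C: "path_connected C" "C \<subseteq> E" "x \<in> C" "q \<in> C" and
      D: "path_connected D" "D \<subseteq> E" "y \<in> D" "q \<in> D" by blast
    then have "path_connected (C \<union> D)" by (intro path_connected_Un) auto
    then have "path_component (C \<union> D) x y" using C D by (simp add: path_connected_component)
    then show "path_component E x y" by (rule path_component_of_subset[rotated]) (use C D in auto)
  qed
  then show "path_connected_space (top_of_set E)"
    by simp
  show "locally_path_connected_space (top_of_set E)"
    unfolding locally_path_connected_space_im_kleinen
  proof (intro allI impI)
    fix V x assume V: "openin (top_of_set E) V \<and> x \<in> V"
    then obtain W where W: "open W" "V = E \<inter> W" by (auto simp: openin_open)
    have x: "x \<in> E" "x \<in> W" using V W by auto
    obtain K e0 where K: "finite K" "0 < e0" "coord_box x K e0 \<subseteq> W"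
      using coord_box_base[OF W(1) x(2)] by blast
    define e where "e = e0 / 2"
    have e: "0 < e" "coord_box x K (2 * e) \<subseteq> W" using K by (auto simp: e_def)
    have xb: "x \<in> coord_box x K e" using e by (simp add: coord_box_def)
    have "\<exists>q U. open U \<and> x \<in> U \<and> U \<subseteq> coord_box x K e \<and> q \<in> coord_box x K e \<and>
      (\<forall>y\<in>E \<inter> U. \<exists>Q. (Q = Qp \<or> Q = Qn) \<and> q \<in> Q \<and> y \<in> box_closure Q)"
    proof -
      consider "d x = 0" | "0 < d x" | "d x < 0" by linarith
      then show ?thesis
      proof cases
        case 1
        from neut[OF x(1) this] obtain q where "q \<in> Qp" "q \<in> Qn" "q \<in> coord_box x K e"
          using K(1) e(1) by (auto simp: box_closure_def)
        then show ?thesis using sign xb open_coord_box[OF K(1)]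
          by (intro exI[of _ q] exI[of _ "coord_box x K e"]) blast
      next
        case 2
        obtain q where "q \<in> Qp" "q \<in> coord_box x K e"
          using pos[OF x(1)] 2 K(1) e(1) by (force simp: box_closure_def)
        moreover have "open (coord_box x K e \<inter> {y. 0 < d y})"
          by (intro open_Int open_coord_box K(1) open_Collect_less continuous_intros d)
        ultimately show ?thesis using pos xb 2
          by (intro exI[of _ q] exI[of _ "coord_box x K e \<inter> {y. 0 < d y}"]) force
      next
        case 3
        obtain q where "q \<in> Qn" "q \<in> coord_box x K e"
          using neg[OF x(1)] 3 K(1) e(1) by (force simp: box_closure_def)
        moreover have "open (coord_box x K e \<inter> {y. d y < 0})"
          by (intro open_Int open_coord_box K(1) open_Collect_less continuous_intros d)
        ultimately show ?thesis using neg xb 3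
          by (intro exI[of _ q] exI[of _ "coord_box x K e \<inter> {y. d y < 0}"]) force
      qed
    qed
    then obtain q U where U: "open U" "x \<in> U" "U \<subseteq> coord_box x K e" "q \<in> coord_box x K e"
      and UQ: "\<And>y. y \<in> E \<Longrightarrow> y \<in> U \<Longrightarrow> \<exists>Q. (Q = Qp \<or> Q = Qn) \<and> q \<in> Q \<and> y \<in> box_closure Q"
      by blast
    have toq: "\<exists>C. path_connected C \<and> C \<subseteq> E \<inter> coord_box x K (2 * e) \<and> y \<in> C \<and> q \<in> C"
      if y: "y \<in> E" "y \<in> U" for y
    proof -
      from UQ[OF y] obtain Q where Q: "Q = Qp \<or> Q = Qn" "q \<in> Q" "y \<in> box_closure Q" by blast
      show ?thesis by (rule join[OF K(1) e(1) y(1) Q]) (use U y in auto)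
    qed
    show "\<exists>U. openin (top_of_set E) U \<and> x \<in> U \<and> U \<subseteq> V \<and>
      (\<forall>y\<in>U. \<exists>C. path_connectedin (top_of_set E) C \<and> C \<subseteq> V \<and> x \<in> C \<and> y \<in> C)"
    proof (rule exI[of _ "E \<inter> U"], intro conjI ballI)
      show "openin (top_of_set E) (E \<inter> U)" using U by auto
      show "x \<in> E \<inter> U" using x U by simp
      have "coord_box x K e \<subseteq> coord_box x K (2 * e)" using e by (force simp: coord_box_def)
      then show "E \<inter> U \<subseteq> V" using U W e by blast
      fix y assume y: "y \<in> E \<inter> U"
      obtain C where C: "path_connected C" "C \<subseteq> E \<inter> coord_box x K (2 * e)" "x \<in> C" "q \<in> C"
        using toq[of x] x U by blast
      obtain D where D: "path_connected D" "D \<subseteq> E \<inter> coord_box x K (2 * e)" "y \<in> D" "q \<in> D"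
        using toq[of y] y by blast
      have "path_connected (C \<union> D)" using C D by (intro path_connected_Un) auto
      moreover have "C \<union> D \<subseteq> V" using C D W e by blast
      ultimately show "\<exists>C. path_connectedin (top_of_set E) C \<and> C \<subseteq> V \<and> x \<in> C \<and> y \<in> C"
        using C D W by (intro exI[of _ "C \<union> D"]) (auto simp: path_connectedin_subtopology)
    qed
  qed
qed

section \<open>Word probabilities as coordinates on ergodic measures\<close>

instance dm_symbol :: countable by countable_datatype

instance dm_symbol :: second_countable_topology
proof
  have "generate_topology (range (\<lambda>x :: dm_symbol. {x})) A" for A
  proof -
    have "generate_topology (range (\<lambda>x :: dm_symbol. {x})) (\<Union>((\<lambda>x. {x}) ` A))"
      by (rule generate_topology.UN) (auto intro: generate_topology.Basis)
    then show ?thesis by simp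
  qed
  then show "\<exists>B :: dm_symbol set set. countable B \<and> open = generate_topology B"
    by (intro exI[of _ "range (\<lambda>x :: dm_symbol. {x})"]) (auto simp: fun_eq_iff Topological_Spaces.open_discrete)
qed

definition block :: "(int \<Rightarrow> 'a) \<Rightarrow> int \<Rightarrow> nat \<Rightarrow> 'a list"
  where "block x i n = map (\<lambda>k. x (i + int k)) [0..<n]"

lemma length_block [simp]: "length (block x i n) = n" by (simp add: block_def)
lemma nth_block [simp]: "k < n \<Longrightarrow> block x i n ! k = x (i + int k)" by (simp add: block_def)
lemma set_block: "set (block x i n) = (\<lambda>k. x (i + int k)) ` {..<n}" 
  by (auto simp: block_def)
lemma block_eq_iff: "block x i n = w \<longleftrightarrow> length w = n \<and> (\<forall>k<n. x (i + int k) = w ! k)"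
  by (auto simp: list_eq_iff_nth_eq)
lemma block_shift: "block (\<lambda>j. x (j + l)) i n = block x (i + l) n"
  by (simp add: block_def algebra_simps)

lemma open_block:
  fixes W :: "'a::discrete_topology list set"
  shows "open {x. block x i n \<in> W}"
proof -
  have "open {x :: int \<Rightarrow> 'a. block x i n = w}" for w
  proof (cases "length w = n")
    case True
    have "open {x :: int \<Rightarrow> 'a. x j = a}" for j a
      using open_vimage[of "{a}" "\<lambda>x :: int \<Rightarrow> 'a. x j"]
      by (simp add: Topological_Spaces.open_discrete vimage_def)
    then have "open (\<Inter>k<n. {x :: int \<Rightarrow> 'a. x (i + int k) = w ! k})" by (intro open_INT) auto
    moreover have "{x :: int \<Rightarrow> 'a. block x i n = w} = (\<Inter>k<n. {x. x (i + int k) = w ! k})"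
      using True by (auto simp: block_eq_iff)
    ultimately show ?thesis by simp
  next
    case False
    then have "{x :: int \<Rightarrow> 'a. block x i n = w} = {}" by (auto simp: block_eq_iff)
    then show ?thesis by simp
  qed
  then have "open (\<Union>w\<in>W. {x. block x i n = w})" by blast
  moreover have "(\<Union>w\<in>W. {x. block x i n = w}) = {x. block x i n \<in> W}" by auto
  ultimately show ?thesis by simp
qed

abbreviation central_block :: "(int \<Rightarrow> 'a) \<Rightarrow> nat \<Rightarrow> 'a list"
  where "central_block x m \<equiv> block x (- int m) (Suc (2 * m))"

lemma central_block_eq_iff: "central_block x m = central_block y m \<longleftrightarrow> (\<forall>i. \<bar>i\<bar> \<le> int m \<longrightarrow> x i = y i)"
proof
  assume eq: "central_block x m = central_block y m"
  show "\<forall>i. \<bar>i\<bar> \<le> int m \<longrightarrow> x i = y i"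
  proof (intro allI impI)
    fix i assume "\<bar>i\<bar> \<le> int m"
    then have "nat (i + int m) < 2 * m + 1" "0 \<le> i + int m" by linarith+
    then show "x i = y i" using arg_cong[OF eq, of "\<lambda>w. w ! nat (i + int m)"] by simp
  qed
qed (simp add: list_eq_iff_nth_eq)

lemma central_block_base:
  fixes U :: "(int \<Rightarrow> 'a::discrete_topology) set"
  assumes "open U" "x \<in> U"
  obtains m where "\<And>y. central_block y m = central_block x m \<Longrightarrow> y \<in> U"
proof -
  have "openin (product_topology (\<lambda>i. euclidean) UNIV) U"
    unfolding euclidean_product_topology using assms(1) by (simp only: open_openin)
  from product_topology_open_contains_basis[OF this \<open>x \<in> U\<close>]
  obtain V where V: "x \<in> Pi\<^sub>E UNIV V" "\<And>i. open (V i)" "finite {i. V i \<noteq> UNIV}" "Pi\<^sub>E UNIV V \<subseteq> U"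
    by auto
  have "finite ((\<lambda>i. nat \<bar>i\<bar>) ` {i. V i \<noteq> UNIV})" using V(3) by simp
  then obtain m where m: "\<forall>j\<in>(\<lambda>i. nat \<bar>i\<bar>) ` {i. V i \<noteq> UNIV}. j \<le> m"
    unfolding finite_nat_set_iff_bounded_le by blast
  have "y \<in> U" if "central_block y m = central_block x m" for y
  proof -
    have "y i \<in> V i" for i
    proof (cases "V i = UNIV")
      case False
      then have "\<bar>i\<bar> \<le> int m" using m by (auto simp: nat_le_iff)
      then have "y i = x i" using that unfolding central_block_eq_iff by blast
      then show ?thesis using V(1) by auto
    qed simp
    then show ?thesis using V(4) by auto
  qed
  then show ?thesis by (rule that)
qed

text \<open>
  For an invariant measure the position of the word is irrelevant, and the probabilities of words
  starting at \<open>0\<close> determine the measure.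
\<close>
definition word_prob :: "(int \<Rightarrow> 'a) set \<Rightarrow> (int \<Rightarrow> 'a) measure \<Rightarrow> 'a list \<Rightarrow> real"
  where "word_prob X \<mu> w = measure \<mu> {x \<in> X. block x 0 (length w) = w}"

lemma compact_functions_into_finite:
  assumes "finite A"
  shows "compact {x :: int \<Rightarrow> 'a::discrete_topology. \<forall>i. x i \<in> A}"
proof -
  have "compactin (product_topology (\<lambda>i. euclidean) UNIV) (Pi\<^sub>E (UNIV :: int set) (\<lambda>_. A))"
    using assms by (simp add: compactin_PiE finite_imp_compact)
  moreover have "Pi\<^sub>E (UNIV :: int set) (\<lambda>_. A) = {x. \<forall>i. x i \<in> A}" by (auto simp: PiE_def)
  ultimately show ?thesis by (simp add: euclidean_product_topology)
qed

text \<open>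
  The alphabet may be a proper subset of the type of letters; compactness comes from its finiteness.
\<close>
locale subshift =
  fixes X :: "(int \<Rightarrow> 'a::{countable, discrete_topology, second_countable_topology}) set" and A :: "'a set"
  assumes finite_alphabet: "finite A" 
    and letters: "x \<in> X \<Longrightarrow> x i \<in> A"
    and closed: "closed X"
    and translate: "x \<in> X \<Longrightarrow> (\<lambda>i. x (i + k)) \<in> X"
begin

lemma compact: "compact X"
proof -
  have "X \<inter> {x. \<forall>i. x i \<in> A} = X" using letters by auto
  then show ?thesis
    using closed_Int_compact[OF closed compact_functions_into_finite[OF finite_alphabet]] by (simp only:)
qed

lemma block_in_words: "x \<in> X \<Longrightarrow> set (block x i n) \<subseteq> A \<and> length (block x i n) = n"
  using letters by (auto simp: set_block)

lemma finite_words: "finite {w. set w \<subseteq> A \<and> length w = n}"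
  by (rule finite_lists_length_eq[OF finite_alphabet])

lemma space_borel_prob: "\<mu> \<in> borel_prob_measures X \<Longrightarrow> space \<mu> = X"
  using sets_eq_imp_space_eq[of \<mu> "restrict_space borel X"]
  by (simp add: borel_prob_measures_def space_restrict_space)

lemma block_event: "\<mu> \<in> borel_prob_measures X \<Longrightarrow> {x \<in> X. block x i n \<in> W} \<in> sets \<mu>"
proof -
  assume "\<mu> \<in> borel_prob_measures X"
  moreover have "X \<inter> {x. block x i n \<in> W} \<in> sets (restrict_space borel X)"
    unfolding sets_restrict_space using borel_open[OF open_block] by blast
  moreover have "X \<inter> {x. block x i n \<in> W} = {x \<in> X. block x i n \<in> W}" by blast
  ultimately show ?thesis by (simp add: borel_prob_measures_def)
qed

lemma block_eq_event: "\<mu> \<in> borel_prob_measures X \<Longrightarrow> {x \<in> X. block x i n = w} \<in> sets \<mu>"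
  using block_event[of \<mu> i n "{w}"] by simp

lemma invariant_borel: "\<mu> \<in> invariant_measures left_shift X \<Longrightarrow> \<mu> \<in> borel_prob_measures X"
  by (simp add: invariant_measures_def)

lemma measure_block_shift:
  assumes \<mu>: "\<mu> \<in> invariant_measures left_shift X"
  shows "measure \<mu> {x \<in> X. block x i n = w} = measure \<mu> {x \<in> X. block x 0 n = w}"
proof -
  note b = invariant_borel[OF \<mu>]
  let ?C = "\<lambda>i. {x \<in> X. block x i n = w}"
  have step: "measure \<mu> (?C (i + 1)) = measure \<mu> (?C i)" for i
  proof -
    have "left_shift -` ?C i \<inter> space \<mu> = ?C (i + 1)"
      using translate[of _ 1] by (auto simp: space_borel_prob[OF b] left_shift_def block_shift)
    then have "emeasure \<mu> (?C (i + 1)) = emeasure \<mu> (?C i)"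
      using \<mu> block_eq_event[OF b, of i n w] unfolding invariant_measures_def by force
    then show ?thesis by (simp add: measure_def)
  qed
  show ?thesis
  proof (induction i rule: int_induct[where k = 0])
    case (step2 i)
    then show ?case using step[of "i - 1"] by simp
  qed (use step in auto)
qed

lemma integral_block_function:
  fixes g :: "'a list \<Rightarrow> real"
  assumes \<mu>: "\<mu> \<in> invariant_measures left_shift X"
  shows "integrable \<mu> (\<lambda>x. g (block x i n))"
    and "(\<integral>x. g (block x i n) \<partial>\<mu>) = (\<Sum>w | set w \<subseteq> A \<and> length w = n. g w * word_prob X \<mu> w)"
proof -
  note b = invariant_borel[OF \<mu>]
  interpret prob_space \<mu> using b by (simp add: borel_prob_measures_def)
  let ?W = "{w. set w \<subseteq> A \<and> length w = n}"
  let ?h = "\<lambda>x. \<Sum>w\<in>?W. g w * indicator {x \<in> X. block x i n = w} x"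
  have ev: "{x \<in> X. block x i n = w} \<in> sets \<mu>" for w by (rule block_eq_event[OF b])
  have h: "?h x = g (block x i n)" if "x \<in> space \<mu>" for x
  proof -
    have x: "x \<in> X" using that space_borel_prob[OF b] by simp
    have "?h x = (\<Sum>w\<in>?W. if w = block x i n then g w else 0)"
      using x by (intro sum.cong) (auto simp: indicator_def)
    also have "\<dots> = g (block x i n)" using block_in_words[OF x] finite_words by (simp add: sum.delta)
    finally show ?thesis .
  qed
  have int: "integrable \<mu> (\<lambda>x. g w * indicator {x \<in> X. block x i n = w} x)" for w
    using ev[of w] by (intro integrable_mult_right integrable_real_indicator) (auto simp: emeasure_eq_measure)
  have "integrable \<mu> ?h" using int by (intro Bochner_Integration.integrable_sum)
  then show "integrable \<mu> (\<lambda>x. g (block x i n))"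
    by (rule Bochner_Integration.integrable_cong[THEN iffD1, rotated 2]) (use h in auto)
  have "(\<integral>x. g (block x i n) \<partial>\<mu>) = (\<integral>x. ?h x \<partial>\<mu>)"
    by (intro Bochner_Integration.integral_cong) (use h in auto)
  also have "\<dots> = (\<Sum>w\<in>?W. \<integral>x. g w * indicator {x \<in> X. block x i n = w} x \<partial>\<mu>)"
    using int by (intro Bochner_Integration.integral_sum)
  also have "\<dots> = (\<Sum>w\<in>?W. g w * word_prob X \<mu> w)"
  proof (rule sum.cong)
    fix w assume w: "w \<in> ?W"
    have "(\<integral>x. g w * indicator {x \<in> X. block x i n = w} x \<partial>\<mu>) = g w * measure \<mu> {x \<in> X. block x i n = w}"
      using ev[of w] by simp
    then show "(\<integral>x. g w * indicator {x \<in> X. block x i n = w} x \<partial>\<mu>) = g w * word_prob X \<mu> w"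
      using w measure_block_shift[OF \<mu>, of i n w] by (simp add: word_prob_def)
  qed simp
  finally show "(\<integral>x. g (block x i n) \<partial>\<mu>) = (\<Sum>w\<in>?W. g w * word_prob X \<mu> w)" .
qed

lemma measure_block_event:
  assumes \<mu>: "\<mu> \<in> invariant_measures left_shift X"
  shows "measure \<mu> {x \<in> X. block x i n \<in> W} = (\<Sum>w | set w \<subseteq> A \<and> length w = n. indicator W w * word_prob X \<mu> w)"
proof -
  note b = invariant_borel[OF \<mu>]
  have "(\<integral>x. indicator W (block x i n) \<partial>\<mu>) = (\<integral>x. indicator {x \<in> X. block x i n \<in> W} x \<partial>\<mu> :: real)"
    by (intro Bochner_Integration.integral_cong) (auto simp: space_borel_prob[OF b] indicator_def)
  then show ?thesis
    using integral_block_function(2)[OF \<mu>, of "indicator W" i n] block_event[OF b, of i n W] by simp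
qed

lemma word_prob_inj: "inj_on (word_prob X) (invariant_measures left_shift X)"
proof (rule inj_onI)
  fix \<mu> \<nu> assume \<mu>: "\<mu> \<in> invariant_measures left_shift X" and \<nu>: "\<nu> \<in> invariant_measures left_shift X"
    and eq: "word_prob X \<mu> = word_prob X \<nu>"
  note b\<mu> = invariant_borel[OF \<mu>] and b\<nu> = invariant_borel[OF \<nu>]
  interpret \<mu>: prob_space \<mu> using b\<mu> by (simp add: borel_prob_measures_def)
  interpret \<nu>: prob_space \<nu> using b\<nu> by (simp add: borel_prob_measures_def)
  let ?D = "\<lambda>\<mu>. distr \<mu> borel (\<lambda>x. x)"
  have meas: "(\<lambda>x. x) \<in> measurable \<rho> borel" if "\<rho> \<in> borel_prob_measures X" for \<rho>
  proof -
    have "sets \<rho> = sets (restrict_space borel X)" using that by (simp add: borel_prob_measures_def)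
    then have "measurable \<rho> borel = measurable (restrict_space borel X) (borel :: (int \<Rightarrow> 'a) measure)"
      by (rule measurable_cong_sets) simp
    then show ?thesis by (simp add: measurable_restrict_space1)
  qed
  have D: "emeasure (?D \<rho>) B = emeasure \<rho> (B \<inter> X)" if "\<rho> \<in> borel_prob_measures X" "B \<in> sets borel" for \<rho> B
    using emeasure_distr[OF meas[OF that(1)] that(2)] by (simp add: space_borel_prob[OF that(1)])
  have "?D \<mu> = ?D \<nu>"
  proof (rule measure_eqI_PiM_infinite[where I = UNIV and M = "\<lambda>_. borel"])
    fix B :: "int \<Rightarrow> 'a set" and J :: "int set"
    assume J: "finite J" "J \<subseteq> UNIV" and B: "\<And>i. i \<in> J \<Longrightarrow> B i \<in> sets borel"
    let ?P = "prod_emb UNIV (\<lambda>_. borel) J (Pi\<^sub>E J B)"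
    have P: "?P \<in> sets borel"
      unfolding sets_PiM_equal_borel[symmetric] by (rule sets_PiM_I) (use J B in auto)
    have "finite ((\<lambda>i. nat \<bar>i\<bar>) ` J)" using J by simp
    then obtain m where m: "\<forall>j\<in>(\<lambda>i. nat \<bar>i\<bar>) ` J. j \<le> m"
      unfolding finite_nat_set_iff_bounded_le by blast
    have "\<bar>i\<bar> \<le> int m" if "i \<in> J" for i using m that by (auto simp: nat_le_iff)
    then have nth_central: "central_block x m ! nat (i + int m) = x i" if "i \<in> J" for x :: "int \<Rightarrow> 'a" and i
      using that by (subst nth_block) force+
    have "?P = {x. \<forall>i\<in>J. x i \<in> B i}"
      unfolding prod_emb_def by (auto simp: PiE_def Pi_def extensional_def)
    moreover have "(\<forall>i\<in>J. x i \<in> B i) \<longleftrightarrow> (\<forall>i\<in>J. central_block x m ! nat (i + int m) \<in> B i)" for x :: "int \<Rightarrow> 'a"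
    proof (rule ball_cong[OF HOL.refl])
      fix i assume "i \<in> J"
      then have "central_block x m ! nat (i + int m) = x i" by (rule nth_central)
      then show "x i \<in> B i \<longleftrightarrow> central_block x m ! nat (i + int m) \<in> B i" by simp
    qed
    ultimately have PX: "?P \<inter> X = {x \<in> X. central_block x m \<in> {w. \<forall>i\<in>J. w ! nat (i + int m) \<in> B i}}"
      by blast
    have "measure \<mu> (?P \<inter> X) = measure \<nu> (?P \<inter> X)"
      unfolding PX measure_block_event[OF \<mu>] measure_block_event[OF \<nu>] eq ..
    then show "emeasure (?D \<mu>) ?P = emeasure (?D \<nu>) ?P"
      by (simp add: D[OF b\<mu> P] D[OF b\<nu> P] \<mu>.emeasure_eq_measure \<nu>.emeasure_eq_measure)
  qed (auto simp: sets_PiM_equal_borel intro!: \<mu>.finite_measure_distr meas b\<mu>)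
  show "\<mu> = \<nu>"
  proof (rule measure_eqI)
    show "sets \<mu> = sets \<nu>" using b\<mu> b\<nu> by (simp add: borel_prob_measures_def)
    fix B assume "B \<in> sets \<mu>"
    then have "B \<in> sets (restrict_space borel X)" using b\<mu> by (simp add: borel_prob_measures_def)
    then obtain C where "B = C \<inter> X" "C \<in> sets borel" unfolding sets_restrict_space by blast
    then show "emeasure \<mu> B = emeasure \<nu> B"
      using D[OF b\<mu>, of C] D[OF b\<nu>, of C] \<open>?D \<mu> = ?D \<nu>\<close> by simp
  qed
qed

text \<open>
  Uniform continuity on the compact set \<open>X\<close>: two points that agree on a long central window are close.
\<close>
lemma continuous_nearly_local:
  fixes f :: "(int \<Rightarrow> 'a) \<Rightarrow> real"
  assumes f: "continuous_on X f" and e: "0 < e"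
  obtains m where "\<And>x y. x \<in> X \<Longrightarrow> y \<in> X \<Longrightarrow> central_block x m = central_block y m \<Longrightarrow> \<bar>f x - f y\<bar> < e"
proof -
  have "\<exists>m. \<forall>y\<in>X. central_block y m = central_block x m \<longrightarrow> \<bar>f y - f x\<bar> < e / 2" if x: "x \<in> X" for x
  proof -
    have "open (ball (f x) (e / 2))" by simp
    with f obtain U where U: "open U" "U \<inter> X = f -` ball (f x) (e / 2) \<inter> X"
      unfolding continuous_on_open_invariant by blast
    have "x \<in> f -` ball (f x) (e / 2) \<inter> X" using x e by simp
    then have "x \<in> U" using U by blast
    with U(1) obtain m where m: "\<And>y. central_block y m = central_block x m \<Longrightarrow> y \<in> U"
      by (rule central_block_base) blast
    have "\<bar>f y - f x\<bar> < e / 2" if "y \<in> X" "central_block y m = central_block x m" for y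
    proof -
      have "y \<in> f -` ball (f x) (e / 2)" using m[OF that(2)] that(1) U(2) by blast
      then show ?thesis by (simp add: dist_real_def abs_minus_commute)
    qed
    then show ?thesis by blast
  qed
  then obtain k where k: "\<And>x y. x \<in> X \<Longrightarrow> y \<in> X \<Longrightarrow> central_block y (k x) = central_block x (k x) \<Longrightarrow> \<bar>f y - f x\<bar> < e / 2"
    by metis
  let ?C = "\<lambda>x. {y. central_block y (k x) \<in> {central_block x (k x)}}"
  have "X \<subseteq> (\<Union>x\<in>X. ?C x)" by auto
  then obtain Y where Y: "Y \<subseteq> X" "finite Y" "X \<subseteq> (\<Union>x\<in>Y. ?C x)"
  proof (rule compactE_image[OF compact, rotated])
    show "open (?C x)" for x by (rule open_block)
  qed
  obtain m where m: "\<forall>j\<in>k ` Y. j \<le> m"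
    using Y(2) finite_nat_set_iff_bounded_le[of "k ` Y"] by auto
  have "\<bar>f x - f y\<bar> < e" if xy: "x \<in> X" "y \<in> X" "central_block x m = central_block y m" for x y
  proof -
    obtain z where z: "z \<in> Y" "central_block x (k z) = central_block z (k z)" using Y(3) xy(1) by blast
    have "int (k z) \<le> int m" using m z(1) by simp
    then have "central_block x (k z) = central_block y (k z)"
      using xy(3) by (auto simp: central_block_eq_iff intro: order_trans)
    then have "\<bar>f x - f z\<bar> < e / 2" "\<bar>f y - f z\<bar> < e / 2" using k[of z] z Y(1) xy by auto
    then show ?thesis by linarith
  qed
  then show ?thesis by (rule that)
qed

text \<open>
  A continuous function is uniformly close to one that depends on a window only, whose integral is a
  finite linear combination of word probabilities. The bound does not depend on the measure, which
  makes integrals uniform limits of continuous functions of the word probabilities.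
\<close>
lemma integral_continuous_approx:
  fixes f :: "(int \<Rightarrow> 'a) \<Rightarrow> real"
  assumes f: "continuous_on X f" and e: "0 < e"
  obtains n g where "\<And>\<mu>. \<mu> \<in> invariant_measures left_shift X \<Longrightarrow>
    \<bar>(\<integral>x. f x \<partial>\<mu>) - (\<Sum>w | set w \<subseteq> A \<and> length w = n. g w * word_prob X \<mu> w)\<bar> \<le> e"
proof -
  obtain m where m: "\<And>x y. x \<in> X \<Longrightarrow> y \<in> X \<Longrightarrow> central_block x m = central_block y m \<Longrightarrow> \<bar>f x - f y\<bar> < e"
    using continuous_nearly_local[OF f e] by blast
  define g where "g w = f (SOME y. y \<in> X \<and> central_block y m = w)" for w
  have g: "\<bar>f x - g (central_block x m)\<bar> \<le> e" if "x \<in> X" for x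
  proof -
    let ?y = "SOME y. y \<in> X \<and> central_block y m = central_block x m"
    have "?y \<in> X \<and> central_block ?y m = central_block x m"
      by (rule someI[of _ x]) (use that in simp)
    then show ?thesis using m[of x ?y] that unfolding g_def by force
  qed
  obtain C where C: "\<And>x. x \<in> X \<Longrightarrow> norm (f x) \<le> C"
    using compact_imp_bounded[OF compact_continuous_image[OF f compact]] by (auto simp: bounded_iff)
  show ?thesis
  proof (rule that[of g "Suc (2 * m)"])
    fix \<mu> assume \<mu>: "\<mu> \<in> invariant_measures left_shift X"
    note b = invariant_borel[OF \<mu>]
    interpret prob_space \<mu> using b by (simp add: borel_prob_measures_def)
    have "sets \<mu> = sets (restrict_space borel X)" using b by (simp add: borel_prob_measures_def)
    then have "measurable \<mu> borel = measurable (restrict_space borel X) (borel :: real measure)"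
      by (rule measurable_cong_sets) simp
    then have fm: "f \<in> borel_measurable \<mu>" using borel_measurable_continuous_on_restrict[OF f] by simp
    have fi: "integrable \<mu> f"
      by (rule integrable_const_bound[where B = C]) (use C fm space_borel_prob[OF b] in auto)
    note gi = integral_block_function[OF \<mu>, of g "- int m" "Suc (2 * m)"]
    have "\<bar>(\<integral>x. f x \<partial>\<mu>) - (\<integral>x. g (central_block x m) \<partial>\<mu>)\<bar> = \<bar>\<integral>x. f x - g (central_block x m) \<partial>\<mu>\<bar>"
      using fi gi(1) by simp
    also have "\<dots> \<le> (\<integral>x. \<bar>f x - g (central_block x m)\<bar> \<partial>\<mu>)" by (rule integral_abs_bound)
    also have "\<dots> \<le> (\<integral>x. e \<partial>\<mu>)"
      by (rule integral_mono) (use fi gi(1) g space_borel_prob[OF b] in auto)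
    finally show "\<bar>(\<integral>x. f x \<partial>\<mu>) - (\<Sum>w | set w \<subseteq> A \<and> length w = Suc (2 * m). g w * word_prob X \<mu> w)\<bar> \<le> e"
      using gi(2) by (simp add: prob_space)
  qed
qed

lemma ergodic_invariant: "ergodic_measures left_shift X \<subseteq> invariant_measures left_shift X"
  by (auto simp: ergodic_measures_def)

lemma openin_weak_star:
  fixes f :: "(int \<Rightarrow> 'a) \<Rightarrow> real"
  assumes "continuous_on X f" "open U"
  shows "openin (weak_star_topology X) {\<mu> \<in> borel_prob_measures X. (LINT x|\<mu>. f x) \<in> U}"
  unfolding weak_star_topology_def
  by (rule topology_generated_by_Basis, rule CollectI, rule exI[of _ f], rule exI[of _ U]) (simp add: assms)

lemma topspace_weak_star: "topspace (weak_star_topology X) = borel_prob_measures X"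
proof
  show "topspace (weak_star_topology X) \<subseteq> borel_prob_measures X"
    unfolding weak_star_topology_def topology_generated_by_topspace by (rule Union_least) force
  have "openin (weak_star_topology X) {\<mu> \<in> borel_prob_measures X. (LINT x|\<mu>. (0::real)) \<in> UNIV}"
    by (rule openin_weak_star) simp_all
  then show "borel_prob_measures X \<subseteq> topspace (weak_star_topology X)"
    using openin_subset by fastforce
qed

lemma topspace_ergodic: "topspace (ergodic_measure_space left_shift X) = ergodic_measures left_shift X"
  using ergodic_invariant invariant_borel by (auto simp: ergodic_measure_space_def topspace_weak_star)

lemma continuous_word_prob: "continuous_map (weak_star_topology X) euclidean (word_prob X)"
proof -
  have "continuous_map (weak_star_topology X) euclideanreal (\<lambda>\<mu>. word_prob X \<mu> w)" for w
    unfolding continuous_map_def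
  proof (intro conjI allI impI)
    fix U :: "real set" assume "openin euclideanreal U"
    then have "open U" by (simp only: open_openin)
    let ?f = "\<lambda>x :: int \<Rightarrow> 'a. indicator {w} (block x 0 (length w)) :: real"
    have "open (?f -` V)" for V
      using open_block[of 0 "length w" "{v. indicator {w} v \<in> V}"] by (simp add: vimage_def)
    then have "continuous_on UNIV ?f" by (simp add: continuous_on_open_vimage)
    then have "continuous_on X ?f" by (rule continuous_on_subset) simp
    have "(LINT x|\<mu>. ?f x) = word_prob X \<mu> w" if "\<mu> \<in> borel_prob_measures X" for \<mu>
    proof -
      have "(LINT x|\<mu>. ?f x) = (LINT x|\<mu>. indicator {x \<in> X. block x 0 (length w) = w} x)"
        by (intro Bochner_Integration.integral_cong) (auto simp: space_borel_prob[OF that] indicator_def)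
      then show ?thesis using block_eq_event[OF that, of 0 "length w" w] by (simp add: word_prob_def)
    qed
    then have "{\<mu> \<in> topspace (weak_star_topology X). word_prob X \<mu> w \<in> U} =
        {\<mu> \<in> borel_prob_measures X. (LINT x|\<mu>. ?f x) \<in> U}"
      by (auto simp: topspace_weak_star)
    then show "openin (weak_star_topology X) {\<mu> \<in> topspace (weak_star_topology X). word_prob X \<mu> w \<in> U}"
      using openin_weak_star[OF \<open>continuous_on X ?f\<close> \<open>open U\<close>] by (simp only:)
  qed simp_all
  then have "continuous_map (weak_star_topology X) (product_topology (\<lambda>w. euclideanreal) UNIV) (word_prob X)"
    unfolding continuous_map_componentwise_UNIV by blast
  then show ?thesis by (simp only: euclidean_product_topology)
qed

lemma inv_word_prob:
  assumes "\<mu> \<in> ergodic_measures left_shift X"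
  shows "inv_into (ergodic_measures left_shift X) (word_prob X) (word_prob X \<mu>) = \<mu>"
  by (rule inv_into_f_f[OF inj_on_subset[OF word_prob_inj ergodic_invariant] assms])

lemma continuous_on_integral_of_word_prob:
  fixes f :: "(int \<Rightarrow> 'a) \<Rightarrow> real"
  assumes f: "continuous_on X f"
  shows "continuous_on (word_prob X ` ergodic_measures left_shift X)
    (\<lambda>y. LINT x|inv_into (ergodic_measures left_shift X) (word_prob X) y. f x)"
    (is "continuous_on (?c ` ?E) ?F")
proof -
  define Q where "Q k n g \<longleftrightarrow> (\<forall>\<mu>\<in>invariant_measures left_shift X.
    \<bar>(\<integral>x. f x \<partial>\<mu>) - (\<Sum>w | set w \<subseteq> A \<and> length w = n. g w * word_prob X \<mu> w)\<bar> \<le> 1 / real (Suc k))"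
    for k :: nat and n g
  have "\<exists>p. Q k (fst p) (snd p)" for k
  proof (rule integral_continuous_approx[OF f])
    show "0 < 1 / real (Suc k)" by simp
    fix g n
    assume "\<And>\<mu>. \<mu> \<in> invariant_measures left_shift X \<Longrightarrow>
      \<bar>(\<integral>x. f x \<partial>\<mu>) - (\<Sum>w | set w \<subseteq> A \<and> length w = n. g w * word_prob X \<mu> w)\<bar> \<le> 1 / real (Suc k)"
    then have "Q k n g" unfolding Q_def by (rule ballI)
    then show "\<exists>p. Q k (fst p) (snd p)" by (intro exI[of _ "(n, g)"]) simp
  qed
  then obtain p where p: "\<And>k. Q k (fst (p k)) (snd (p k))" using choice[of "\<lambda>k p. Q k (fst p) (snd p)"] by blast
  define n where "n k = fst (p k)" for k
  define g where "g k = snd (p k)" for k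
  have "Q k (n k) (g k)" for k unfolding n_def g_def by (rule p)
  then have ng: "\<bar>(\<integral>x. f x \<partial>\<mu>) - (\<Sum>w | set w \<subseteq> A \<and> length w = n k. g k w * word_prob X \<mu> w)\<bar>
      \<le> 1 / real (Suc k)" if "\<mu> \<in> ?E" for k \<mu>
    using that ergodic_invariant unfolding Q_def by blast
  define G where "G k y = (\<Sum>w | set w \<subseteq> A \<and> length w = n k. g k w * y w)" for k and y :: "'a list \<Rightarrow> real"
  have close: "dist (G k y) (?F y) < e" if "k0 \<le> k" "1 / real (Suc k0) < e" and y: "y \<in> ?c ` ?E" for k0 k e y
  proof -
    obtain \<mu> where \<mu>: "\<mu> \<in> ?E" "y = ?c \<mu>" using y by (rule imageE)
    have "1 / real (Suc k) \<le> 1 / real (Suc k0)" using that by (intro divide_left_mono) auto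
    moreover have "dist (G k y) (?F y) \<le> 1 / real (Suc k)"
      using ng[OF \<mu>(1), of k] by (simp add: \<mu>(2) inv_word_prob[OF \<mu>(1)] G_def dist_real_def abs_minus_commute)
    ultimately show ?thesis using that(2) by linarith
  qed
  have "uniform_limit (?c ` ?E) G ?F sequentially"
  proof (rule uniform_limitI)
    fix e :: real assume "0 < e"
    then obtain k0 where "1 / real (Suc k0) < e" using nat_approx_posE by blast
    then show "\<forall>\<^sub>F k in sequentially. \<forall>y\<in>?c ` ?E. dist (G k y) (?F y) < e"
      unfolding eventually_sequentially using close by blast
  qed
  moreover have "continuous_on (?c ` ?E) (G k)" for k
    unfolding G_def
    by (rule continuous_on_subset[OF _ subset_UNIV])
       (intro continuous_on_sum continuous_on_mult continuous_on_const continuous_on_product_coordinates)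
  ultimately show ?thesis
    by (intro uniform_limit_theorem[where f = G and F = sequentially]) simp_all
qed

lemma ergodic_space_homeomorphic:
  "ergodic_measure_space left_shift X homeomorphic_space
    top_of_set (word_prob X ` ergodic_measures left_shift X)"
proof -
  let ?E = "ergodic_measures left_shift X"
  let ?c = "word_prob X"
  let ?d = "inv_into ?E ?c"
  have Eb: "?E \<subseteq> borel_prob_measures X" using ergodic_invariant invariant_borel by blast
  have dE: "?d y \<in> ?E" if "y \<in> ?c ` ?E" for y using that by (rule inv_into_into)
  have c: "continuous_map (ergodic_measure_space left_shift X) (top_of_set (?c ` ?E)) ?c"
    unfolding continuous_map_in_subtopology
  proof
    show "continuous_map (ergodic_measure_space left_shift X) euclidean ?c"
      unfolding ergodic_measure_space_def by (rule continuous_map_from_subtopology[OF continuous_word_prob])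
    show "?c \<in> topspace (ergodic_measure_space left_shift X) \<rightarrow> ?c ` ?E"
      unfolding topspace_ergodic by (rule funcsetI) (rule imageI)
  qed
  have "continuous_map (top_of_set (?c ` ?E)) (weak_star_topology X) ?d"
    unfolding weak_star_topology_def
  proof (rule continuous_on_generated_topo)
    fix V assume "V \<in> {{\<mu> \<in> borel_prob_measures X. (LINT x|\<mu>. f x) \<in> U} | (f :: (int \<Rightarrow> 'a) \<Rightarrow> real) U.
      continuous_on X f \<and> open U}"
    then obtain f :: "(int \<Rightarrow> 'a) \<Rightarrow> real" and U where f: "continuous_on X f" and U: "open U"
      and V: "V = {\<mu> \<in> borel_prob_measures X. (LINT x|\<mu>. f x) \<in> U}" by blast
    let ?F = "\<lambda>y. LINT x|?d y. f x"
    have "openin (top_of_set (?c ` ?E)) (?c ` ?E \<inter> ?F -` U)"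
      by (rule continuous_openin_preimage_gen[OF continuous_on_integral_of_word_prob[OF f] U])
    moreover have "?d -` V \<inter> ?c ` ?E = ?c ` ?E \<inter> ?F -` U"
      using Eb dE by (auto simp only: V vimage_def)
    ultimately show "openin (top_of_set (?c ` ?E)) (?d -` V \<inter> topspace (top_of_set (?c ` ?E)))"
      by (simp only: topspace_euclidean_subtopology)
  next
    have "?d ` (?c ` ?E) \<subseteq> topspace (weak_star_topology X)"
      unfolding topspace_weak_star using Eb dE by blast
    then show "?d ` topspace (top_of_set (?c ` ?E)) \<subseteq> \<Union>{{\<mu> \<in> borel_prob_measures X. (LINT x|\<mu>. f x) \<in> U} |
      (f :: (int \<Rightarrow> 'a) \<Rightarrow> real) U. continuous_on X f \<and> open U}"
      by (simp only: weak_star_topology_def topology_generated_by_topspace topspace_euclidean_subtopology)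
  qed
  then have "continuous_map (top_of_set (?c ` ?E)) (ergodic_measure_space left_shift X) ?d"
    unfolding ergodic_measure_space_def continuous_map_in_subtopology
    using dE by (simp add: topspace_euclidean_subtopology)
  with c have "homeomorphic_maps (ergodic_measure_space left_shift X) (top_of_set (?c ` ?E)) ?c ?d"
    unfolding homeomorphic_maps_def topspace_ergodic topspace_euclidean_subtopology
    using inv_word_prob f_inv_into_f[of _ ?c ?E] by blast
  then show ?thesis unfolding homeomorphic_space_def by blast
qed

end

section \<open>Random concatenations of two words\<close>

definition unit_uniform :: "real measure" where "unit_uniform = uniform_measure lborel {0..1}"
definition iid_uniform :: "(int \<Rightarrow> real) measure" where "iid_uniform = (\<Pi>\<^sub>M i\<in>(UNIV :: int set). unit_uniform)"

lemma space_unit_uniform [simp]: "space unit_uniform = UNIV" and sets_unit_uniform [simp]: "sets unit_uniform = sets borel"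
  by (simp_all add: unit_uniform_def)

lemma prob_space_unit_uniform: "prob_space unit_uniform"
  unfolding unit_uniform_def by (rule prob_space_uniform_measure) simp_all

lemma measure_unit_uniform:
  assumes "t \<in> {0..1}"
  shows "measure unit_uniform {..<t} = t" "measure unit_uniform {t..} = 1 - t"
proof -
  have "{0..1} \<inter> {..<t} = {0..<t}" "{0..1} \<inter> {t..} = {t..1}" using assms by auto
  then show "measure unit_uniform {..<t} = t" "measure unit_uniform {t..} = 1 - t"
    using assms by (simp_all add: unit_uniform_def measure_uniform_measure)
qed

lemma prob_space_iid_uniform: "prob_space iid_uniform"
  unfolding iid_uniform_def by (rule prob_space_PiM) (rule prob_space_unit_uniform)

lemma space_iid_uniform [simp]: "space iid_uniform = UNIV"
  by (simp add: iid_uniform_def space_PiM)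

text \<open>
  The coin tosses are read off from i.i.d. uniform variables by comparing them with the bias \<open>t\<close>. The
  probability of an event that depends on the tosses in \<open>K\<close> is a polynomial in \<open>t\<close>, which gives
  continuity in \<open>t\<close>, the values at the end points and the estimate for single blocks all at once.
\<close>
lemma bernoulli_pattern_probability:
  assumes K: "finite K" and t: "t \<in> {0..1}"
  shows "measure iid_uniform {\<omega>. R {k \<in> K. \<omega> k < t}} =
    (\<Sum>T\<in>Pow K. of_bool (R T) * (t ^ card T * (1 - t) ^ card (K - T)))"
    and "{\<omega>. R {k \<in> K. \<omega> k < t}} \<in> sets iid_uniform"
proof -
  interpret U: prob_space unit_uniform by (rule prob_space_unit_uniform)
  interpret product_prob_space "\<lambda>_. unit_uniform" "UNIV :: int set" ..
  interpret IU: prob_space iid_uniform by (rule prob_space_iid_uniform)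
  let ?E = "\<lambda>T. {\<omega>. {k \<in> K. \<omega> k < t} = T}"
  let ?F = "\<lambda>T k. if k \<in> T then {..<t} else {t..}"
  have E_eq: "?E T = prod_emb UNIV (\<lambda>_. unit_uniform) K (Pi\<^sub>E K (?F T))" if "T \<subseteq> K" for T
  proof -
    have "prod_emb UNIV (\<lambda>_. unit_uniform) K (Pi\<^sub>E K (?F T)) = {\<omega>. \<forall>k\<in>K. \<omega> k \<in> ?F T k}"
      unfolding prod_emb_def by (auto simp: PiE_def Pi_def extensional_def)
    also have "\<dots> = ?E T" using that by (auto split: if_splits)
    finally show ?thesis by simp
  qed
  have E_sets: "?E T \<in> sets iid_uniform" if "T \<subseteq> K" for T
    unfolding E_eq[OF that] iid_uniform_def by (rule sets_PiM_I) (use K in auto)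
  have E_prob: "measure iid_uniform (?E T) = t ^ card T * (1 - t) ^ card (K - T)" if T: "T \<subseteq> K" for T
  proof -
    have "measure iid_uniform (?E T) = (\<Prod>k\<in>K. measure unit_uniform (?F T k))"
      unfolding E_eq[OF T] iid_uniform_def by (rule measure_PiM_emb) (use K in auto)
    also have "\<dots> = (\<Prod>k\<in>K. if k \<in> T then t else 1 - t)"
      using measure_unit_uniform[OF t] by (intro prod.cong) auto
    also have "\<dots> = t ^ card T * (1 - t) ^ card (K - T)"
      using T K by (simp add: prod.If_cases Int_absorb1 Diff_eq)
    finally show ?thesis .
  qed
  have un: "{\<omega>. R {k \<in> K. \<omega> k < t}} = (\<Union>T\<in>{T \<in> Pow K. R T}. ?E T)" by auto
  have fin: "finite {T \<in> Pow K. R T}" using K by simp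
  show "{\<omega>. R {k \<in> K. \<omega> k < t}} \<in> sets iid_uniform"
    unfolding un by (intro sets.finite_UN fin E_sets) auto
  have "measure iid_uniform (\<Union>T\<in>{T \<in> Pow K. R T}. ?E T) = (\<Sum>T\<in>{T \<in> Pow K. R T}. measure iid_uniform (?E T))"
    using E_sets fin by (intro IU.finite_measure_finite_Union) (auto simp: disjoint_family_on_def)
  also have "\<dots> = (\<Sum>T\<in>{T \<in> Pow K. R T}. t ^ card T * (1 - t) ^ card (K - T))"
    by (intro sum.cong) (auto simp: E_prob)
  also have "\<dots> = (\<Sum>T\<in>Pow K. if R T then t ^ card T * (1 - t) ^ card (K - T) else 0)"
    using K by (intro sum.inter_filter) simp
  also have "\<dots> = (\<Sum>T\<in>Pow K. of_bool (R T) * (t ^ card T * (1 - t) ^ card (K - T)))"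
    by (rule sum.cong) simp_all
  finally show "measure iid_uniform {\<omega>. R {k \<in> K. \<omega> k < t}} =
    (\<Sum>T\<in>Pow K. of_bool (R T) * (t ^ card T * (1 - t) ^ card (K - T)))" unfolding un .
qed

lemma pattern_weights_endpoints:
  assumes K: "finite K"
  shows "(\<Sum>T\<in>Pow K. of_bool (R T) * ((0::real) ^ card T * (1 - 0) ^ card (K - T))) = of_bool (R {})"
    and "(\<Sum>T\<in>Pow K. of_bool (R T) * ((1::real) ^ card T * (1 - 1) ^ card (K - T))) = of_bool (R K)"
proof -
  have "(\<Sum>T\<in>Pow K. of_bool (R T) * ((0::real) ^ card T * (1 - 0) ^ card (K - T)))
      = (\<Sum>T\<in>Pow K. if T = {} then of_bool (R {}) else 0)"
    using K by (intro sum.cong) (auto simp: power_0_left card_eq_0_iff dest: finite_subset)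
  then show "(\<Sum>T\<in>Pow K. of_bool (R T) * ((0::real) ^ card T * (1 - 0) ^ card (K - T))) = of_bool (R {})"
    using K by simp
  have "(\<Sum>T\<in>Pow K. of_bool (R T) * ((1::real) ^ card T * (1 - 1) ^ card (K - T)))
      = (\<Sum>T\<in>Pow K. if T = K then of_bool (R K) else 0)"
  proof (rule sum.cong)
    fix T assume "T \<in> Pow K"
    then have "card (K - T) = 0 \<longleftrightarrow> T = K" using K by auto
    then show "of_bool (R T) * ((1::real) ^ card T * (1 - 1) ^ card (K - T)) = (if T = K then of_bool (R K) else 0)"
      by (auto simp: power_0_left)
  qed simp
  then show "(\<Sum>T\<in>Pow K. of_bool (R T) * ((1::real) ^ card T * (1 - 1) ^ card (K - T))) = of_bool (R K)"
    using K by simp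
qed

text \<open>
  The distribution of \<open>F j\<close> for an independent \<open>j\<close>, uniform on \<open>{..<L}\<close>.
\<close>
lemma average_of_distributions:
  assumes P: "prob_space P" and F: "\<And>j. j < L \<Longrightarrow> F j \<in> measurable P N" and L: "0 < L"
  obtains \<mu> where "prob_space \<mu>" "sets \<mu> = sets N"
    "\<And>B. B \<in> sets N \<Longrightarrow> measure \<mu> B = (\<Sum>j<L. measure P (F j -` B \<inter> space P)) / real L"
proof -
  interpret P: prob_space P by fact
  define m where "m B = (\<Sum>j<L. ennreal (1 / real L) * emeasure (distr P N (F j)) B)" for B
  define \<mu> where "\<mu> = measure_of (space N) (sets N) m"
  have sets\<mu>: "sets \<mu> = sets N" by (simp add: \<mu>_def)
  have em: "emeasure \<mu> B = m B" if "B \<in> sets N" for B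
  proof (rule emeasure_measure_of[OF \<mu>_def])
    show "sets N \<subseteq> Pow (space N)" by (rule sets.space_closed)
    show "B \<in> sets \<mu>" using that by (simp add: sets\<mu>)
    show "positive (sets \<mu>) m" by (simp add: positive_def m_def)
    show "countably_additive (sets \<mu>) m"
      unfolding countably_additive_def
    proof (intro allI impI)
      fix C :: "nat \<Rightarrow> 'b set"
      assume C: "range C \<subseteq> sets \<mu>" "disjoint_family C"
      have "(\<Sum>i. m (C i)) = (\<Sum>j<L. \<Sum>i. ennreal (1 / real L) * emeasure (distr P N (F j)) (C i))"
        unfolding m_def by (rule suminf_sum) simp
      also have "\<dots> = (\<Sum>j<L. ennreal (1 / real L) * (\<Sum>i. emeasure (distr P N (F j)) (C i)))"
        by (simp only: ennreal_suminf_cmult)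
      also have "\<dots> = m (\<Union>i. C i)"
        unfolding m_def using C by (intro sum.cong) (simp_all add: suminf_emeasure sets\<mu>)
      finally show "(\<Sum>i. m (C i)) = m (\<Union>i. C i)" .
    qed
  qed
  have m_real: "m B = ennreal ((\<Sum>j<L. measure P (F j -` B \<inter> space P)) / real L)" if B: "B \<in> sets N" for B
  proof -
    have "m B = (\<Sum>j<L. ennreal (measure P (F j -` B \<inter> space P) / real L))"
      unfolding m_def
    proof (rule sum.cong)
      fix j assume "j \<in> {..<L}"
      then have "emeasure (distr P N (F j)) B = ennreal (measure P (F j -` B \<inter> space P))"
        using F B by (simp add: emeasure_distr P.emeasure_eq_measure)
      then show "ennreal (1 / real L) * emeasure (distr P N (F j)) B = ennreal (measure P (F j -` B \<inter> space P) / real L)"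
        by (simp add: ennreal_mult'[symmetric])
    qed simp
    also have "\<dots> = ennreal (\<Sum>j<L. measure P (F j -` B \<inter> space P) / real L)"
      by (rule sum_ennreal) simp
    finally show ?thesis by (simp add: sum_divide_distrib)
  qed
  show ?thesis
  proof (rule that[of \<mu>])
    show "prob_space \<mu>"
    proof
      have sp: "space \<mu> = space N" by (rule sets_eq_imp_space_eq[OF sets\<mu>])
      have "F j -` space N \<inter> space P = space P" if "j < L" for j
        using measurable_space[OF F[OF that]] by auto
      then have "(\<Sum>j<L. measure P (F j -` space N \<inter> space P)) = real L"
        by (simp add: P.prob_space)
      then show "emeasure \<mu> (space \<mu>) = 1" using L by (simp add: sp em m_real)
    qed
    show "measure \<mu> B = (\<Sum>j<L. measure P (F j -` B \<inter> space P)) / real L" if "B \<in> sets N" for B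
      unfolding measure_def[of \<mu>] em[OF that] m_real[OF that] by (simp add: sum_nonneg)
  qed (rule sets\<mu>)
qed

definition bi_concat :: "nat \<Rightarrow> (int \<Rightarrow> 'a list) \<Rightarrow> int \<Rightarrow> 'a"
  where "bi_concat L y i = y (i div int L) ! nat (i mod int L)"

abbreviation two_word_concat :: "'a list \<Rightarrow> 'a list \<Rightarrow> int set \<Rightarrow> int \<Rightarrow> 'a"
  where "two_word_concat u v T \<equiv> bi_concat (length u) (\<lambda>k. if k \<in> T then v else u)"

definition periodic_point :: "'a list \<Rightarrow> int \<Rightarrow> 'a"
  where "periodic_point u i = u ! nat (i mod int (length u))"

text \<open>
  The word probabilities of the uniform measure on the orbit of the periodic point.
\<close>
definition orbit_freq :: "'a list \<Rightarrow> 'a list \<Rightarrow> real"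
  where "orbit_freq u w =
    (\<Sum>j<length u. of_bool (block (periodic_point u) (int j) (length w) = w)) / real (length u)"

text \<open>
  The word probabilities of a random concatenation of \<open>u\<close> and \<open>v\<close>, seen from a uniformly chosen position.
  The average over the positions in one block makes the law shift-invariant.
\<close>
definition mix_freq :: "'a list \<Rightarrow> 'a list \<Rightarrow> real \<Rightarrow> 'a list \<Rightarrow> real"
  where "mix_freq u v t w = (\<Sum>j<length u. measure iid_uniform
    {\<omega>. block (two_word_concat u v {k. \<omega> k < t}) (int j) (length w) = w}) / real (length u)"

lemma bi_concat_shift: "0 < L \<Longrightarrow> bi_concat L y (i + int L) = bi_concat L (\<lambda>k. y (k + 1)) i"
  by (simp add: bi_concat_def)

lemma block_cong: "(\<And>k. k < n \<Longrightarrow> x (i + int k) = y (i + int k)) \<Longrightarrow> block x i n = block y i n"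
  by (simp add: block_def)

lemma block_two_word_concat_local:
  assumes "\<And>k. k < n \<Longrightarrow> (i + int k) div int (length u) \<in> K"
  shows "block (two_word_concat u v T) i n = block (two_word_concat u v {k \<in> K. k \<in> T}) i n"
  using assms by (intro block_cong) (simp add: bi_concat_def)

lemma block_probability:
  assumes K: "finite K" and t: "t \<in> {0..1}" and loc: "\<And>k. k < n \<Longrightarrow> (i + int k) div int (length u) \<in> K"
  shows "measure iid_uniform {\<omega>. block (two_word_concat u v {k. \<omega> k < t}) i n = w} =
    (\<Sum>T\<in>Pow K. of_bool (block (two_word_concat u v T) i n = w) * (t ^ card T * (1 - t) ^ card (K - T)))"
proof -
  have "block (two_word_concat u v {k. \<omega> k < t}) i n = block (two_word_concat u v {k \<in> K. \<omega> k < t}) i n" for \<omega>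
    using block_two_word_concat_local[where T = "{k. \<omega> k < t}" and v = v, OF loc] by simp
  then show ?thesis
    using bernoulli_pattern_probability(1)[OF K t, of "\<lambda>T. block (two_word_concat u v T) i n = w"] by simp
qed

text \<open>
  The numbers of the blocks of length \<open>L\<close> that meet the window of length \<open>n\<close> at \<open>i\<close>.
\<close>
definition touched :: "nat \<Rightarrow> int \<Rightarrow> nat \<Rightarrow> int set"
  where "touched L i n = (\<lambda>k. (i + int k) div int L) ` {..<n}"

lemma finite_touched [simp]: "finite (touched L i n)"
  and in_touched: "k < n \<Longrightarrow> (i + int k) div int L \<in> touched L i n"
  by (auto simp: touched_def)

lemma mix_freq_polynomial:
  fixes u v w :: "'a list"
  assumes "t \<in> {0..1}"
  defines "K \<equiv> \<lambda>j. touched (length u) (int j) (length w)"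
  shows "mix_freq u v t w = (\<Sum>j<length u. \<Sum>T\<in>Pow (K j).
      of_bool (block (two_word_concat u v T) (int j) (length w) = w) *
      (t ^ card T * (1 - t) ^ card (K j - T))) / real (length u)"
  unfolding mix_freq_def K_def
  by (simp only: block_probability[OF finite_touched assms(1) in_touched])

lemma continuous_on_mix_freq: "continuous_on {0..1} (mix_freq u v)"
proof (rule continuous_on_coordinatewise_then_product)
  fix w :: "'a list"
  let ?K = "\<lambda>j. touched (length u) (int j) (length w)"
  have "continuous_on {0..1} (\<lambda>t. (\<Sum>j<length u. \<Sum>T\<in>Pow (?K j).
      of_bool (block (two_word_concat u v T) (int j) (length w) = w) *
      (t ^ card T * (1 - t) ^ card (?K j - T))) / real (length u))"
    unfolding divide_inverse by (intro continuous_intros)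
  then show "continuous_on {0..1} (\<lambda>t. mix_freq u v t w)"
    by (rule continuous_on_eq) (rule mix_freq_polynomial[symmetric])
qed

lemma mix_freq_0: "mix_freq u v 0 = orbit_freq u"
proof
  fix w :: "'a list"
  have "two_word_concat u v {} = periodic_point u" by (auto simp: bi_concat_def periodic_point_def)
  moreover have "mix_freq u v 0 w =
      (\<Sum>j<length u. of_bool (block (two_word_concat u v {}) (int j) (length w) = w)) / real (length u)"
    by (subst mix_freq_polynomial) (simp, subst pattern_weights_endpoints(1)[OF finite_touched], rule HOL.refl)
  ultimately show "mix_freq u v 0 w = orbit_freq u w" by (simp only: orbit_freq_def)
qed

lemma mix_freq_1:
  assumes "length v = length u"
  shows "mix_freq u v 1 = orbit_freq v"
proof
  fix w :: "'a list"
  have "block (two_word_concat u v (touched (length u) i n)) i n = block (periodic_point v) i n" for i n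
    using in_touched[of _ n i "length u"] assms by (intro block_cong) (auto simp: bi_concat_def periodic_point_def)
  moreover have "mix_freq u v 1 w = (\<Sum>j<length u. of_bool (block (two_word_concat u v
      (touched (length u) (int j) (length w))) (int j) (length w) = w)) / real (length u)"
    by (subst mix_freq_polynomial) (simp, subst pattern_weights_endpoints(2)[OF finite_touched], rule HOL.refl)
  ultimately show "mix_freq u v 1 w = orbit_freq v w" by (simp only: orbit_freq_def assms)
qed

text \<open>
  A window that lies inside one block sees only \<open>u\<close> or only \<open>v\<close>, with probabilities \<open>1 - t\<close> and \<open>t\<close>. All
  but at most \<open>length w\<close> of the positions in a block are of this kind.
\<close>
lemma mix_freq_nearly_affine:
  assumes t: "t \<in> {0..1}" and len: "length v = length u" "u \<noteq> []"
  shows "\<bar>mix_freq u v t w - ((1 - t) * orbit_freq u w + t * orbit_freq v w)\<bar> \<le> real (length w) / real (length u)"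
proof -
  let ?L = "length u" and ?n = "length w"
  define a where "a j = measure iid_uniform {\<omega>. block (two_word_concat u v {k. \<omega> k < t}) (int j) ?n = w}" for j
  define b where "b j = (1 - t) * of_bool (block (periodic_point u) (int j) ?n = w)
    + t * of_bool (block (periodic_point v) (int j) ?n = w)" for j
  have inside: "a j = b j" if "j + ?n \<le> ?L" for j
  proof -
    have div: "(int j + int k) div int ?L = 0" if "k < ?n" for k
      using \<open>j + ?n \<le> ?L\<close> that by (intro div_pos_pos_trivial) auto
    have pow: "Pow {0::int} = {{}, {0}}" by auto
    have "block (two_word_concat u v {}) (int j) ?n = block (periodic_point u) (int j) ?n"
      by (intro block_cong) (simp add: bi_concat_def periodic_point_def)
    moreover have "block (two_word_concat u v {0}) (int j) ?n = block (periodic_point v) (int j) ?n"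
      using len(1) div by (intro block_cong) (simp add: bi_concat_def periodic_point_def)
    ultimately show ?thesis
      unfolding a_def b_def using block_probability[of "{0}" t ?n "int j" u v w] t div
      by (simp add: pow algebra_simps)
  qed
  interpret P: prob_space iid_uniform by (rule prob_space_iid_uniform)
  have any: "\<bar>a j - b j\<bar> \<le> 1" for j
  proof -
    have "0 \<le> a j" "a j \<le> 1" by (simp_all add: a_def)
    moreover have "0 \<le> b j" "b j \<le> 1" using t by (auto simp: b_def of_bool_def)
    ultimately show ?thesis by linarith
  qed
  have "\<bar>(\<Sum>j<?L. a j) - (\<Sum>j<?L. b j)\<bar> = \<bar>\<Sum>j<?L. a j - b j\<bar>" by (simp add: sum_subtractf)
  also have "\<dots> \<le> (\<Sum>j<?L. \<bar>a j - b j\<bar>)" by (rule sum_abs)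
  also have "\<dots> \<le> (\<Sum>j<?L. of_bool (?L < j + ?n))"
    by (intro sum_mono) (use inside any in \<open>auto simp: not_less\<close>)
  also have "\<dots> = real (card {j \<in> {..<?L}. ?L < j + ?n})"
    by (simp add: sum.inter_filter[symmetric] of_bool_def)
  also have "\<dots> \<le> real ?n"
  proof -
    have "card {j \<in> {..<?L}. ?L < j + ?n} \<le> card {?L - ?n..<?L}" by (intro card_mono) auto
    then show ?thesis by simp
  qed
  finally have "\<bar>(\<Sum>j<?L. a j) - (\<Sum>j<?L. b j)\<bar> / real ?L \<le> real ?n / real ?L"
    by (intro divide_right_mono) auto
  moreover have "mix_freq u v t w = (\<Sum>j<?L. a j) / real ?L" by (simp add: mix_freq_def a_def)
  moreover have "(1 - t) * orbit_freq u w + t * orbit_freq v w = (\<Sum>j<?L. b j) / real ?L"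
    by (simp add: orbit_freq_def b_def len(1) sum.distrib sum_distrib_left[symmetric] add_divide_distrib)
  ultimately show ?thesis by (simp add: diff_divide_distrib[symmetric])
qed

section \<open>Periodic orbits among the ergodic measures of a subshift\<close>

lemma nth_concat_replicate: "i < k * length u \<Longrightarrow> concat (replicate k u) ! i = u ! (i mod length u)"
proof (induction k arbitrary: i)
  case (Suc k)
  then show ?case by (cases "i < length u") (auto simp: nth_append le_mod_geq)
qed simp

lemma length_concat_replicate [simp]: "length (concat (replicate k u)) = k * length u"
  by (induction k) auto

lemma periodic_point_power:
  assumes "0 < k"
  shows "periodic_point (concat (replicate k u)) = periodic_point u"
proof
  fix i
  show "periodic_point (concat (replicate k u)) i = periodic_point u i"
  proof (cases "u = []")
    case False
    let ?r = "nat (i mod int (k * length u))"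
    have "i mod int (k * length u) < int (k * length u)" "0 \<le> i mod int (k * length u)"
      using False assms by simp_all
    then have "?r < k * length u" by linarith
    then have "concat (replicate k u) ! ?r = u ! (?r mod length u)" by (rule nth_concat_replicate)
    moreover have "?r mod length u = nat (i mod int (length u))"
    proof -
      have "int (?r mod length u) = (i mod int (k * length u)) mod int (length u)"
        using False assms by (simp add: zmod_int)
      also have "\<dots> = i mod int (length u)" by (simp add: mod_mod_cancel)
      finally show ?thesis by simp
    qed
    ultimately show ?thesis by (simp add: periodic_point_def)
  qed (simp add: periodic_point_def)
qed

lemma periodic_point_shift: "periodic_point u (i + int (length u)) = periodic_point u i"
  by (simp add: periodic_point_def)

lemma sum_lessThan_add: "(\<Sum>j<m + n. f j) = (\<Sum>j<m. f j) + (\<Sum>j<n. f (m + j))"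
  for f :: "nat \<Rightarrow> real"
  by (induction n) simp_all

lemma sum_periodic:
  fixes g :: "nat \<Rightarrow> real"
  assumes "\<And>j. g (j + L) = g j"
  shows "(\<Sum>j<k * L. g j) = real k * (\<Sum>j<L. g j)"
proof (induction k)
  case (Suc k)
  have per: "g (k * L + j) = g j" for j k
  proof (induction k)
    case (Suc k)
    then show ?case using assms[of "k * L + j"] by (simp add: ac_simps)
  qed simp
  have "Suc k * L = k * L + L" by simp
  then have "(\<Sum>j<Suc k * L. g j) = (\<Sum>j<k * L. g j) + (\<Sum>j<L. g (k * L + j))"
    by (simp only: sum_lessThan_add)
  then show ?case unfolding per Suc by (simp add: algebra_simps)
qed simp

lemma orbit_freq_power:
  assumes "0 < k"
  shows "orbit_freq (concat (replicate k u)) = orbit_freq u"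
proof
  fix w :: "'a list"
  define g where "g j = (of_bool (block (periodic_point u) (int j) (length w) = w) :: real)" for j
  have "g (j + length u) = g j" for j
  proof -
    have "block (periodic_point u) (int (j + length u)) (length w) = block (periodic_point u) (int j) (length w)"
      unfolding block_def
      by (intro map_cong HOL.refl) (metis add.assoc add.commute of_nat_add periodic_point_shift)
    then show ?thesis by (simp only: g_def)
  qed
  then have "(\<Sum>j<k * length u. g j) = real k * (\<Sum>j<length u. g j)" by (rule sum_periodic)
  then show "orbit_freq (concat (replicate k u)) w = orbit_freq u w"
    using assms by (simp add: orbit_freq_def periodic_point_power g_def)
qed

lemma averages_close:
  fixes s s' :: real
  assumes n: "0 < n" "n \<le> m" and s: "\<bar>s' - s\<bar> \<le> d" "0 \<le> s" "s \<le> real n" and m: "real m \<le> real n + c"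
  shows "\<bar>s' / real m - s / real n\<bar> \<le> (d + c) / real n"
proof -
  have "s' / real m - s / real n = (s' - s) / real m - s / real n * ((real m - real n) / real m)"
    using n by (simp add: field_simps)
  then have "\<bar>s' / real m - s / real n\<bar> \<le> \<bar>s' - s\<bar> / real m + s / real n * ((real m - real n) / real m)"
    using n s abs_triangle_ineq4[of "(s' - s) / real m" "s / real n * ((real m - real n) / real m)"]
    by (simp add: abs_mult)
  also have "\<bar>s' - s\<bar> / real m \<le> d / real n"
    using s(1) n by (intro frac_le) auto
  also have "s / real n * ((real m - real n) / real m) \<le> 1 * (c / real n)"
    using s n m by (intro mult_mono frac_le) auto
  finally show ?thesis by (simp add: add_divide_distrib)
qed

text \<open>
  Periodic continuation and the two attached words affect at most \<open>length w + length a + length b\<close>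
  occurrences; the remaining \<open>length a + length b\<close> is the price of normalising by the length of the
  extended block instead of \<open>n\<close>.
\<close>
lemma orbit_freq_of_extended_block:
  fixes x :: "int \<Rightarrow> 'a" and a b w :: "'a list"
  assumes n: "0 < n"
  defines "u \<equiv> a @ block x 0 n @ b"
  shows "\<bar>orbit_freq u w - (\<Sum>i<n. of_bool (block x (int i) (length w) = w)) / real n\<bar>
    \<le> (real (length w) + 2 * real (length a + length b)) / real n"
proof -
  let ?m = "length w" and ?A = "length a" and ?B = "length b"
  define f where "f j = (of_bool (block (periodic_point u) (int j) ?m = w) :: real)" for j
  define h where "h i = (of_bool (block x (int i) ?m = w) :: real)" for i
  have f01: "0 \<le> f j" "f j \<le> 1" and h01: "0 \<le> h j" "h j \<le> 1" for j
    by (simp_all add: f_def h_def)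
  have len: "length u = ?A + n + ?B" by (simp add: u_def)
  have eq: "f (?A + i) = h i" if "i + ?m \<le> n" for i
  proof -
    have "block (periodic_point u) (int (?A + i)) ?m = block x (int i) ?m"
    proof (simp only: block_def, intro map_cong HOL.refl)
      fix k assume "k \<in> set [0..<?m]"
      then have k: "i + k < n" using that by simp
      have "(int (?A + i) + int k) mod int (length u) = int (?A + i + k)"
        using k by (simp add: len)
      then have "periodic_point u (int (?A + i) + int k) = u ! (?A + i + k)"
        by (simp only: periodic_point_def nat_int)
      also have "\<dots> = x (int i + int k)" using k by (simp add: u_def nth_append add.assoc)
      finally show "periodic_point u (int (?A + i) + int k) = x (int i + int k)" .
    qed
    then show ?thesis by (simp only: f_def h_def)
  qed
  have split: "(\<Sum>j<?A + n + ?B. f j) = (\<Sum>j<?A. f j) + (\<Sum>i<n. f (?A + i)) + (\<Sum>j<?B. f (?A + n + j))"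
    by (simp only: sum_lessThan_add)
  have "\<bar>(\<Sum>i<n. f (?A + i)) - (\<Sum>i<n. h i)\<bar> \<le> (\<Sum>i<n. \<bar>f (?A + i) - h i\<bar>)"
    unfolding sum_subtractf[symmetric] by (rule sum_abs)
  also have "\<dots> \<le> (\<Sum>i<n. if n < i + ?m then 1 else 0)"
  proof (rule sum_mono)
    fix i
    show "\<bar>f (?A + i) - h i\<bar> \<le> (if n < i + ?m then 1 else 0)"
    proof (cases "n < i + ?m")
      case True
      then show ?thesis using f01[of "?A + i"] h01[of i] by (simp only: if_True)
    next
      case False
      then show ?thesis using eq[of i] by simp
    qed
  qed
  also have "\<dots> = real (card {i \<in> {..<n}. n < i + ?m})"
    by (subst sum.inter_filter[symmetric]) simp_all
  also have "\<dots> \<le> real ?m"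
  proof -
    have "card {i \<in> {..<n}. n < i + ?m} \<le> card {n - ?m..<n}" by (intro card_mono) auto
    then show ?thesis by simp
  qed
  finally have mid: "\<bar>(\<Sum>i<n. f (?A + i)) - (\<Sum>i<n. h i)\<bar> \<le> real ?m" .
  have bnd: "0 \<le> (\<Sum>j<k. f (c + j))" "(\<Sum>j<k. f (c + j)) \<le> real k" for c k
    using f01 sum_bounded_above[of "{..<k}" "\<lambda>j. f (c + j)" 1] by (simp_all add: sum_nonneg)
  have "\<bar>(\<Sum>j<length u. f j) - (\<Sum>i<n. h i)\<bar> \<le> real ?m + real (?A + ?B)"
    unfolding len split using mid bnd[of 0 ?A] bnd[of "?A + n" ?B] by simp
  moreover have "0 \<le> (\<Sum>i<n. h i)" "(\<Sum>i<n. h i) \<le> real n"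
    using h01 sum_bounded_above[of "{..<n}" h 1] by (simp_all add: sum_nonneg)
  ultimately have "\<bar>(\<Sum>j<length u. f j) / real (length u) - (\<Sum>i<n. h i) / real n\<bar>
      \<le> (real ?m + real (?A + ?B) + real (?A + ?B)) / real n"
    by (intro averages_close n) (simp_all add: len)
  then show ?thesis unfolding orbit_freq_def f_def h_def by (simp add: algebra_simps)
qed

context subshift
begin

lemma left_shift_in: "x \<in> X \<Longrightarrow> left_shift x \<in> X"
  using translate[of x 1] by (simp add: left_shift_def)

lemma measurable_left_shift: "left_shift \<in> measurable (restrict_space borel X) (restrict_space borel X)"
proof (rule measurable_restrict_space2)
  have "(\<lambda>x. left_shift x i) \<in> borel_measurable (restrict_space borel X)" for i
    unfolding left_shift_def by (rule measurable_restrict_space1[OF measurable_product_coordinates])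
  then show "left_shift \<in> borel_measurable (restrict_space borel X)"
    by (rule measurable_coordinatewise_then_product)
qed (simp add: space_restrict_space left_shift_in)

text \<open>
  Shifting a random concatenation by a full block is the same as shifting the coin tosses. Hence the
  average over the positions in a block is invariant, and an invariant set pulls back to a set of coin
  tosses which is invariant under their shift and so has probability \<open>0\<close> or \<open>1\<close>.
\<close>
lemma mix_freq_ergodic:
  assumes len: "length v = length u" "u \<noteq> []" and t: "t \<in> {0..1}"
    and conc: "\<And>T. two_word_concat u v T \<in> X"
  shows "mix_freq u v t \<in> word_prob X ` ergodic_measures left_shift X"
proof -
  define N where "N = restrict_space borel X"
  define L where "L = length u"
  have L: "0 < L" using len by (simp add: L_def)
  define F where "F j \<omega> = (\<lambda>i. two_word_concat u v {k. \<omega> k < t} (i + int j))" for j :: nat and \<omega> :: "int \<Rightarrow> real"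
  define S where "S \<omega> = (\<lambda>i. \<omega> (i + 1))" for \<omega> :: "int \<Rightarrow> real"
  interpret P: prob_space iid_uniform by (rule prob_space_iid_uniform)
  have spN: "space N = X" by (simp add: N_def space_restrict_space)
  have FX: "F j \<omega> \<in> X" for j \<omega> unfolding F_def by (rule translate[OF conc])
  have F: "F j \<in> measurable iid_uniform N" for j
    unfolding N_def
  proof (rule measurable_restrict_space2)
    have "(\<lambda>\<omega>. F j \<omega> i) \<in> borel_measurable iid_uniform" for i
    proof -
      let ?k = "(i + int j) div int (length u)" and ?r = "nat ((i + int j) mod int (length u))"
      have "{\<omega>. {k \<in> {?k}. \<omega> k < t} \<noteq> {}} \<in> sets iid_uniform"
        by (rule bernoulli_pattern_probability(2)[OF _ t, where R = "\<lambda>T. T \<noteq> {}"]) simp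
      then have "{\<omega> \<in> space iid_uniform. \<omega> ?k < t} \<in> sets iid_uniform" by simp
      then have "(\<lambda>\<omega>. if \<omega> ?k < t then v ! ?r else u ! ?r) \<in> borel_measurable iid_uniform"
        by (intro measurable_If) simp_all
      moreover have "(\<lambda>\<omega>. F j \<omega> i) = (\<lambda>\<omega>. if \<omega> ?k < t then v ! ?r else u ! ?r)"
        by (auto simp: F_def bi_concat_def)
      ultimately show ?thesis by simp
    qed
    then show "F j \<in> borel_measurable iid_uniform" by (rule measurable_coordinatewise_then_product)
  qed (use FX in auto)
  obtain \<mu> where \<mu>: "prob_space \<mu>" "sets \<mu> = sets N"
    "\<And>B. B \<in> sets N \<Longrightarrow> measure \<mu> B = (\<Sum>j<L. measure iid_uniform (F j -` B \<inter> space iid_uniform)) / real L"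
    by (rule average_of_distributions[of iid_uniform L F N, OF prob_space_iid_uniform F L]) blast
  interpret \<mu>: prob_space \<mu> by (rule \<mu>(1))
  define p where "p j B = measure iid_uniform (F j -` B)" for j B
  have m: "measure \<mu> B = (\<Sum>j<L. p j B) / real L" if "B \<in> sets N" for B
    using \<mu>(3)[OF that] by (simp add: p_def)
  have b: "\<mu> \<in> borel_prob_measures X" using \<mu> by (simp add: borel_prob_measures_def N_def)
  have sp: "space \<mu> = X" by (rule space_borel_prob[OF b])
  \<comment> \<open>The shift moves to the next position and, after the last one, to the next coin toss.\<close>
  have FS: "left_shift (F j \<omega>) = F (Suc j) \<omega>" for j \<omega>
    by (rule ext) (simp add: left_shift_def F_def algebra_simps)
  have FL: "F L \<omega> = F 0 (S \<omega>)" for \<omega>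
  proof
    fix i
    show "F L \<omega> i = F 0 (S \<omega>) i"
      unfolding F_def S_def L_def using bi_concat_shift[of "length u" _ i] L by (simp add: L_def)
  qed
  have Fm: "F j -` B \<in> sets iid_uniform" if "B \<in> sets N" for j B
    using measurable_sets[OF F that, of j] by simp
  have Sm: "S \<in> measurable iid_uniform iid_uniform"
    unfolding S_def iid_uniform_def by (rule measurable_PiM_shift) simp
  have Sinv: "measure iid_uniform (S -` B) = measure iid_uniform B" if "B \<in> sets iid_uniform" for B
  proof -
    have "distr iid_uniform iid_uniform S = iid_uniform"
      unfolding S_def iid_uniform_def by (rule distr_PiM_shift) (simp_all add: prob_space_unit_uniform)
    then show ?thesis using measure_distr[OF Sm that] by simp
  qed
  have "emeasure \<mu> (left_shift -` B \<inter> space \<mu>) = emeasure \<mu> B" if "B \<in> sets \<mu>" for B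
  proof -
    have B: "B \<in> sets N" using that \<mu> by simp
    then have B': "left_shift -` B \<inter> X \<in> sets N"
      using measurable_sets[OF measurable_left_shift, of B] by (simp add: N_def space_restrict_space)
    have "p j (left_shift -` B \<inter> X) = p (Suc j) B" for j
    proof -
      have "F j -` (left_shift -` B \<inter> X) = F (Suc j) -` B" using FX FS by auto
      then show ?thesis by (simp add: p_def)
    qed
    moreover have "p L B = p 0 B"
    proof -
      have "F L -` B = S -` (F 0 -` B)" using FL by auto
      then show ?thesis using Sinv[OF Fm[OF B]] by (simp add: p_def)
    qed
    moreover have "(\<Sum>j<L. p (Suc j) B) = (\<Sum>j<L. p j B) + p L B - p 0 B"
      using sum.lessThan_Suc_shift[of "\<lambda>j. p j B" L] by simp
    ultimately have "measure \<mu> (left_shift -` B \<inter> X) = measure \<mu> B"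
      using m[OF B] m[OF B'] by simp
    then show ?thesis by (simp add: \<mu>.emeasure_eq_measure sp)
  qed
  then have inv: "\<mu> \<in> invariant_measures left_shift X" using b by (simp add: invariant_measures_def)
  have "emeasure \<mu> B = 0 \<or> emeasure \<mu> B = 1" if B\<mu>: "B \<in> sets \<mu>" and Binv: "left_shift -` B \<inter> space \<mu> = B" for B
  proof -
    have B: "B \<in> sets N" using B\<mu> \<mu> by simp
    have step: "F (Suc j) \<omega> \<in> B \<longleftrightarrow> F j \<omega> \<in> B" for j \<omega>
    proof -
      have "F j \<omega> \<in> left_shift -` B \<inter> space \<mu> \<longleftrightarrow> F j \<omega> \<in> B" by (simp only: Binv)
      then show ?thesis using FX[of j \<omega>] FS[of j \<omega>] by (simp add: sp)
    qed
    have all: "F j \<omega> \<in> B \<longleftrightarrow> F 0 \<omega> \<in> B" for j \<omega>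
      by (induction j) (simp_all add: step)
    have "S -` (F 0 -` B) = F 0 -` B" using all[of L] FL by auto
    then have "emeasure iid_uniform (F 0 -` B) = 0 \<or> emeasure iid_uniform (F 0 -` B) = 1"
      using PiM_shift_ergodic[OF prob_space_unit_uniform space_unit_uniform, of "F 0 -` B"] Fm[OF B, of 0]
      unfolding S_def iid_uniform_def[symmetric] by simp
    moreover have p0: "p j B = p 0 B" for j
    proof -
      have "F j -` B = F 0 -` B" using all by auto
      then show ?thesis by (simp add: p_def)
    qed
    have "(\<Sum>j<L. p j B) = (\<Sum>j<L. p 0 B)" by (rule sum.cong[OF HOL.refl p0])
    then have "measure \<mu> B = measure iid_uniform (F 0 -` B)" using m[OF B] L by (simp add: p_def)
    ultimately show ?thesis by (simp add: \<mu>.emeasure_eq_measure P.emeasure_eq_measure)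
  qed
  then have erg: "\<mu> \<in> ergodic_measures left_shift X" using inv by (simp add: ergodic_measures_def)
  have "word_prob X \<mu> w = mix_freq u v t w" for w
  proof -
    let ?B = "{x \<in> X. block x 0 (length w) = w}"
    have "?B \<in> sets N" using block_eq_event[OF b] \<mu>(2) by simp
    moreover have "p j ?B = measure iid_uniform {\<omega>. block (two_word_concat u v {k. \<omega> k < t}) (int j) (length w) = w}" for j
    proof -
      have "block (F j \<omega>) 0 (length w) = block (two_word_concat u v {k. \<omega> k < t}) (int j) (length w)" for \<omega>
        unfolding F_def by (simp only: block_shift add_0)
      then have "F j -` ?B = {\<omega>. block (two_word_concat u v {k. \<omega> k < t}) (int j) (length w) = w}"
        using FX by auto
      then show ?thesis by (simp add: p_def)
    qed
    ultimately show ?thesis unfolding word_prob_def mix_freq_def using m[of ?B] by (simp add: L_def)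
  qed
  then have "mix_freq u v t = word_prob X \<mu>" by auto
  then show ?thesis using erg by blast
qed

text \<open>
  A common length \<open>L\<close> of the concatenated words is no restriction for the purpose of joining two periodic
  orbits, as two words can be replaced by powers of equal length.
\<close>
definition freely_concatenable :: "'a list set \<Rightarrow> bool" where
  "freely_concatenable S \<longleftrightarrow> [] \<notin> S \<and> (\<forall>u\<in>S. \<forall>k>0. concat (replicate k u) \<in> S) \<and>
    (\<forall>L y. (\<forall>i. y i \<in> S \<and> length (y i) = L) \<longrightarrow> bi_concat L y \<in> X)"

lemma freely_concatenable_two_words:
  assumes "freely_concatenable S" "u \<in> S" "v \<in> S" "length v = length u"
  shows "two_word_concat u v T \<in> X"
  using assms unfolding freely_concatenable_def by auto

lemma orbit_freq_ergodic:
  assumes "freely_concatenable S"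
  shows "orbit_freq ` S \<subseteq> word_prob X ` ergodic_measures left_shift X"
proof
  fix q assume "q \<in> orbit_freq ` S"
  then obtain u where u: "u \<in> S" "q = orbit_freq u" by blast
  have "mix_freq u u 0 \<in> word_prob X ` ergodic_measures left_shift X"
    by (rule mix_freq_ergodic) (use assms u in \<open>auto simp: freely_concatenable_def\<close>)
  then show "q \<in> word_prob X ` ergodic_measures left_shift X" by (simp add: mix_freq_0 u)
qed

text \<open>
  Powers \<open>U\<close> of \<open>u\<close> and \<open>V\<close> of \<open>v\<close> of the same length have the same periodic orbits as \<open>u\<close> and \<open>v\<close>, and if
  that length is large compared with the words in \<open>K\<close>, the path \<open>mix_freq U V\<close> is as straight as
  required.
\<close>
lemma nearly_affinely_connected_orbits:
  assumes S: "freely_concatenable S"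
  shows "nearly_affinely_connected (word_prob X ` ergodic_measures left_shift X) (orbit_freq ` S)"
  unfolding nearly_affinely_connected_def
proof (intro ballI allI impI)
  fix q q' and K :: "'a list set" and e :: real
  assume "q \<in> orbit_freq ` S" "q' \<in> orbit_freq ` S" and K: "finite K" and e: "0 < e"
  then obtain u v where u: "u \<in> S" "q = orbit_freq u" and v: "v \<in> S" "q' = orbit_freq v" by blast
  have ne: "u \<noteq> []" "v \<noteq> []" using S u v by (auto simp: freely_concatenable_def)
  obtain B where B: "\<And>w. w \<in> K \<Longrightarrow> length w \<le> B"
    using finite_nat_set_iff_bounded_le[of "length ` K"] K by auto
  obtain k :: nat where k: "real B / e < real k" using reals_Archimedean2 by blast
  then have k0: "0 < k" using e by (cases k) (auto simp: field_simps not_less zero_less_mult_iff)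
  define U where "U = concat (replicate (k * length v) u)"
  define V where "V = concat (replicate (k * length u) v)"
  have US: "U \<in> S" "V \<in> S"
    using S u(1) v(1) k0 ne by (simp_all add: U_def V_def freely_concatenable_def)
  have len: "length V = length U" by (simp add: U_def V_def)
  have Une: "U \<noteq> []" using US(1) S unfolding freely_concatenable_def by metis
  \<comment> \<open>Powers have the same periodic orbit, so the path keeps its ends.\<close>
  have qU: "orbit_freq U = q" "orbit_freq V = q'"
    using k0 ne by (simp_all add: U_def V_def u v orbit_freq_power)
  have "k \<le> length U" using ne by (simp add: U_def Suc_leI)
  then have small: "real (length w) / real (length U) < e" if "w \<in> K" for w
  proof -
    have "real (length w) \<le> real B" using B[OF that] by simp
    also have "\<dots> < e * real k" using k e by (simp add: field_simps)
    also have "\<dots> \<le> e * real (length U)" using \<open>k \<le> length U\<close> e by simp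
    finally show ?thesis using Une by (simp add: field_simps)
  qed
  show "\<exists>g. continuous_on {0..1} g \<and> g 0 = q \<and> g 1 = q' \<and>
      (\<forall>t\<in>{0..1}. g t \<in> word_prob X ` ergodic_measures left_shift X \<and>
        (\<forall>w\<in>K. \<bar>g t w - ((1 - t) * q w + t * q' w)\<bar> < e))"
  proof (rule exI[of _ "mix_freq U V"], intro conjI ballI)
    show "mix_freq U V 0 = q" "mix_freq U V 1 = q'"
      using mix_freq_0[of U V] mix_freq_1[OF len] qU by simp_all
    show "continuous_on {0..1} (mix_freq U V)" by (rule continuous_on_mix_freq)
    fix t :: real assume t: "t \<in> {0..1}"
    show "mix_freq U V t \<in> word_prob X ` ergodic_measures left_shift X"
      by (rule mix_freq_ergodic[OF len Une t freely_concatenable_two_words[OF S US len]])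
    fix w assume "w \<in> K"
    from small[OF this] mix_freq_nearly_affine[OF t len Une, of w]
    show "\<bar>mix_freq U V t w - ((1 - t) * q w + t * q' w)\<bar> < e" unfolding qU by linarith
  qed
qed

text \<open>
  There are only countably many words, so almost every point satisfies Birkhoff's theorem for all of
  them simultaneously.
\<close>
lemma generic_point:
  assumes \<mu>: "\<mu> \<in> ergodic_measures left_shift X"
  obtains x where "x \<in> X"
    "\<And>w. (\<lambda>n. (\<Sum>i<n. of_bool (block x (int i) (length w) = w)) / real n) \<longlonglongrightarrow> word_prob X \<mu> w"
proof -
  have inv: "\<mu> \<in> invariant_measures left_shift X" using \<mu> ergodic_invariant by blast
  note b = invariant_borel[OF inv]
  interpret prob_space \<mu> using b by (simp add: borel_prob_measures_def)
  have sets\<mu>: "sets \<mu> = sets (restrict_space borel X)" using b by (simp add: borel_prob_measures_def)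
  have sp: "space \<mu> = X" by (rule space_borel_prob[OF b])
  have T: "left_shift \<in> measurable \<mu> \<mu>"
    using measurable_left_shift measurable_cong_sets[OF sets\<mu> sets\<mu>] by simp
  have dT: "distr \<mu> \<mu> left_shift = \<mu>"
    by (rule measure_eqI) (use inv T in \<open>auto simp: emeasure_distr invariant_measures_def\<close>)
  have erg: "emeasure \<mu> B = 0 \<or> emeasure \<mu> B = 1" if "B \<in> sets \<mu>" "left_shift -` B \<inter> space \<mu> = B" for B
    using \<mu> that by (simp add: ergodic_measures_def)
  let ?f = "\<lambda>w. indicator {x \<in> X. block x 0 (length w) = w} :: _ \<Rightarrow> real"
  have ev: "{x \<in> X. block x 0 (length w) = w} \<in> sets \<mu>" for w by (rule block_eq_event[OF b])
  have iter: "(left_shift ^^ i) x = (\<lambda>k. x (k + int i))" for i :: nat and x :: "int \<Rightarrow> 'a"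
    by (induction i) (simp_all add: left_shift_def algebra_simps)
  have conv: "AE x in \<mu>. (\<lambda>n. (\<Sum>i<n. ?f w ((left_shift ^^ i) x)) / real n) \<longlonglongrightarrow> word_prob X \<mu> w" for w
  proof -
    have "AE x in \<mu>. (\<lambda>n. (\<Sum>i<n. ?f w ((left_shift ^^ i) x)) / real n) \<longlonglongrightarrow> (\<integral>x. ?f w x \<partial>\<mu>)"
    proof (rule birkhoff_ergodic[where f = "?f w" and C = 1, OF T dT])
      show "?f w \<in> borel_measurable \<mu>" using ev[of w] by simp
      show "\<bar>?f w x\<bar> \<le> 1" for x by (simp add: indicator_def)
    qed (rule erg)
    moreover have "(\<integral>x. ?f w x \<partial>\<mu>) = word_prob X \<mu> w" using ev[of w] by (simp add: word_prob_def)
    ultimately show ?thesis by simp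
  qed
  have "AE x in \<mu>. \<forall>w. (\<lambda>n. (\<Sum>i<n. ?f w ((left_shift ^^ i) x)) / real n) \<longlonglongrightarrow> word_prob X \<mu> w"
    unfolding AE_all_countable using conv by blast
  then have "AE x in \<mu>. x \<in> space \<mu> \<and>
      (\<forall>w. (\<lambda>n. (\<Sum>i<n. ?f w ((left_shift ^^ i) x)) / real n) \<longlonglongrightarrow> word_prob X \<mu> w)"
    by (rule AE_conjI[OF AE_space])
  from eventually_happens'[OF ae_filter_bot this] obtain x where x: "x \<in> space \<mu>"
    "\<And>w. (\<lambda>n. (\<Sum>i<n. ?f w ((left_shift ^^ i) x)) / real n) \<longlonglongrightarrow> word_prob X \<mu> w"
    by blast
  have "?f w ((left_shift ^^ i) x) = of_bool (block x (int i) (length w) = w)" for w i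
  proof -
    have "(\<lambda>k. x (k + int i)) \<in> X" using x(1) sp by (intro translate) simp
    then show ?thesis by (simp add: iter block_shift indicator_def)
  qed
  then show ?thesis using x sp by (intro that[of x]) simp_all
qed

lemma generic_point_box_closure:
  fixes x :: "int \<Rightarrow> 'a"
  assumes lim: "\<And>w. (\<lambda>n. (\<Sum>i<n. of_bool (block x (int i) (length w) = w)) / real n) \<longlonglongrightarrow> c w"
    and S: "\<And>e. 0 < e \<Longrightarrow> \<forall>\<^sub>F n in sequentially. \<exists>a b. a @ block x 0 n @ b \<in> S \<and>
      real (length a + length b) \<le> e * real n"
  shows "c \<in> box_closure (orbit_freq ` S)"
  unfolding box_closure_def
proof (intro CollectI allI impI)
  fix K :: "'a list set" and e :: real
  assume K: "finite K" and e: "0 < e"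
  obtain B where B: "\<And>w. w \<in> K \<Longrightarrow> length w \<le> B"
    using finite_nat_set_iff_bounded_le[of "length ` K"] K by auto
  have "\<forall>\<^sub>F n in sequentially. \<forall>w\<in>K. dist ((\<Sum>i<n. of_bool (block x (int i) (length w) = w)) / real n) (c w) < e / 4"
    using K e by (intro eventually_ball_finite ballI tendstoD[OF lim]) auto
  moreover have "\<forall>\<^sub>F n in sequentially. \<exists>a b. a @ block x 0 n @ b \<in> S \<and>
      real (length a + length b) \<le> e / 8 * real n" using e by (intro S) simp
  moreover have "\<forall>\<^sub>F n in sequentially. 4 * real B / e < real n"
    using filterlim_real_sequentially by (simp add: filterlim_at_top_dense)
  moreover have "\<forall>\<^sub>F n in sequentially. (0::nat) < n" by (rule eventually_gt_at_top)
  ultimately have "\<forall>\<^sub>F n in sequentially.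
      (\<forall>w\<in>K. dist ((\<Sum>i<n. of_bool (block x (int i) (length w) = w)) / real n) (c w) < e / 4) \<and>
      (\<exists>a b. a @ block x 0 n @ b \<in> S \<and> real (length a + length b) \<le> e / 8 * real n) \<and>
      4 * real B / e < real n \<and> 0 < n"
    by (intro eventually_conj)
  then obtain n where n1: "\<And>w. w \<in> K \<Longrightarrow> dist ((\<Sum>i<n. of_bool (block x (int i) (length w) = w)) / real n) (c w) < e / 4"
    and n2: "\<exists>a b. a @ block x 0 n @ b \<in> S \<and> real (length a + length b) \<le> e / 8 * real n"
    and n3: "4 * real B / e < real n" "0 < n"
    using eventually_happens'[OF sequentially_bot] by blast
  obtain a b where ab: "a @ block x 0 n @ b \<in> S" "real (length a + length b) \<le> e / 8 * real n"
    using n2 by blast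
  let ?u = "a @ block x 0 n @ b"
  have "\<bar>orbit_freq ?u w - c w\<bar> < e" if w: "w \<in> K" for w
  proof -
    have "real (length w) \<le> real B" using B[OF w] by simp
    moreover define p where "p = e * real n"
    moreover have "4 * real B < p" using n3 e by (simp add: field_simps p_def)
    moreover have "real (length a + length b) \<le> p / 8" using ab(2) by (simp add: p_def)
    moreover have "y + 2 * l \<le> p / 2" if "y \<le> r" "4 * r < p" "l \<le> p / 8" for y r l :: real
      using that by linarith
    ultimately have "real (length w) + 2 * real (length a + length b) \<le> p / 2" by blast
    then have "real (length w) + 2 * real (length a + length b) \<le> e / 2 * real n" by (simp add: p_def)
    then have "(real (length w) + 2 * real (length a + length b)) / real n \<le> e / 2"
      using n3(2) by (simp add: field_simps)
    then show ?thesis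
      using orbit_freq_of_extended_block[OF n3(2), of a x b w] n1[OF w] e unfolding dist_real_def by linarith
  qed
  then have "orbit_freq ?u \<in> orbit_freq ` S \<inter> coord_box c K e"
    using ab(1) by (auto simp: coord_box_def)
  then show "orbit_freq ` S \<inter> coord_box c K e \<noteq> {}" by blast
qed

end

section \<open>Opening and closing words\<close>

lemma sym_act_indices:
  "sym_act c s = Some t \<Longrightarrow> c \<in> dm_alphabet M N \<Longrightarrow> set s \<subseteq> {1..M} \<Longrightarrow> set t \<subseteq> {1..M}"
  by (cases "(c, s)" rule: sym_act.cases) (auto simp: dm_alphabet_def split: if_splits)

lemma word_act_indices:
  "word_act w s = Some t \<Longrightarrow> set w \<subseteq> dm_alphabet M N \<Longrightarrow> set s \<subseteq> {1..M} \<Longrightarrow> set t \<subseteq> {1..M}"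
proof (induction w arbitrary: s)
  case (Cons c w)
  from Cons.prems(1) obtain s1 where s1: "sym_act c s = Some s1" "word_act w s1 = Some t"
    by (auto simp: bind_eq_Some_conv)
  have "set s1 \<subseteq> {1..M}" using sym_act_indices[OF s1(1), of M N] Cons.prems by simp
  then show ?case using Cons.IH[OF s1(2)] Cons.prems by simp
qed simp

text \<open>
  The stack can be built from the indices of letters of the alphabet, so it can be pushed and popped
  by words over the alphabet.
\<close>
lemma word_act_index_stack:
  assumes w: "set w \<subseteq> dm_alphabet M N" and s: "word_act w s \<noteq> None"
  obtains s' where "set s' \<subseteq> {1..M}" "word_act w s' \<noteq> None"
proof -
  have "\<not> dm_cong M N (Some w) None"
  proof
    assume "dm_cong M N (Some w) None"
    from fun_cong[OF dm_cong_act[OF this], of s] s show False by simp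
  qed
  then obtain b a where ba: "set b \<subseteq> {1..M}" "dm_cong M N (Some w) (Some (map Sym_beta b @ map Sym_alpha a))"
    using dm_cong_normal_form[OF w] by blast
  have "word_act w b = word_act (map Sym_beta b @ map Sym_alpha a) b"
    using fun_cong[OF dm_cong_act[OF ba(2)], of b] by simp
  also have "\<dots> \<noteq> None" using word_act_betas[of b "[]"] by (simp add: word_act_append word_act_alphas)
  finally show ?thesis by (rule that[OF ba(1)])
qed

lemma word_act_factor: "word_act (u @ v @ z) s \<noteq> None \<Longrightarrow> \<exists>s. word_act v s \<noteq> None"
  by (auto simp: word_act_append split: bind_splits)

lemma block_append: "block x i (m + n) = block x i m @ block x (i + int m) n"
  by (rule nth_equalityI) (auto simp: nth_append algebra_simps of_nat_diff)

lemma block_factor: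
  assumes "j \<le> i" "i + int n \<le> j + int m"
  obtains a b where "block x j m = a @ block x i n @ b"
proof -
  let ?k = "nat (i - j)"
  have "m = ?k + (n + (m - ?k - n))" using assms by linarith
  then have "block x j m = block x j ?k @ block x (j + int ?k) n @ block x (j + int ?k + int n) (m - ?k - n)"
    by (metis block_append)
  moreover have "j + int ?k = i" using assms by simp
  ultimately show ?thesis using that by metis
qed

lemma upto_block: "map x [j..k] = block x j (nat (k - j + 1))"
  by (rule nth_equalityI) auto

text \<open>
  Blocks of length at most \<open>1\<close>, which the definition of the shift does not mention, are factors of longer
  ones.
\<close>
lemma dyck_motzkin_shift_iff:
  "x \<in> dyck_motzkin_shift M N \<longleftrightarrow>
    (\<forall>i n. set (block x i n) \<subseteq> dm_alphabet M N \<and> (\<exists>s. word_act (block x i n) s \<noteq> None))"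
proof
  assume x: "x \<in> dyck_motzkin_shift M N"
  have letters: "set (block x i n) \<subseteq> dm_alphabet M N" for i n
    using x by (auto simp: dyck_motzkin_shift_def set_block)
  have "\<exists>s. word_act (block x i n) s \<noteq> None" for i n
  proof -
    let ?k = "i + int n + 1"
    have "i < ?k" by simp
    then have "dm_red M N (block x i (nat (?k - i + 1))) \<noteq> dm_zero M N"
      using x unfolding dyck_motzkin_shift_def upto_block[symmetric] by blast
    then obtain s where s: "word_act (block x i (nat (?k - i + 1))) s \<noteq> None"
      using dm_red_neq_zero_iff[OF letters] by blast
    obtain a b where "block x i (nat (?k - i + 1)) = a @ block x i n @ b"
      by (rule block_factor[of i i n "nat (?k - i + 1)" x]) simp_all
    then show ?thesis using word_act_factor[of a "block x i n" b s] s by simp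
  qed
  with letters show "\<forall>i n. set (block x i n) \<subseteq> dm_alphabet M N \<and> (\<exists>s. word_act (block x i n) s \<noteq> None)"
    by blast
next
  assume x: "\<forall>i n. set (block x i n) \<subseteq> dm_alphabet M N \<and> (\<exists>s. word_act (block x i n) s \<noteq> None)"
  have "x i \<in> dm_alphabet M N" for i
    using x[rule_format, of i 1] by (auto simp: set_block)
  moreover have "dm_red M N (map x [j..k]) \<noteq> dm_zero M N" for j k
    unfolding upto_block using x dm_red_neq_zero_iff by blast
  ultimately show "x \<in> dyck_motzkin_shift M N" by (simp add: dyck_motzkin_shift_def)
qed

interpretation dyck_motzkin: subshift "dyck_motzkin_shift M N" "dm_alphabet M N" for M N
proof
  show "finite (dm_alphabet M N)" by (simp add: dm_alphabet_def)
  show "x i \<in> dm_alphabet M N" if "x \<in> dyck_motzkin_shift M N" for x i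
    using that by (simp add: dyck_motzkin_shift_def)
  let ?W = "{w. set w \<subseteq> dm_alphabet M N \<and> (\<exists>s. word_act w s \<noteq> None)}"
  have "closed {x. block x i n \<in> ?W}" for i n
    using open_block[of i n "- ?W"] unfolding closed_def by (simp add: Collect_neg_eq[symmetric] Compl_eq)
  then have "closed (\<Inter>i. \<Inter>n. {x. block x i n \<in> ?W})" by (intro closed_INT ballI)
  moreover have "dyck_motzkin_shift M N = (\<Inter>i. \<Inter>n. {x. block x i n \<in> ?W})"
    unfolding set_eq_iff dyck_motzkin_shift_iff by simp
  ultimately show "closed (dyck_motzkin_shift M N)" by simp
  show "(\<lambda>i. x (i + k)) \<in> dyck_motzkin_shift M N" if "x \<in> dyck_motzkin_shift M N" for x k
    using that unfolding dyck_motzkin_shift_iff block_shift by blast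
qed

text \<open>
  An opening word reduces to \<open>\<alpha>\<close>'s only, so it runs from the empty stack. Dually, a closing word reduces to
  \<open>\<beta>\<close>'s only and can empty a stack.
\<close>
definition opening_words :: "nat \<Rightarrow> nat \<Rightarrow> dm_symbol list set" where
  "opening_words M N = {u. u \<noteq> [] \<and> set u \<subseteq> dm_alphabet M N \<and> word_act u [] \<noteq> None}"

definition closing_words :: "nat \<Rightarrow> nat \<Rightarrow> dm_symbol list set" where
  "closing_words M N = {u. u \<noteq> [] \<and> set u \<subseteq> dm_alphabet M N \<and> (\<exists>s. word_act u s = Some [])}"

lemma opening_words_append:
  assumes "u \<in> opening_words M N" "v \<in> opening_words M N"
  shows "u @ v \<in> opening_words M N"
proof -
  obtain s t where "word_act u [] = Some s" "word_act v [] = Some t"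
    using assms by (auto simp: opening_words_def)
  then have "word_act (u @ v) [] = Some (t @ s)"
    using word_act_frame[of v "[]" t s] by (simp add: word_act_append)
  then show ?thesis using assms by (simp add: opening_words_def)
qed

lemma closing_words_append:
  assumes "u \<in> closing_words M N" "v \<in> closing_words M N"
  shows "u @ v \<in> closing_words M N"
proof -
  obtain s t where "word_act u s = Some []" "word_act v t = Some []"
    using assms by (auto simp: closing_words_def)
  then have "word_act (u @ v) (s @ t) = Some []"
    using word_act_frame[of u s "[]" t] by (simp add: word_act_append)
  then show ?thesis using assms by (auto simp: closing_words_def)
qed

lemma block_bi_concat:
  assumes "\<And>i. length (y i) = L" "0 < L"
  shows "block (bi_concat L y) (int L * q) (m * L) = concat (map (\<lambda>r. y (q + int r)) [0..<m])"
proof (induction m)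
  case (Suc m)
  have "block (bi_concat L y) (int L * q + int (m * L)) L = y (q + int m)"
  proof (rule nth_equalityI)
    fix k assume "k < length (block (bi_concat L y) (int L * q + int (m * L)) L)"
    then have k: "k < L" by simp
    have "int L * q + int (m * L) + int k = int L * (q + int m) + int k" by (simp add: algebra_simps)
    moreover have "(int L * (q + int m) + int k) div int L = q + int m" using k by simp
    moreover have "(int L * (q + int m) + int k) mod int L = int k" using k by simp
    ultimately show "block (bi_concat L y) (int L * q + int (m * L)) L ! k = y (q + int m) ! k"
      using k by (simp only: nth_block bi_concat_def nat_int)
  qed (simp add: assms)
  moreover have "Suc m * L = m * L + L" by simp
  ultimately show ?case using Suc by (simp only: block_append upt_Suc_append map_append concat_append) simp
qed (simp add: block_def)

text \<open>
  Every window of a bi-infinite concatenation lies in a finite concatenation of words of \<open>S\<close>, and factors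
  of non-vanishing words do not vanish.
\<close>
lemma freely_concatenable_of_append:
  assumes app: "\<And>u v. u \<in> S \<Longrightarrow> v \<in> S \<Longrightarrow> u @ v \<in> S" and ne: "[] \<notin> S"
    and adm: "\<And>u. u \<in> S \<Longrightarrow> set u \<subseteq> dm_alphabet M N \<and> (\<exists>s. word_act u s \<noteq> None)"
  shows "dyck_motzkin.freely_concatenable M N S"
proof -
  have conc: "us \<noteq> [] \<Longrightarrow> set us \<subseteq> S \<Longrightarrow> concat us \<in> S" for us
  proof (induction us)
    case (Cons u us)
    then show ?case by (cases "us = []") (simp_all add: app)
  qed simp
  have "bi_concat L y \<in> dyck_motzkin_shift M N" if y: "\<forall>i. y i \<in> S \<and> length (y i) = L" for L y
    unfolding dyck_motzkin_shift_iff
  proof (intro allI)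
    fix i n
    have L: "0 < L" using y ne by (metis length_greater_0_conv)
    let ?q = "i div int L"
    have "concat (map (\<lambda>r. y (?q + int r)) [0..<Suc n]) \<in> S" using y by (intro conc) auto
    then have S: "block (bi_concat L y) (int L * ?q) (Suc n * L) \<in> S"
      using block_bi_concat[of y L ?q "Suc n"] y L by simp
    have "int L * ?q \<le> i" using L by (simp add: mult.commute pos_mod_sign minus_mod_eq_mult_div[symmetric])
    moreover have "i + int n \<le> int L * ?q + int (Suc n * L)"
    proof -
      have "i = int L * ?q + i mod int L" by simp
      moreover have "i mod int L < int L" using L by simp
      moreover have "int n \<le> int (n * L)" using L by (cases L) simp_all
      ultimately show ?thesis by (simp only: mult_Suc of_nat_add)
    qed
    ultimately obtain a b where ab: "block (bi_concat L y) (int L * ?q) (Suc n * L) = a @ block (bi_concat L y) i n @ b"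
      by (rule block_factor)
    have "set (a @ block (bi_concat L y) i n @ b) \<subseteq> dm_alphabet M N"
      and "\<exists>s. word_act (a @ block (bi_concat L y) i n @ b) s \<noteq> None"
      using adm[OF S] unfolding ab by blast+
    then show "set (block (bi_concat L y) i n) \<subseteq> dm_alphabet M N \<and>
        (\<exists>s. word_act (block (bi_concat L y) i n) s \<noteq> None)"
      using word_act_factor[of a "block (bi_concat L y) i n" b] by (simp only: set_append) blast
  qed
  moreover have "concat (replicate k u) \<in> S" if "u \<in> S" "0 < k" for u k
    using that by (intro conc) auto
  ultimately show ?thesis using ne by (auto simp: dyck_motzkin.freely_concatenable_def)
qed

lemma freely_concatenable_opening: "dyck_motzkin.freely_concatenable M N (opening_words M N)"
  by (rule freely_concatenable_of_append[OF opening_words_append])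
     (auto simp: opening_words_def)

lemma freely_concatenable_closing: "dyck_motzkin.freely_concatenable M N (closing_words M N)"
  by (rule freely_concatenable_of_append[OF closing_words_append])
     (auto simp: closing_words_def)

text \<open>
  The mean height per letter, in terms of word probabilities.
\<close>
definition drift :: "nat \<Rightarrow> (dm_symbol list \<Rightarrow> real) \<Rightarrow> real" where
  "drift M c = (\<Sum>i\<in>{1..M}. c [Sym_alpha i] - c [Sym_beta i])"

lemma continuous_on_drift: "continuous_on UNIV (drift M)"
  unfolding drift_def by (intro continuous_on_sum continuous_on_diff continuous_on_product_coordinates)

lemma sym_height_eq_sum:
  assumes "c \<in> dm_alphabet M N"
  shows "real_of_int (sym_height c) = (\<Sum>i\<in>{1..M}. of_bool (c = Sym_alpha i) - of_bool (c = Sym_beta i))"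
  using assms by (auto simp: dm_alphabet_def of_bool_def sum_negf sum.delta sum.delta')

lemma height_append: "height (u @ v) = height u + height v"
  by (simp add: height_def)

lemma take_block: "k \<le> n \<Longrightarrow> take k (block x i n) = block x i k"
  by (simp add: block_def take_map)

lemma height_block:
  assumes x: "x \<in> dyck_motzkin_shift M N"
  shows "real_of_int (height (block x 0 n)) =
    (\<Sum>i\<in>{1..M}. (\<Sum>k<n. of_bool (block x (int k) (length [Sym_alpha i]) = [Sym_alpha i]))
      - (\<Sum>k<n. of_bool (block x (int k) (length [Sym_beta i]) = [Sym_beta i])))"
proof -
  have 1: "block x (int k) (length [c]) = [c] \<longleftrightarrow> x (int k) = c" for k c by (simp add: block_def)
  have "real_of_int (height (block x 0 n)) = (\<Sum>k<n. real_of_int (sym_height (x (int k))))"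
  proof (induction n)
    case (Suc n)
    have "block x 0 (Suc n) = block x 0 n @ [x (int n)]" by (simp add: block_def)
    then show ?case using Suc by (simp add: height_append)
  qed (simp add: block_def)
  also have "\<dots> = (\<Sum>k<n. \<Sum>i\<in>{1..M}. of_bool (x (int k) = Sym_alpha i) - of_bool (x (int k) = Sym_beta i))"
    using dyck_motzkin.letters[OF x] by (intro sum.cong HOL.refl sym_height_eq_sum)
  also have "\<dots> = (\<Sum>i\<in>{1..M}. \<Sum>k<n. of_bool (x (int k) = Sym_alpha i) - of_bool (x (int k) = Sym_beta i))"
    by (rule sum.swap)
  finally show ?thesis unfolding 1 by (simp only: sum_subtractf)
qed

lemma height_average_tendsto_drift:
  assumes x: "x \<in> dyck_motzkin_shift M N"
    and lim: "\<And>w. (\<lambda>n. (\<Sum>i<n. of_bool (block x (int i) (length w) = w)) / real n) \<longlonglongrightarrow> c w"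
  shows "(\<lambda>n. real_of_int (height (block x 0 n)) / real n) \<longlonglongrightarrow> drift M c"
proof -
  have "(\<lambda>n. \<Sum>i\<in>{1..M}. (\<Sum>k<n. of_bool (block x (int k) (length [Sym_alpha i]) = [Sym_alpha i])) / real n
      - (\<Sum>k<n. of_bool (block x (int k) (length [Sym_beta i]) = [Sym_beta i])) / real n) \<longlonglongrightarrow> drift M c"
    unfolding drift_def by (intro tendsto_sum tendsto_diff lim)
  then show ?thesis
    unfolding height_block[OF x] sum_divide_distrib diff_divide_distrib .
qed

text \<open>
  If \<open>H n\<close> grows like \<open>d n\<close> with \<open>d \<ge> 0\<close>, it cannot fall far below its starting value \<open>0\<close>; if \<open>d \<le> 0\<close>, it
  cannot end far above its earlier values. In both cases the finitely many times before the
  averages settle contribute a constant only.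
\<close>
lemma sublinear_dips:
  fixes H :: "nat \<Rightarrow> real"
  assumes lim: "(\<lambda>n. H n / real n) \<longlonglongrightarrow> d" and e: "0 < e"
  shows "0 \<le> d \<Longrightarrow> \<forall>\<^sub>F n in sequentially. \<forall>k\<le>n. - H k \<le> e * real n"
    and "d \<le> 0 \<Longrightarrow> \<forall>\<^sub>F n in sequentially. \<forall>k\<le>n. H n - H k \<le> e * real n"
proof -
  have "0 < e / 4" using e by simp
  from tendstoD[OF lim this] obtain m where m: "\<And>n. m \<le> n \<Longrightarrow> dist (H n / real n) d < e / 4"
    unfolding eventually_sequentially by blast
  have near: "\<bar>H n - d * real n\<bar> \<le> e / 4 * real n" if "Suc m \<le> n" for n
  proof -
    have n: "0 < real n" using that by simp
    have "\<bar>H n / real n - d\<bar> \<le> e / 4" using m[of n] that by (simp add: dist_real_def)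
    then have "\<bar>H n / real n - d\<bar> * real n \<le> e / 4 * real n" by (rule mult_right_mono) simp
    moreover have "\<bar>H n / real n - d\<bar> * real n = \<bar>H n - d * real n\<bar>"
      using n by (simp add: abs_mult_pos left_diff_distrib)
    ultimately show ?thesis by simp
  qed
  define B where "B = (\<Sum>k\<le>m. \<bar>H k\<bar>)"
  have B: "\<bar>H k\<bar> \<le> B" if "k \<le> m" for k
    unfolding B_def using that by (intro member_le_sum) auto
  have big: "\<forall>\<^sub>F n in sequentially. 4 * B / e < real n"
    using filterlim_real_sequentially by (simp add: filterlim_at_top_dense)
  have dip: "- H k \<le> e / 4 * real n - d * real k \<or> - H k \<le> e / 4 * real n" if n: "4 * B / e < real n" "k \<le> n" for k n
  proof (cases "k \<le> m")
    case True
    have "B \<le> e / 4 * real n" using n(1) e by (simp add: field_simps)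
    then show ?thesis using B[OF True] by linarith
  next
    case False
    have "e / 4 * real k \<le> e / 4 * real n" using e n(2) by simp
    then show ?thesis using near[of k] False by linarith
  qed
  show "\<forall>\<^sub>F n in sequentially. \<forall>k\<le>n. - H k \<le> e * real n" if "0 \<le> d"
    using big
  proof (rule eventually_mono, intro allI impI)
    fix n k assume n: "4 * B / e < real n" and k: "k \<le> n"
    have "0 \<le> d * real k" "0 \<le> e * real n" using that e by simp_all
    then show "- H k \<le> e * real n" using dip[OF n k] by linarith
  qed
  show "\<forall>\<^sub>F n in sequentially. \<forall>k\<le>n. H n - H k \<le> e * real n" if d: "d \<le> 0"
    using eventually_conj[OF big eventually_ge_at_top[of "Suc m"]]
  proof (rule eventually_mono, intro allI impI)
    fix n k assume n: "4 * B / e < real n \<and> Suc m \<le> n" and k: "k \<le> n"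
    have "d * real n \<le> d * real k" "d * real n \<le> 0" using d k by (simp_all add: mult_left_mono_neg mult_nonpos_nonneg)
    moreover have "0 \<le> e * real n" using e by simp
    ultimately show "H n - H k \<le> e * real n"
      using dip[of n k] near[of n] n k by linarith
  qed
qed

text \<open>
  Here \<open>k\<close> is the position of the deepest dip of the height. The minimal stack is no larger than
  the dip, and what remains on it at the end is no more than the rise after the dip.
\<close>
lemma block_min_stack:
  assumes x: "x \<in> dyck_motzkin_shift M N"
  obtains s t k where "k \<le> n" "word_act (block x 0 n) s = Some t"
    "set s \<subseteq> {1..M}" "set t \<subseteq> {1..M}"
    "int (length s) \<le> - height (block x 0 k)"
    "int (length t) \<le> height (block x 0 n) - height (block x 0 k)"
proof -
  let ?w = "block x 0 n"
  let ?D = "(\<lambda>k. - height (block x 0 k)) ` {..n}"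
  have w: "set ?w \<subseteq> dm_alphabet M N" "\<exists>s. word_act ?w s \<noteq> None"
    using x unfolding dyck_motzkin_shift_iff by blast+
  have "Max ?D \<in> ?D" by (rule Max_in) auto
  then obtain k where "Max ?D = - height (block x 0 k)" "k \<in> {..n}" by (rule imageE) blast
  then have k: "k \<le> n" "Max ?D = - height (block x 0 k)" by simp_all
  have max: "- height (block x 0 j) \<le> Max ?D" if "j \<le> n" for j
    using that by (intro Max_ge) auto
  have "0 \<le> Max ?D" using max[of 0] by (simp add: block_def)
  define p where "p = nat (Max ?D)"
  have p: "int p = Max ?D" using \<open>0 \<le> Max ?D\<close> by (simp add: p_def)
  obtain s0 where s0: "set s0 \<subseteq> {1..M}" "word_act ?w s0 \<noteq> None"
    using w word_act_index_stack by metis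
  then obtain t0 where t0: "word_act ?w s0 = Some t0" by blast
  have "- height (take j ?w) \<le> int p" if "j \<le> length ?w" for j
    using max[of j] that by (simp add: take_block p)
  from word_act_min_stack[OF t0 this]
  obtain s t where st: "length s \<le> p" "set s \<subseteq> set s0" "word_act ?w s = Some t"
    "int (length t) = int (length s) + height ?w" .
  show ?thesis
  proof (rule that[of k s t])
    show "set s \<subseteq> {1..M}" using st s0 by blast
    then show "set t \<subseteq> {1..M}" using word_act_indices[OF st(3) w(1)] by blast
    show "int (length s) \<le> - height (block x 0 k)" using st(1) p k(2) by linarith
    then show "int (length t) \<le> height ?w - height (block x 0 k)" using st(4) by linarith
  qed (use k st in simp_all)
qed

text \<open>
  A block of a generic point is completed by the \<open>\<alpha>\<close>'s that build its minimal stack, by the \<open>\<beta>\<close>'s that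
  empty its final stack, or by both. The sign of the drift decides which of these completions are
  short compared with the block.
\<close>
lemma drift_approximation:
  assumes c: "c \<in> word_prob (dyck_motzkin_shift M N) ` ergodic_measures left_shift (dyck_motzkin_shift M N)"
  shows "0 \<le> drift M c \<Longrightarrow> c \<in> box_closure (orbit_freq ` opening_words M N)"
    and "drift M c \<le> 0 \<Longrightarrow> c \<in> box_closure (orbit_freq ` closing_words M N)"
    and "drift M c = 0 \<Longrightarrow> c \<in> box_closure (orbit_freq ` (opening_words M N \<inter> closing_words M N))"
proof -
  obtain x where x: "x \<in> dyck_motzkin_shift M N"
    and lim: "\<And>w. (\<lambda>n. (\<Sum>i<n. of_bool (block x (int i) (length w) = w)) / real n) \<longlonglongrightarrow> c w"
    using c dyck_motzkin.generic_point by blast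
  define H where "H n = real_of_int (height (block x 0 n))" for n
  have H: "(\<lambda>n. H n / real n) \<longlonglongrightarrow> drift M c"
    unfolding H_def by (rule height_average_tendsto_drift[OF x lim])
  have w: "set (block x 0 n) \<subseteq> dm_alphabet M N" for n
    using x unfolding dyck_motzkin_shift_iff by blast
  have ext: "\<exists>a b. word_act (a @ block x 0 n) [] \<noteq> None \<and> (\<exists>s. word_act (block x 0 n @ b) s = Some []) \<and>
      word_act (a @ block x 0 n @ b) [] = Some [] \<and>
      set a \<subseteq> dm_alphabet M N \<and> set b \<subseteq> dm_alphabet M N \<and>
      (\<exists>k\<le>n. real (length a) \<le> - H k \<and> real (length b) \<le> H n - H k)" for n
  proof -
    obtain s t k where k: "k \<le> n" and st: "word_act (block x 0 n) s = Some t"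
      "set s \<subseteq> {1..M}" "set t \<subseteq> {1..M}"
      and len: "int (length s) \<le> - height (block x 0 k)"
      "int (length t) \<le> height (block x 0 n) - height (block x 0 k)"
      using block_min_stack[OF x] by metis
    let ?a = "map Sym_alpha (rev s)" and ?b = "map Sym_beta t"
    have "word_act ?a [] = Some s" by (simp only: word_act_alphas) simp
    moreover have "word_act ?b t = Some []" using word_act_betas[of t "[]"] by simp
    ultimately have "word_act (?a @ block x 0 n) [] = Some t" "word_act (block x 0 n @ ?b) s = Some []"
      "word_act (?a @ block x 0 n @ ?b) [] = Some []"
      using st(1) by (simp_all only: word_act_append bind.bind_lunit)
    moreover have "set ?a \<subseteq> dm_alphabet M N" "set ?b \<subseteq> dm_alphabet M N"
      using st(2,3) by (auto simp: dm_alphabet_def)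
    moreover have "real (length ?a) \<le> - H k" "real (length ?b) \<le> H n - H k"
      using len unfolding H_def by simp_all
    ultimately show ?thesis using k by blast
  qed
  show "c \<in> box_closure (orbit_freq ` opening_words M N)" if d: "0 \<le> drift M c"
  proof (rule dyck_motzkin.generic_point_box_closure[OF lim])
    fix e :: real assume e: "0 < e"
    from eventually_conj[OF sublinear_dips(1)[OF H e d] eventually_gt_at_top[of 0]]
    show "\<forall>\<^sub>F n in sequentially. \<exists>a b. a @ block x 0 n @ b \<in> opening_words M N \<and>
      real (length a + length b) \<le> e * real n"
    proof (rule eventually_mono)
      fix n assume n: "(\<forall>k\<le>n. - H k \<le> e * real n) \<and> 0 < n"
      obtain a b k where ab: "word_act (a @ block x 0 n) [] \<noteq> None" "set a \<subseteq> dm_alphabet M N"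
        "k \<le> n" "real (length a) \<le> - H k"
        using ext[of n] by blast
      have "- H k \<le> e * real n" using n ab(3) by blast
      then show "\<exists>a b. a @ block x 0 n @ b \<in> opening_words M N \<and> real (length a + length b) \<le> e * real n"
        using ab w[of n] n by (intro exI[of _ a] exI[of _ "[]"]) (auto simp: opening_words_def block_def)
    qed
  qed
  show "c \<in> box_closure (orbit_freq ` closing_words M N)" if d: "drift M c \<le> 0"
  proof (rule dyck_motzkin.generic_point_box_closure[OF lim])
    fix e :: real assume e: "0 < e"
    from eventually_conj[OF sublinear_dips(2)[OF H e d] eventually_gt_at_top[of 0]]
    show "\<forall>\<^sub>F n in sequentially. \<exists>a b. a @ block x 0 n @ b \<in> closing_words M N \<and>
      real (length a + length b) \<le> e * real n"
    proof (rule eventually_mono)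
      fix n assume n: "(\<forall>k\<le>n. H n - H k \<le> e * real n) \<and> 0 < n"
      obtain a b k where ab: "\<exists>s. word_act (block x 0 n @ b) s = Some []" "set b \<subseteq> dm_alphabet M N"
        "k \<le> n" "real (length b) \<le> H n - H k"
        using ext[of n] by blast
      have "H n - H k \<le> e * real n" using n ab(3) by blast
      then show "\<exists>a b. a @ block x 0 n @ b \<in> closing_words M N \<and> real (length a + length b) \<le> e * real n"
        using ab w[of n] n by (intro exI[of _ "[]"] exI[of _ b]) (auto simp: closing_words_def block_def)
    qed
  qed
  show "c \<in> box_closure (orbit_freq ` (opening_words M N \<inter> closing_words M N))" if d: "drift M c = 0"
  proof (rule dyck_motzkin.generic_point_box_closure[OF lim])
    fix e :: real assume e: "0 < e"
    then have e2: "0 < e / 2" by simp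
    have "\<forall>\<^sub>F n in sequentially. (\<forall>k\<le>n. - H k \<le> e / 2 * real n) \<and> (\<forall>k\<le>n. H n - H k \<le> e / 2 * real n) \<and> 0 < n"
      by (intro eventually_conj sublinear_dips[OF H e2] eventually_gt_at_top) (simp_all add: d)
    then show "\<forall>\<^sub>F n in sequentially. \<exists>a b. a @ block x 0 n @ b \<in> opening_words M N \<inter> closing_words M N \<and>
      real (length a + length b) \<le> e * real n"
    proof (rule eventually_mono)
      fix n assume n: "(\<forall>k\<le>n. - H k \<le> e / 2 * real n) \<and> (\<forall>k\<le>n. H n - H k \<le> e / 2 * real n) \<and> 0 < n"
      obtain a b k where ab: "word_act (a @ block x 0 n @ b) [] = Some []"
        "set a \<subseteq> dm_alphabet M N" "set b \<subseteq> dm_alphabet M N"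
        "k \<le> n" "real (length a) \<le> - H k" "real (length b) \<le> H n - H k"
        using ext[of n] by blast
      have "- H k \<le> e / 2 * real n" "H n - H k \<le> e / 2 * real n" using n ab(4) by blast+
      then have "real (length a + length b) \<le> e * real n" using ab(5,6) by simp
      moreover have "a @ block x 0 n @ b \<in> opening_words M N \<inter> closing_words M N"
        using ab w[of n] n by (auto simp: opening_words_def closing_words_def block_def)
      ultimately show "\<exists>a b. a @ block x 0 n @ b \<in> opening_words M N \<inter> closing_words M N \<and>
        real (length a + length b) \<le> e * real n" by blast
    qed
  qed
qed

lemma box_closure_mono: "Q \<subseteq> Q' \<Longrightarrow> box_closure Q \<subseteq> box_closure Q'"
  unfolding box_closure_def by blast

theorem theoremB:
  fixes M N :: nat
  assumes "M \<ge> 2"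
  shows "path_connected_space (ergodic_measure_space left_shift (dyck_motzkin_shift M N))
    \<and> locally_path_connected_space (ergodic_measure_space left_shift (dyck_motzkin_shift M N))"
proof -
  let ?X = "dyck_motzkin_shift M N"
  let ?E = "word_prob ?X ` ergodic_measures left_shift ?X"
  have neutral: "[Sym_alpha 1, Sym_beta 1] \<in> opening_words M N \<inter> closing_words M N"
    using assms by (auto simp: opening_words_def closing_words_def dm_alphabet_def intro: exI[of _ "[]"])
  have "path_connected_space (top_of_set ?E) \<and> locally_path_connected_space (top_of_set ?E)"
  proof (rule connected_by_two_classes[of ?E "orbit_freq ` opening_words M N" "orbit_freq ` closing_words M N" "drift M"])
    show "nearly_affinely_connected ?E (orbit_freq ` opening_words M N)"
      by (rule dyck_motzkin.nearly_affinely_connected_orbits[OF freely_concatenable_opening])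
    show "nearly_affinely_connected ?E (orbit_freq ` closing_words M N)"
      by (rule dyck_motzkin.nearly_affinely_connected_orbits[OF freely_concatenable_closing])
    show "orbit_freq ` opening_words M N \<subseteq> ?E"
      by (rule dyck_motzkin.orbit_freq_ergodic[OF freely_concatenable_opening])
    show "orbit_freq ` closing_words M N \<subseteq> ?E"
      by (rule dyck_motzkin.orbit_freq_ergodic[OF freely_concatenable_closing])
    show "continuous_on UNIV (drift M)" by (rule continuous_on_drift)
    show "orbit_freq ` opening_words M N \<inter> orbit_freq ` closing_words M N \<noteq> {}" using neutral by blast
    fix c assume c: "c \<in> ?E"
    show "c \<in> box_closure (orbit_freq ` opening_words M N)" if "0 \<le> drift M c"
      by (rule drift_approximation(1)[OF c that])
    show "c \<in> box_closure (orbit_freq ` closing_words M N)" if "drift M c \<le> 0"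
      by (rule drift_approximation(2)[OF c that])
    show "c \<in> box_closure (orbit_freq ` opening_words M N \<inter> orbit_freq ` closing_words M N)" if "drift M c = 0"
      using drift_approximation(3)[OF c that] box_closure_mono[OF image_Int_subset] by blast
  qed
  then show ?thesis
    using homeomorphic_path_connected_space[OF dyck_motzkin.ergodic_space_homeomorphic, of M N]
      homeomorphic_locally_path_connected_space[OF dyck_motzkin.ergodic_space_homeomorphic, of M N]
    by simp
qed

end
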